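(* Assume that the coefficients of the channel satisfy $\sum_{\ell=1}^{\infty}\alpha_\ell<\infty$ and that $\{U_k\}$ is a sequence of IID, zero-mean, unit-variance Gaussian random variables. Then, irrespective of whether feedback is available or not, the capacity per unit cost is $$\dot C_{\mathrm{FB}}(0)=\dot C(0)=\lim_{\mathrm{SNR}\downarrow0}\frac{C(\mathrm{SNR})}{\mathrm{SNR}}=\frac12\left(1+\sum_{\ell=1}^{\infty}\alpha_\ell\right),$$ where $\dot C(0)=\sup_{\mathrm{SNR}>0}C(\mathrm{SNR})/\mathrm{SNR}$ and $\dot C_{\mathrm{FB}}(0)=\sup_{\mathrm{SNR}>0}C_{\mathrm{FB}}(\mathrm{SNR})/\mathrm{SNR}$.
   Context: Notation: $A_m^n$ stands for $A_m,\dots,A_n$; $\log$ is the natural logarithm. Channel model. Fix $\sigma^2>0$ and real coefficients $\alpha_\ell$, $\ell\in\{1,2,\dots\}$, with $\alpha_\ell\ge 0$ and $\sup_{\ell\ge1}\alpha_\ell<\infty$. Let $\{U_k\}$ be the noise process (whose law is specified in the claim), drawn independently of the message $M$. Conditional on inputs $X_1=x_1,\dots,X_k=x_k\in\mathbb{R}$, the time-$k$ channel output is $$Y_k=x_k+\sqrt{\sigma^2+\sum_{\ell=1}^{k-1}\alpha_{k-\ell}x_\ell^2}\;\cdot U_k,\qquad k=1,2,\dots$$ Codes. A code of block-length $n$ has a finite message set $\mathcal{M}_n$, with the message $M$ uniform on $\mathcal{M}_n$. Without feedback the encoder is a map $\phi_n:\mathcal{M}_n\to\mathbb{R}^n$ with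 $X_1^n=\phi_n(M)$. With feedback the encoder consists of maps $\varphi_n^{(k)}:\mathcal{M}_n\times\mathbb{R}^{k-1}\to\mathbb{R}$ with $X_k=\varphi_n^{(k)}(M,Y_1^{k-1})$, $k=1,\dots,n$. In both cases the decoder is a map $\psi_n:\mathbb{R}^n\to\mathcal{M}_n$ with $\hat M=\psi_n(Y_1^n)$. The encoder must satisfy the average-power constraint $\frac1n\sum_{k=1}^n\mathsf{E}[X_k^2]\le\mathsf{P}$ (expectation over the message and the channel outputs). With $\sigma^2$ fixed, $\mathrm{SNR}=\mathsf{P}/\sigma^2$. Capacity. The rate of a code is $\frac1n\log|\mathcal{M}_n|$ (nats per channel use). A rate $R$ is achievable if there is a sequence of codes satisfying the power constraint with rates at least $R$ asymptotically (i.e. $\liminf_n\frac1n\log|\mathcal{M}_n|\ge R$) and $\Pr(\hat M\ne M)\to0$ as $n\to\infty$. $C(\mathrm{SNR})$ is the supremum of achievable rates without feedback, and $C_{\mathrm{FB}}(\mathrm{SNR})$ is the supremum of achievable rates with feedback. *)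

theory Defs
  imports "HOL-Probability.Probability"
begin

text \<open>
  Time indices start at 1: of sequences such as \<open>\<alpha>\<close>, \<open>x\<close>, \<open>U\<close> only the entries with
  index at least 1 matter. Vectors in $R^k$ are extensional functions on \<open>{1..k}\<close>, that is,
  elements of the space of \<open>PiM {1..k} (\<lambda>_. borel)\<close>. The message set is \<open>{..<m}\<close> with \<open>m > 0\<close>,
  and \<open>s2\<close> is the constant noise variance.
\<close>

definition channel_output ::
  "real \<Rightarrow> (nat \<Rightarrow> real) \<Rightarrow> (nat \<Rightarrow> real) \<Rightarrow> (nat \<Rightarrow> real) \<Rightarrow> nat \<Rightarrow> real" where
  "channel_output s2 \<alpha> u x k = x k + sqrt (s2 + (\<Sum>l\<in>{1..<k}. \<alpha> (k - l) * (x l)\<^sup>2)) * u k"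

lemma channel_output_cong [fundef_cong]:
  assumes "s2 = s2'" "\<alpha> = \<alpha>'" "u = u'" "k = k'" "\<And>l. l \<le> k' \<Longrightarrow> x l = x' l"
  shows "channel_output s2 \<alpha> u x k = channel_output s2' \<alpha>' u' x' k'"
  unfolding channel_output_def using assms by (auto intro!: sum.cong)

lemma restrict_fundef_cong [fundef_cong]:
  assumes "A = B" "\<And>x. x \<in> B \<Longrightarrow> f x = g x"
  shows "restrict f A = restrict g B"
  using assms by (auto simp: restrict_def)

text \<open>
  The inputs produced by a feedback encoder \<open>\<phi>\<close> when the message is \<open>i\<close> and the noise sequence
  is \<open>u\<close>: the \<open>k\<close>-th input is a function of the message and of the outputs at times
  \<open>1, \<dots>, k - 1\<close>.
\<close>

function fb_input ::
  "real \<Rightarrow> (nat \<Rightarrow> real) \<Rightarrow> (nat \<Rightarrow> nat \<Rightarrow> (nat \<Rightarrow> real) \<Rightarrow> real) \<Rightarrow> nat \<Rightarrow> (nat \<Rightarrow> real) \<Rightarrow> nat \<Rightarrow> real" where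
  "fb_input s2 \<alpha> \<phi> i u k =
     \<phi> k i (\<lambda>j\<in>{1..<k}. channel_output s2 \<alpha> u (fb_input s2 \<alpha> \<phi> i u) j)"
  by pat_completeness auto
termination
  by (relation "Wellfounded.measure (\<lambda>(s2, \<alpha>, \<phi>, i, u, k). k)") auto

declare fb_input.simps [simp del]

text \<open>
  Message and noise are independent, the message being uniform. Below, \<open>N\<close> is the probability
  space carrying the noise process \<open>U\<close>, and \<open>X i u k\<close> is the input at time \<open>k\<close> when the message
  is \<open>i\<close> and the noise sequence is \<open>u\<close>.
\<close>

definition message_noise_space :: "nat \<Rightarrow> 'w measure \<Rightarrow> (nat \<times> 'w) measure" where
  "message_noise_space m N = uniform_count_measure {..<m} \<Otimes>\<^sub>M N"

text \<open>
  The second moments are nonnegative Lebesgue integrals, so that inputs of infinite power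
  violate the constraint.
\<close>

definition power_constraint ::
  "'w measure \<Rightarrow> (nat \<Rightarrow> 'w \<Rightarrow> real) \<Rightarrow> nat \<Rightarrow> nat \<Rightarrow> (nat \<Rightarrow> (nat \<Rightarrow> real) \<Rightarrow> nat \<Rightarrow> real) \<Rightarrow> real \<Rightarrow> bool" where
  "power_constraint N U n m X P \<longleftrightarrow>
     (\<Sum>k=1..n. \<integral>\<^sup>+ (i, w). ennreal ((X i (\<lambda>t. U t w) k)\<^sup>2) \<partial>message_noise_space m N) / of_nat n
       \<le> ennreal P"

definition error_prob ::
  "'w measure \<Rightarrow> (nat \<Rightarrow> 'w \<Rightarrow> real) \<Rightarrow> real \<Rightarrow> (nat \<Rightarrow> real) \<Rightarrow> nat \<Rightarrow> nat \<Rightarrow>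
    (nat \<Rightarrow> (nat \<Rightarrow> real) \<Rightarrow> nat \<Rightarrow> real) \<Rightarrow> ((nat \<Rightarrow> real) \<Rightarrow> nat) \<Rightarrow> real" where
  "error_prob N U s2 \<alpha> n m X \<psi> =
     measure (message_noise_space m N)
       {(i, w) \<in> space (message_noise_space m N).
          \<psi> (\<lambda>k\<in>{1..n}. channel_output s2 \<alpha> (\<lambda>t. U t w) (X i (\<lambda>t. U t w)) k) \<noteq> i}"

definition decoder :: "nat \<Rightarrow> nat \<Rightarrow> ((nat \<Rightarrow> real) \<Rightarrow> nat) \<Rightarrow> bool" where
  "decoder n m \<psi> \<longleftrightarrow> \<psi> \<in> measurable (PiM {1..n} (\<lambda>_. borel)) (count_space {..<m})"

definition fb_encoder :: "nat \<Rightarrow> nat \<Rightarrow> (nat \<Rightarrow> nat \<Rightarrow> (nat \<Rightarrow> real) \<Rightarrow> real) \<Rightarrow> bool" where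
  "fb_encoder n m \<phi> \<longleftrightarrow>
     (\<forall>k\<in>{1..n}. \<forall>i<m. \<phi> k i \<in> borel_measurable (PiM {1..<k} (\<lambda>_. borel)))"

definition achievable ::
  "'w measure \<Rightarrow> (nat \<Rightarrow> 'w \<Rightarrow> real) \<Rightarrow> real \<Rightarrow> (nat \<Rightarrow> real) \<Rightarrow> real \<Rightarrow> real \<Rightarrow> bool" where
  "achievable N U s2 \<alpha> P R \<longleftrightarrow>
     (\<exists>(m :: nat \<Rightarrow> nat) (\<phi> :: nat \<Rightarrow> nat \<Rightarrow> nat \<Rightarrow> real) \<psi>.
        (\<forall>n\<ge>1. m n > 0 \<and> decoder n (m n) (\<psi> n) \<and>
           power_constraint N U n (m n) (\<lambda>i u. \<phi> n i) P) \<and>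
        ereal R \<le> liminf (\<lambda>n. ereal (ln (real (m n)) / real n)) \<and>
        (\<lambda>n. error_prob N U s2 \<alpha> n (m n) (\<lambda>i u. \<phi> n i) (\<psi> n)) \<longlonglongrightarrow> 0)"

definition achievable_fb ::
  "'w measure \<Rightarrow> (nat \<Rightarrow> 'w \<Rightarrow> real) \<Rightarrow> real \<Rightarrow> (nat \<Rightarrow> real) \<Rightarrow> real \<Rightarrow> real \<Rightarrow> bool" where
  "achievable_fb N U s2 \<alpha> P R \<longleftrightarrow>
     (\<exists>(m :: nat \<Rightarrow> nat) \<phi> \<psi>.
        (\<forall>n\<ge>1. m n > 0 \<and> fb_encoder n (m n) (\<phi> n) \<and> decoder n (m n) (\<psi> n) \<and>
           power_constraint N U n (m n) (fb_input s2 \<alpha> (\<phi> n)) P) \<and>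
        ereal R \<le> liminf (\<lambda>n. ereal (ln (real (m n)) / real n)) \<and>
        (\<lambda>n. error_prob N U s2 \<alpha> n (m n) (fb_input s2 \<alpha> (\<phi> n)) (\<psi> n)) \<longlonglongrightarrow> 0)"

text \<open>
  Capacities are extended reals, so that the suprema are meaningful without a prior boundedness
  proof. The argument \<open>snr\<close> corresponds to the power \<open>snr * s2\<close>.
\<close>

definition capacity ::
  "'w measure \<Rightarrow> (nat \<Rightarrow> 'w \<Rightarrow> real) \<Rightarrow> real \<Rightarrow> (nat \<Rightarrow> real) \<Rightarrow> real \<Rightarrow> ereal" where
  "capacity N U s2 \<alpha> snr = Sup {ereal R |R. achievable N U s2 \<alpha> (snr * s2) R}"

definition capacity_fb ::
  "'w measure \<Rightarrow> (nat \<Rightarrow> 'w \<Rightarrow> real) \<Rightarrow> real \<Rightarrow> (nat \<Rightarrow> real) \<Rightarrow> real \<Rightarrow> ereal" where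
  "capacity_fb N U s2 \<alpha> snr = Sup {ereal R |R. achievable_fb N U s2 \<alpha> (snr * s2) R}"

definition capacity_per_unit_cost :: "(real \<Rightarrow> ereal) \<Rightarrow> ereal" where
  "capacity_per_unit_cost C = (SUP snr\<in>{0<..}. C snr / ereal snr)"

end

theory Submission
  imports Defs
begin

text \<open>
  Converse: for a fixed message, compare the law of the outputs with white Gaussian noise of
  variance $\sigma^2$, under which decoding is pure guessing. Dropping the logarithms of the
  (enlarged) noise variances, the expected log-likelihood ratio is at most
  $\frac{1}{2\sigma^2}\sum_k (E[X_k^2] + \sum_{l<k} \alpha_{k-l} E[X_l^2])$, and a unit of input energy
  is counted at most $1 + \sum_l \alpha_l$ times.

  Achievability: a strong isolated pulse $\xi$ raises the signal at its own instant and the noise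
  variance at the following ones; its divergence from silence is about
  $\frac{\xi^2}{2\sigma^2}(1 + \sum_l \alpha_l)$, up to terms that are $o(\xi^2)$. Pulse-position modulation
  with about $e^{K D}$ positions of $K$ pulses each, $D$ being this divergence, is detected with small error
  probability uniformly in the heat left by earlier blocks. Given the inputs, block errors are
  independent, so a Gilbert--Varshamov code over the blocks corrects them at a negligible loss of rate.
\<close>

section \<open>Gaussian integrals and the message space\<close>

text \<open>The noise variance in a block depends on everything sent before, so the detector cannot
  form the exact likelihood ratio of a slot. One fixed statistic replaces it. Its exponential
  moments need only one-sided information: the variance is at most \<open>v0\<close> at silent
  instants and at pulses, and at least \<open>\<alpha> i * \<xi>\<^sup>2\<close> at distance
  \<open>i\<close> after a pulse. The pulse must be strong because a variance raised by the factor
  \<open>1 + x\<close>, with \<open>x\<close> proportional to \<open>\<xi>\<^sup>2\<close>, has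
  divergence \<open>(x - ln (1 + x)) / 2\<close>: this is of second order for small
  \<open>x\<close>, and the logarithm becomes negligible only for large \<open>x\<close>. Low
  average power is then met by making pulses rare, and their position among many slots carries the
  information. At a fixed SNR the numbers \<open>M\<close> and \<open>K\<close> are fixed, so the
  error probability of a block is small but does not vanish as the block-length grows; this is the
  reason for the outer code. Its loss per block is \<open>2 * \<rho> * ln M + ln 2\<close>, a small
  fraction of \<open>ln M\<close> once \<open>\<rho>\<close> is small and \<open>M\<close> is
  large.\<close>

lemma nn_integral_message_noise_space:
  fixes N :: "'w measure" and f :: "nat \<Rightarrow> 'w \<Rightarrow> ennreal"
  assumes "prob_space N" "m > 0" and f: "\<And>i. i < m \<Longrightarrow> f i \<in> borel_measurable N"
  shows "(\<integral>\<^sup>+ (i, w). f i w \<partial>message_noise_space m N) = (\<Sum>i<m. \<integral>\<^sup>+ w. f i w \<partial>N) / of_nat m"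
proof -
  interpret prob_space N by fact
  have sets_eq: "sets (uniform_count_measure {..<m} \<Otimes>\<^sub>M N) = sets (count_space {..<m} \<Otimes>\<^sub>M N)"
    by (intro sets_pair_measure_cong) (simp_all add: sets_uniform_count_measure)
  have "(\<lambda>(i, w). f i w) \<in> borel_measurable (count_space {..<m} \<Otimes>\<^sub>M N)"
    by (rule measurable_pair_measure_countable1) (auto intro: f)
  then have meas: "(\<lambda>(i, w). f i w) \<in> borel_measurable (uniform_count_measure {..<m} \<Otimes>\<^sub>M N)"
    using measurable_cong_sets[OF sets_eq refl] by blast
  have "(\<integral>\<^sup>+ (i, w). f i w \<partial>message_noise_space m N)
      = (\<integral>\<^sup>+ i. (\<integral>\<^sup>+ w. f i w \<partial>N) \<partial>uniform_count_measure {..<m})"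
    unfolding message_noise_space_def using nn_integral_fst[OF meas] by simp
  also have "\<dots> = (\<Sum>i<m. (\<integral>\<^sup>+ w. f i w \<partial>N) * ennreal (1 / real m))"
    unfolding uniform_count_measure_def
    by (subst nn_integral_point_measure_finite) (auto simp: mult.commute)
  also have "\<dots> = (\<Sum>i<m. (\<integral>\<^sup>+ w. f i w \<partial>N)) * ennreal (1 / real m)"
    by (simp add: sum_distrib_right)
  also have "ennreal (1 / real m) = 1 / of_nat m"
    using \<open>m > 0\<close> by (metis divide_ennreal ennreal_1 ennreal_of_nat_eq_real_of_nat of_nat_0_less_iff zero_le_one)
  finally show ?thesis
    by (simp add: ennreal_times_divide)
qed

lemma prob_space_message_noise_space:
  assumes "prob_space N" "m > 0"
  shows "prob_space (message_noise_space m N)"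
proof -
  interpret N: prob_space N by fact
  interpret u: prob_space "uniform_count_measure {..<m}"
    using \<open>m > 0\<close> by (intro prob_space_uniform_count_measure) auto
  interpret pair_prob_space "uniform_count_measure {..<m}" N ..
  show ?thesis unfolding message_noise_space_def by (rule prob_space_axioms)
qed

lemma measure_message_noise_space:
  fixes N :: "'w measure"
  assumes "prob_space N" "m > 0" and P: "\<And>i. i < m \<Longrightarrow> {w \<in> space N. P i w} \<in> sets N"
  shows "measure (message_noise_space m N) {(i, w) \<in> space (message_noise_space m N). P i w}
     = (\<Sum>i<m. measure N {w \<in> space N. P i w}) / real m"
proof -
  interpret prob_space N by fact
  interpret mn: prob_space "message_noise_space m N" by (rule prob_space_message_noise_space) fact+
  let ?M = "message_noise_space m N"
  let ?S = "{(i, w) \<in> space ?M. P i w}"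
  have sp: "space ?M = {..<m} \<times> space N"
    by (simp add: message_noise_space_def space_pair_measure space_uniform_count_measure)
  have S_eq: "?S = (\<Union>i<m. {i} \<times> {w \<in> space N. P i w})"
    unfolding sp by auto
  have S: "?S \<in> sets ?M"
    unfolding S_eq unfolding message_noise_space_def using P
    by (intro sets.countable_UN' pair_measureI) (auto simp: sets_uniform_count_measure)
  have "emeasure ?M ?S = (\<integral>\<^sup>+ (i, w). indicator {w \<in> space N. P i w} w \<partial>?M)"
    by (subst nn_integral_indicator[OF S, symmetric], intro nn_integral_cong)
       (auto simp: sp indicator_def)
  also have "\<dots> = (\<Sum>i<m. emeasure N {w \<in> space N. P i w}) / of_nat m"
    using P by (subst nn_integral_message_noise_space) (auto intro!: assms)
  also have "\<dots> = ennreal ((\<Sum>i<m. measure N {w \<in> space N. P i w}) / real m)"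
    using \<open>m > 0\<close> by (simp add: emeasure_eq_measure sum_nonneg ennreal_of_nat_eq_real_of_nat divide_ennreal)
  finally show ?thesis
    by (simp add: mn.emeasure_eq_measure sum_nonneg)
qed

section \<open>Integrals against the standard normal law\<close>

definition std_normal :: "real measure" where
  "std_normal = density lborel (\<lambda>x. ennreal (std_normal_density x))"

lemma sets_std_normal [measurable_cong, simp]: "sets std_normal = sets borel"
  by (simp add: std_normal_def)

lemma space_std_normal [simp]: "space std_normal = UNIV"
  by (simp add: std_normal_def)

lemma prob_space_std_normal: "prob_space std_normal"
  unfolding std_normal_def by (rule prob_space_normal_density) simp

lemma nn_integral_std_normal:
  "f \<in> borel_measurable borel \<Longrightarrow>
    (\<integral>\<^sup>+ x. f x \<partial>std_normal) = (\<integral>\<^sup>+ x. ennreal (std_normal_density x) * f x \<partial>lborel)"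
  unfolding std_normal_def by (subst nn_integral_density) auto

lemma nn_integral_normal_density: "\<sigma> > 0 \<Longrightarrow> (\<integral>\<^sup>+ x. ennreal (normal_density \<mu> \<sigma> x) \<partial>lborel) = 1"
  by (subst nn_integral_eq_integral) auto

lemma nn_integral_std_normal_exp:
  "(\<integral>\<^sup>+ x. ennreal (exp (c * x)) \<partial>std_normal) = ennreal (exp (c\<^sup>2 / 2))"
proof -
  have "(\<integral>\<^sup>+ x. ennreal (exp (c * x)) \<partial>std_normal)
      = (\<integral>\<^sup>+ x. ennreal (exp (c\<^sup>2 / 2)) * ennreal (normal_density c 1 x) \<partial>lborel)"
    by (subst nn_integral_std_normal)
       (auto simp: normal_density_def ennreal_mult'[symmetric] mult_exp_exp power2_eq_square algebra_simps
         add_divide_distrib diff_divide_distrib intro!: nn_integral_cong)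
  then show ?thesis
    by (simp add: nn_integral_cmult nn_integral_normal_density)
qed

lemma nn_integral_std_normal_exp_square:
  assumes "c > -1"
  shows "(\<integral>\<^sup>+ x. ennreal (exp (- c * x\<^sup>2 / 2)) \<partial>std_normal) = ennreal (1 / sqrt (1 + c))"
proof -
  have *: "std_normal_density x * exp (- c * x\<^sup>2 / 2) = 1 / sqrt (1 + c) * normal_density 0 (1 / sqrt (1 + c)) x"
    for x :: real
  proof -
    have "- x\<^sup>2 / 2 + - c * x\<^sup>2 / 2 = - (x - 0)\<^sup>2 / (2 * (1 / sqrt (1 + c))\<^sup>2)"
      using assms by (simp add: power_divide field_simps)
    then show ?thesis
      using assms unfolding normal_density_def
      by (simp add: mult_exp_exp power_divide real_sqrt_divide real_sqrt_mult)
  qed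
  have "(\<integral>\<^sup>+ x. ennreal (exp (- c * x\<^sup>2 / 2)) \<partial>std_normal)
      = (\<integral>\<^sup>+ x. ennreal (std_normal_density x * exp (- c * x\<^sup>2 / 2)) \<partial>lborel)"
    by (subst nn_integral_std_normal) (auto simp: ennreal_mult')
  also have "\<dots> = (\<integral>\<^sup>+ x. ennreal (1 / sqrt (1 + c)) * ennreal (normal_density 0 (1 / sqrt (1 + c)) x) \<partial>lborel)"
    using assms unfolding * by (simp add: ennreal_mult' del: times_divide_eq_left)
  finally have "(\<integral>\<^sup>+ x. ennreal (exp (- c * x\<^sup>2 / 2)) \<partial>std_normal)
      = (\<integral>\<^sup>+ x. ennreal (1 / sqrt (1 + c)) * ennreal (normal_density 0 (1 / sqrt (1 + c)) x) \<partial>lborel)" .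
  then show ?thesis
    using assms by (simp add: nn_integral_cmult nn_integral_normal_density)
qed

lemma nn_integral_std_normal_affine_square:
  assumes "v \<ge> 0"
  shows "(\<integral>\<^sup>+ t. ennreal ((x + sqrt v * t)\<^sup>2) \<partial>std_normal) = ennreal (x\<^sup>2 + v)"
proof -
  have "has_bochner_integral lborel (\<lambda>t. x\<^sup>2 * (std_normal_density t * t ^ (2 * 0))
      + 2 * x * sqrt v * (std_normal_density t * t ^ (2 * 0 + 1)) + v * (std_normal_density t * t ^ (2 * 1)))
      (x\<^sup>2 * (fact (2 * 0) / (2 ^ 0 * fact 0)) + 2 * x * sqrt v * 0 + v * (fact (2 * 1) / (2 ^ 1 * fact 1)))"
    by (intro has_bochner_integral_add has_bochner_integral_mult_right std_normal_moment_even std_normal_moment_odd)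
  also have "(\<lambda>t. x\<^sup>2 * (std_normal_density t * t ^ (2 * 0))
      + 2 * x * sqrt v * (std_normal_density t * t ^ (2 * 0 + 1)) + v * (std_normal_density t * t ^ (2 * 1)))
      = (\<lambda>t. std_normal_density t * (x + sqrt v * t)\<^sup>2)"
    using assms by (auto simp: fun_eq_iff power2_sum power_mult_distrib algebra_simps power2_eq_square)
  finally have "has_bochner_integral lborel (\<lambda>t. std_normal_density t * (x + sqrt v * t)\<^sup>2) (x\<^sup>2 + v)"
    by simp
  then have "(\<integral>\<^sup>+ t. ennreal (std_normal_density t * (x + sqrt v * t)\<^sup>2) \<partial>lborel) = ennreal (x\<^sup>2 + v)"
    by (subst nn_integral_eq_integral) (auto simp: has_bochner_integral_iff)
  then show ?thesis
    by (subst nn_integral_std_normal) (auto simp: ennreal_mult')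
qed

text \<open>The weight is the density of a centred Gaussian of variance \<open>s\<close> over the
  density of the output \<open>x + sqrt v * t\<close>, expressed through the noise \<open>t\<close>.
  One affine substitution passes from the noise to the output, a second one to the standard scale.
  This is a single time step of the change of measure.\<close>

lemma nn_integral_std_normal_change:
  assumes [measurable]: "g \<in> borel_measurable borel" and "v > 0" "s > 0"
  shows "(\<integral>\<^sup>+ t. g (x + sqrt v * t) *
            ennreal (sqrt (v / s) * exp (t\<^sup>2 / 2 - (x + sqrt v * t)\<^sup>2 / (2 * s))) \<partial>std_normal)
       = (\<integral>\<^sup>+ z. g (sqrt s * z) \<partial>std_normal)"
proof -
  have *: "std_normal_density t * (sqrt (v / s) * exp (t\<^sup>2 / 2 - y\<^sup>2 / (2 * s))) = sqrt v * normal_density 0 (sqrt s) y"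
    for t y :: real
  proof -
    have "- t\<^sup>2 / 2 + (t\<^sup>2 / 2 - y\<^sup>2 / (2 * s)) = - y\<^sup>2 / (2 * s)" by simp
    then have "exp (- t\<^sup>2 / 2) * exp (t\<^sup>2 / 2 - y\<^sup>2 / (2 * s)) = exp (- y\<^sup>2 / (2 * s))"
      by (metis mult_exp_exp)
    then show ?thesis
      using assms by (simp add: normal_density_def real_sqrt_divide real_sqrt_mult field_simps)
  qed
  have "(\<integral>\<^sup>+ t. g (x + sqrt v * t) *
            ennreal (sqrt (v / s) * exp (t\<^sup>2 / 2 - (x + sqrt v * t)\<^sup>2 / (2 * s))) \<partial>std_normal)
     = (\<integral>\<^sup>+ t. ennreal (sqrt v) * (ennreal (normal_density 0 (sqrt s) (x + sqrt v * t)) * g (x + sqrt v * t)) \<partial>lborel)"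
    using assms
  proof (subst nn_integral_std_normal, goal_cases)
    case 2
    have "ennreal (std_normal_density t) * (g y * ennreal (sqrt (v / s) * exp (t\<^sup>2 / 2 - y\<^sup>2 / (2 * s))))
        = ennreal (sqrt v) * (ennreal (normal_density 0 (sqrt s) y) * g y)" for t y
    proof -
      have "ennreal (std_normal_density t) * (g y * ennreal (sqrt (v / s) * exp (t\<^sup>2 / 2 - y\<^sup>2 / (2 * s))))
          = g y * ennreal (std_normal_density t * (sqrt (v / s) * exp (t\<^sup>2 / 2 - y\<^sup>2 / (2 * s))))"
        by (simp add: ennreal_mult' mult.left_commute)
      also have "\<dots> = g y * ennreal (sqrt v * normal_density 0 (sqrt s) y)"
        by (simp only: *)
      finally show ?thesis
        using assms by (simp add: ennreal_mult' ac_simps)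
    qed
    then show ?case by simp
  qed measurable
  also have "\<dots> = ennreal \<bar>sqrt v\<bar> * (\<integral>\<^sup>+ t. ennreal (normal_density 0 (sqrt s) (x + sqrt v * t)) * g (x + sqrt v * t) \<partial>lborel)"
    using assms by (subst nn_integral_cmult) auto
  also have "\<dots> = (\<integral>\<^sup>+ y. ennreal (normal_density 0 (sqrt s) y) * g y \<partial>lborel)"
    using assms by (subst nn_integral_real_affine[where c="sqrt v" and t=x]) auto
  also have "\<dots> = ennreal \<bar>sqrt s\<bar> * (\<integral>\<^sup>+ z. ennreal (normal_density 0 (sqrt s) (0 + sqrt s * z)) * g (0 + sqrt s * z) \<partial>lborel)"
    using assms by (subst nn_integral_real_affine[where c="sqrt s" and t=0]) auto
  also have "\<dots> = (\<integral>\<^sup>+ z. ennreal \<bar>sqrt s\<bar> * (ennreal (normal_density 0 (sqrt s) (0 + sqrt s * z)) * g (0 + sqrt s * z)) \<partial>lborel)"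
    using assms by (subst nn_integral_cmult) auto
  also have "\<dots> = (\<integral>\<^sup>+ z. ennreal (std_normal_density z) * g (sqrt s * z) \<partial>lborel)"
    using assms
    by (intro nn_integral_cong)
       (auto simp: mult.assoc[symmetric] ennreal_mult'[symmetric] normal_density_def real_sqrt_mult power_mult_distrib)
  also have "\<dots> = (\<integral>\<^sup>+ z. g (sqrt s * z) \<partial>std_normal)"
    by (subst nn_integral_std_normal) auto
  finally show ?thesis .
qed

section \<open>Change of measure for causal inputs\<close>

text \<open>Measurability over the product space only concerns extensional arguments. The second
  clause makes it meaningful to evaluate \<open>f\<close> at a whole noise sequence. The general
  codomain covers both \<open>real\<close> and \<open>ennreal\<close>.\<close>

definition causal :: "nat \<Rightarrow> ((nat \<Rightarrow> real) \<Rightarrow> 'a::topological_space) \<Rightarrow> bool" where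
  "causal k f \<longleftrightarrow> f \<in> borel_measurable (PiM {1..<k} (\<lambda>_. borel)) \<and>
     (\<forall>u u'. (\<forall>j\<in>{1..<k}. u j = u' j) \<longrightarrow> f u = f u')"

lemma causalD_measurable: "causal k f \<Longrightarrow> f \<in> borel_measurable (PiM {1..<k} (\<lambda>_. borel))"
  by (simp add: causal_def)

lemma causalD_eq: "causal k f \<Longrightarrow> (\<And>j. j \<in> {1..<k} \<Longrightarrow> u j = u' j) \<Longrightarrow> f u = f u'"
  unfolding causal_def by blast

lemma causal_mono:
  assumes f: "causal k f" and "k \<le> n"
  shows "causal n f"
proof -
  have "(\<lambda>u. restrict u {1..<k}) \<in> measurable (PiM {1..<n} (\<lambda>_. borel)) (PiM {1..<k} (\<lambda>_. borel))"
    using \<open>k \<le> n\<close> by (intro measurable_restrict_subset) auto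
  from measurable_compose[OF this causalD_measurable[OF f]]
  have "(\<lambda>u. f (restrict u {1..<k})) \<in> borel_measurable (PiM {1..<n} (\<lambda>_. borel))" .
  moreover have "(\<lambda>u. f (restrict u {1..<k})) = f"
    by (rule ext, rule causalD_eq[OF f]) auto
  moreover have "f u = f u'" if "\<forall>j\<in>{1..<n}. u j = u' j" for u u' :: "nat \<Rightarrow> real"
    using that \<open>k \<le> n\<close> by (intro causalD_eq[OF f]) auto
  ultimately show ?thesis by (simp add: causal_def)
qed

lemma causal_upd: "causal k f \<Longrightarrow> k \<le> j \<Longrightarrow> f (u(j := t)) = f u"
  by (erule causalD_eq) auto

lemma causal_const: "causal k (\<lambda>_. c)"
  by (simp add: causal_def)

lemma causal_proj: "j \<in> {1..<k} \<Longrightarrow> causal k (\<lambda>u. u j)"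
  by (simp add: causal_def)

lemma causal_compose:
  assumes "causal k f" "h \<in> borel_measurable borel"
  shows "causal k (\<lambda>u. h (f u))"
  unfolding causal_def
proof (intro conjI allI impI)
  show "(\<lambda>u. h (f u)) \<in> borel_measurable (PiM {1..<k} (\<lambda>_. borel))"
    by (rule measurable_compose[OF causalD_measurable[OF assms(1)] assms(2)])
qed (auto intro!: arg_cong[where f=h] causalD_eq[OF assms(1)])

lemma causal_add:
  fixes f g :: "(nat \<Rightarrow> real) \<Rightarrow> real"
  assumes "causal k f" "causal k g"
  shows "causal k (\<lambda>u. f u + g u)"
  unfolding causal_def
proof (intro conjI allI impI)
  show "(\<lambda>u. f u + g u) \<in> borel_measurable (PiM {1..<k} (\<lambda>_. borel))"
    by (intro borel_measurable_add causalD_measurable assms)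
qed (auto intro!: arg_cong2[where f="(+)"] causalD_eq[OF assms(1)] causalD_eq[OF assms(2)])

lemma causal_mult:
  fixes f g :: "(nat \<Rightarrow> real) \<Rightarrow> real"
  assumes "causal k f" "causal k g"
  shows "causal k (\<lambda>u. f u * g u)"
  unfolding causal_def
proof (intro conjI allI impI)
  show "(\<lambda>u. f u * g u) \<in> borel_measurable (PiM {1..<k} (\<lambda>_. borel))"
    by (intro borel_measurable_times causalD_measurable assms)
qed (auto intro!: arg_cong2[where f="(*)"] causalD_eq[OF assms(1)] causalD_eq[OF assms(2)])

lemma causal_mult_ennreal:
  fixes f g :: "(nat \<Rightarrow> real) \<Rightarrow> ennreal"
  assumes "causal k f" "causal k g"
  shows "causal k (\<lambda>u. f u * g u)"
  unfolding causal_def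
proof (intro conjI allI impI)
  show "(\<lambda>u. f u * g u) \<in> borel_measurable (PiM {1..<k} (\<lambda>_. borel))"
    by (intro borel_measurable_times_ennreal causalD_measurable assms)
qed (auto intro!: arg_cong2[where f="(*)"] causalD_eq[OF assms(1)] causalD_eq[OF assms(2)])

lemma causal_sum:
  fixes f :: "'i \<Rightarrow> (nat \<Rightarrow> real) \<Rightarrow> real"
  assumes "\<And>i. i \<in> I \<Longrightarrow> causal k (f i)"
  shows "causal k (\<lambda>u. \<Sum>i\<in>I. f i u)"
  unfolding causal_def
proof (intro conjI allI impI)
  show "(\<lambda>u. \<Sum>i\<in>I. f i u) \<in> borel_measurable (PiM {1..<k} (\<lambda>_. borel))"
    by (intro borel_measurable_sum causalD_measurable assms)
qed (auto intro!: sum.cong causalD_eq[OF assms])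

lemma causal_prod:
  fixes f :: "'i \<Rightarrow> (nat \<Rightarrow> real) \<Rightarrow> real"
  assumes "\<And>i. i \<in> I \<Longrightarrow> causal k (f i)"
  shows "causal k (\<lambda>u. \<Prod>i\<in>I. f i u)"
  unfolding causal_def
proof (intro conjI allI impI)
  show "(\<lambda>u. \<Prod>i\<in>I. f i u) \<in> borel_measurable (PiM {1..<k} (\<lambda>_. borel))"
    by (intro borel_measurable_prod causalD_measurable assms)
qed (auto intro!: prod.cong causalD_eq[OF assms])

lemma causal_vector:
  assumes f: "\<And>j. j \<in> J \<Longrightarrow> causal k (f j)" and g: "g \<in> borel_measurable (PiM J (\<lambda>_. borel))"
  shows "causal k (\<lambda>u. g (\<lambda>j\<in>J. f j u))"
proof -
  have "(\<lambda>u. \<lambda>j\<in>J. f j u) \<in> measurable (PiM {1..<k} (\<lambda>_. borel)) (PiM J (\<lambda>_. borel))"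
    by (intro measurable_restrict causalD_measurable f)
  from measurable_compose[OF this g] show ?thesis
    using f unfolding causal_def by (auto intro!: arg_cong[where f=g])
qed

section \<open>The noise process and integration over its latest value\<close>

locale gaussian_noise = prob_space N for N :: "'w measure" +
  fixes U :: "nat \<Rightarrow> 'w \<Rightarrow> real"
  assumes indep_U: "indep_vars (\<lambda>_. borel) U {1..}"
    and distributed_U: "\<And>k. k \<ge> 1 \<Longrightarrow> distributed N lborel (U k) (\<lambda>x. ennreal (std_normal_density x))"
begin

lemma measurable_U: "k \<ge> 1 \<Longrightarrow> U k \<in> borel_measurable N"
  using distributed_measurable[OF distributed_U, of k] by simp

lemma distr_U: "k \<ge> 1 \<Longrightarrow> distr N borel (U k) = std_normal"
  using distributed_distr_eq_density[OF distributed_U, of k] unfolding std_normal_def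
  by (simp cong: distr_cong)

lemma nn_integral_U:
  assumes "k \<ge> 1" "f \<in> borel_measurable borel"
  shows "(\<integral>\<^sup>+ w. f (U k w) \<partial>N) = (\<integral>\<^sup>+ t. f t \<partial>std_normal)"
  using assms measurable_U[of k] by (simp add: distr_U[symmetric] nn_integral_distr)

lemma nn_integral_noise:
  assumes "finite J" "J \<subseteq> {1..}" and f: "f \<in> borel_measurable (PiM J (\<lambda>_. borel))"
  shows "(\<integral>\<^sup>+ w. f (\<lambda>k\<in>J. U k w) \<partial>N) = (\<integral>\<^sup>+ u. f u \<partial>PiM J (\<lambda>_. std_normal))"
proof (cases "J = {}")
  \<comment> \<open>The product form of independence used in the other case is for a nonempty index
    set; the empty set occurs when the noise at time 1 is integrated out.\<close>
  case True
  interpret product_sigma_finite "\<lambda>_::nat. std_normal"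
    using prob_space_std_normal by (simp add: prob_space_imp_sigma_finite product_sigma_finite.intro)
  from True show ?thesis
    by (simp add: nn_integral_empty emeasure_space_1 restrict_def)
next
  case False
  have rv: "\<And>i. i \<in> J \<Longrightarrow> random_variable borel (U i)"
    using \<open>J \<subseteq> {1..}\<close> by (intro measurable_U) auto
  have "distr N (PiM J (\<lambda>_. borel)) (\<lambda>w. \<lambda>i\<in>J. U i w) = PiM J (\<lambda>i. distr N borel (U i))"
    using indep_vars_iff_distr_eq_PiM'[OF False rv] indep_vars_subset[OF indep_U \<open>J \<subseteq> {1..}\<close>] by simp
  also have "\<dots> = PiM J (\<lambda>_. std_normal)"
    using assms by (intro PiM_cong) (auto simp: distr_U)
  finally have eq: "PiM J (\<lambda>_. std_normal) = distr N (PiM J (\<lambda>_. borel)) (\<lambda>w. \<lambda>i\<in>J. U i w)" ..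
  have T: "(\<lambda>w. \<lambda>i\<in>J. U i w) \<in> measurable N (PiM J (\<lambda>_. borel))"
    by (intro measurable_restrict rv)
  show ?thesis
    unfolding eq using nn_integral_distr[OF T, of f] f by simp
qed

lemma causal_measurable_noise:
  assumes "causal k f"
  shows "(\<lambda>w. f (\<lambda>t. U t w)) \<in> borel_measurable N"
proof -
  have "(\<lambda>w. \<lambda>j\<in>{1..<k}. U j w) \<in> measurable N (PiM {1..<k} (\<lambda>_. borel))"
    by (intro measurable_restrict measurable_U) auto
  from measurable_compose[OF this causalD_measurable[OF assms]]
  have "(\<lambda>w. f (\<lambda>j\<in>{1..<k}. U j w)) \<in> borel_measurable N" .
  also have "(\<lambda>w. f (\<lambda>j\<in>{1..<k}. U j w)) = (\<lambda>w. f (\<lambda>t. U t w))"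
    by (rule ext, rule causalD_eq[OF assms]) auto
  finally show ?thesis .
qed

text \<open>Fubini for the latest noise only: \<open>f\<close> looks at times 1 to
  \<open>Suc n\<close>, the value at \<open>Suc n\<close> becomes an independent integration
  variable, and the earlier values stay random variables on \<open>N\<close>, so that the step can
  be iterated.\<close>

lemma nn_integral_causal_step:
  assumes f: "causal (Suc (Suc n)) f"
  shows "(\<integral>\<^sup>+ w. f (\<lambda>t. U t w) \<partial>N) = (\<integral>\<^sup>+ w. (\<integral>\<^sup>+ t. f ((\<lambda>t. U t w)(Suc n := t)) \<partial>std_normal) \<partial>N)"
proof -
  interpret product_sigma_finite "\<lambda>_::nat. std_normal"
    using prob_space_std_normal by (simp add: prob_space_imp_sigma_finite product_sigma_finite.intro)
  have ins: "{1..<Suc (Suc n)} = insert (Suc n) {1..<Suc n}" by auto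
  have sets_eq: "sets (PiM J (\<lambda>_. std_normal)) = sets (PiM J (\<lambda>_. borel :: real measure))" for J :: "nat set"
    by (intro sets_PiM_cong) auto
  have fm: "f \<in> borel_measurable (PiM (insert (Suc n) {1..<Suc n}) (\<lambda>_. std_normal))"
    using causalD_measurable[OF f] unfolding ins using measurable_cong_sets[OF sets_eq refl] by blast
  have restr: "f (\<lambda>k\<in>{1..<Suc (Suc n)}. u k) = f u" for u
    by (rule causalD_eq[OF f]) auto
  have "(\<integral>\<^sup>+ w. f (\<lambda>t. U t w) \<partial>N) = (\<integral>\<^sup>+ w. f (\<lambda>k\<in>{1..<Suc (Suc n)}. U k w) \<partial>N)"
    by (simp only: restr)
  also have "\<dots> = (\<integral>\<^sup>+ u. f u \<partial>PiM {1..<Suc (Suc n)} (\<lambda>_. std_normal))"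
    by (rule nn_integral_noise[OF _ _ causalD_measurable[OF f]]) auto
  also have "\<dots> = (\<integral>\<^sup>+ u. (\<integral>\<^sup>+ t. f (u(Suc n := t)) \<partial>std_normal) \<partial>PiM {1..<Suc n} (\<lambda>_. std_normal))"
    unfolding ins by (rule product_nn_integral_insert) (use fm in auto)
  also have "\<dots> = (\<integral>\<^sup>+ w. (\<integral>\<^sup>+ t. f ((\<lambda>k\<in>{1..<Suc n}. U k w)(Suc n := t)) \<partial>std_normal) \<partial>N)"
  proof (rule nn_integral_noise[symmetric])
    have "(\<lambda>(u, t). u(Suc n := t)) \<in> measurable (PiM {1..<Suc n} (\<lambda>_. std_normal) \<Otimes>\<^sub>M std_normal)
        (PiM (insert (Suc n) {1..<Suc n}) (\<lambda>_. std_normal))"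
      using measurable_add_dim[of "Suc n" "{1..<Suc n}" "\<lambda>_. std_normal"] by simp
    from measurable_compose[OF this fm]
    have "(\<lambda>(u, t). f (u(Suc n := t))) \<in> borel_measurable (PiM {1..<Suc n} (\<lambda>_. std_normal) \<Otimes>\<^sub>M std_normal)"
      by (simp add: case_prod_unfold)
    then have "(\<lambda>u. \<integral>\<^sup>+ t. f (u(Suc n := t)) \<partial>std_normal) \<in> borel_measurable (PiM {1..<Suc n} (\<lambda>_. std_normal))"
      by (rule sigma_finite_measure.borel_measurable_nn_integral[rotated])
         (simp add: prob_space_std_normal prob_space_imp_sigma_finite)
    then show "(\<lambda>u. \<integral>\<^sup>+ t. f (u(Suc n := t)) \<partial>std_normal) \<in> borel_measurable (PiM {1..<Suc n} (\<lambda>_. borel))"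
      using measurable_cong_sets[OF sets_eq refl] by blast
  qed auto
  also have "\<dots> = (\<integral>\<^sup>+ w. (\<integral>\<^sup>+ t. f ((\<lambda>t. U t w)(Suc n := t)) \<partial>std_normal) \<partial>N)"
    by (intro nn_integral_cong causalD_eq[OF f]) auto
  finally show ?thesis .
qed

text \<open>The cross term vanishes, because the noise at time \<open>k\<close> is centred and
  independent of the past that determines \<open>X\<close> and \<open>v\<close>.\<close>

lemma nn_integral_output_square:
  assumes X: "causal k X" and v: "causal k v" and "\<And>u. v u \<ge> 0" and "k \<ge> 1"
  shows "(\<integral>\<^sup>+ w. ennreal ((X (\<lambda>t. U t w) + sqrt (v (\<lambda>t. U t w)) * U k w)\<^sup>2) \<partial>N)
       = (\<integral>\<^sup>+ w. ennreal ((X (\<lambda>t. U t w))\<^sup>2) \<partial>N) + (\<integral>\<^sup>+ w. ennreal (v (\<lambda>t. U t w)) \<partial>N)"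
proof -
  obtain n where k: "k = Suc n" using \<open>k \<ge> 1\<close> by (cases k) auto
  have "causal (Suc k) (\<lambda>u. (X u + sqrt (v u) * u k)\<^sup>2)"
    using \<open>k \<ge> 1\<close>
    by (intro causal_compose[of _ _ "\<lambda>x. x\<^sup>2"] causal_add causal_mult causal_compose[of _ _ sqrt]
       causal_mono[OF X] causal_mono[OF v] causal_proj) auto
  then have "causal (Suc (Suc n)) (\<lambda>u. ennreal ((X u + sqrt (v u) * u k)\<^sup>2))"
    unfolding k by (rule causal_compose) simp
  from nn_integral_causal_step[OF this]
  have "(\<integral>\<^sup>+ w. ennreal ((X (\<lambda>t. U t w) + sqrt (v (\<lambda>t. U t w)) * U k w)\<^sup>2) \<partial>N)
     = (\<integral>\<^sup>+ w. (\<integral>\<^sup>+ t. ennreal ((X (\<lambda>t. U t w) + sqrt (v (\<lambda>t. U t w)) * t)\<^sup>2) \<partial>std_normal) \<partial>N)"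
    using X v by (simp add: k causal_upd)
  also have "\<dots> = (\<integral>\<^sup>+ w. ennreal ((X (\<lambda>t. U t w))\<^sup>2) + ennreal (v (\<lambda>t. U t w)) \<partial>N)"
    using assms by (simp add: nn_integral_std_normal_affine_square)
  also have "\<dots> = (\<integral>\<^sup>+ w. ennreal ((X (\<lambda>t. U t w))\<^sup>2) \<partial>N) + (\<integral>\<^sup>+ w. ennreal (v (\<lambda>t. U t w)) \<partial>N)"
    using causal_measurable_noise[OF X] causal_measurable_noise[OF v] by (intro nn_integral_add) auto
  finally show ?thesis .
qed

text \<open>
  The product below is the likelihood ratio, at the channel outputs, of white Gaussian noise of
  variance \<open>s\<close> against the output law. It is integrated out one time instant at a time, latest first:
  given the past, the output is an affine function of the current noise.
\<close>

lemma nn_integral_change_to_white_noise: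
  fixes X v :: "nat \<Rightarrow> (nat \<Rightarrow> real) \<Rightarrow> real"
  defines "Y \<equiv> \<lambda>k u. X k u + sqrt (v k u) * u k"
  assumes "s > 0"
    and "\<And>k. k \<in> {1..n} \<Longrightarrow> causal k (X k)" and "\<And>k. k \<in> {1..n} \<Longrightarrow> causal k (v k)"
    and "\<And>k u. k \<in> {1..n} \<Longrightarrow> v k u > 0"
    and "g \<in> borel_measurable (PiM {1..n} (\<lambda>_. borel))"
  shows "(\<integral>\<^sup>+ w. g (\<lambda>k\<in>{1..n}. Y k (\<lambda>t. U t w)) *
            ennreal (\<Prod>k\<in>{1..n}. sqrt (v k (\<lambda>t. U t w) / s) * exp ((U k w)\<^sup>2 / 2 - (Y k (\<lambda>t. U t w))\<^sup>2 / (2 * s))) \<partial>N)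
       = (\<integral>\<^sup>+ w. g (\<lambda>k\<in>{1..n}. sqrt s * U k w) \<partial>N)"
  using assms(2-)
proof (induction n arbitrary: g)
  case 0
  then show ?case by simp
next
  case (Suc n)
  note g = Suc.prems(5)
  define lr where "lr k u = sqrt (v k u / s) * exp ((u k)\<^sup>2 / 2 - (Y k u)\<^sup>2 / (2 * s))" for k u
  \<comment> \<open>\<open>h\<close> is \<open>g\<close> with its last coordinate averaged over
    white noise. The induction hypothesis is applied to \<open>h\<close>, which is why
    \<open>g\<close> has to be arbitrary.\<close>
  define h where "h y = (\<integral>\<^sup>+ z. g (y(Suc n := sqrt s * z)) \<partial>std_normal)" for y
  have ins: "{1..Suc n} = insert (Suc n) {1..n}" by auto
  have gm: "(\<lambda>(y, t). g (y(Suc n := t))) \<in> borel_measurable (PiM {1..n} (\<lambda>_. borel) \<Otimes>\<^sub>M borel)"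
  proof -
    have "(\<lambda>(u, t). u(Suc n := t)) \<in> measurable (PiM {1..n} (\<lambda>_. borel) \<Otimes>\<^sub>M borel)
        (PiM {1..Suc n} (\<lambda>_. borel :: real measure))"
      using measurable_add_dim[of "Suc n" "{1..n}" "\<lambda>_. borel :: real measure"] unfolding ins by simp
    from measurable_compose[OF this g] show ?thesis by (simp only: case_prod_unfold)
  qed
  have h: "h \<in> borel_measurable (PiM {1..n} (\<lambda>_. borel))"
  proof -
    interpret sigma_finite_measure std_normal
      by (simp add: prob_space_std_normal prob_space_imp_sigma_finite)
    have "(\<lambda>(y, z). (y, sqrt s * z)) \<in> measurable (PiM {1..n} (\<lambda>_. borel :: real measure) \<Otimes>\<^sub>M std_normal)
        (PiM {1..n} (\<lambda>_. borel) \<Otimes>\<^sub>M borel)"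
      by measurable
    from measurable_compose[OF this gm] show ?thesis
      unfolding h_def by (intro borel_measurable_nn_integral) (simp add: case_prod_unfold)
  qed
  have causal_Y: "causal (Suc (Suc n)) (Y k)" if "k \<in> {1..Suc n}" for k
    unfolding Y_def using that
    by (intro causal_add causal_mult causal_compose[of _ _ sqrt] causal_proj
        causal_mono[OF Suc.prems(2)[of k]] causal_mono[OF Suc.prems(3)[of k]]) auto
  have causal_lr: "causal (Suc (Suc n)) (lr k)" if "k \<in> {1..Suc n}" for k
  proof -
    \<comment> \<open>The difference in the exponent is rewritten as a sum with a negative factor,
      to fit the closure of causal functions under sums and products.\<close>
    have "causal (Suc (Suc n)) (\<lambda>u. sqrt (v k u / s) * exp ((u k)\<^sup>2 / 2 + (- 1 / (2 * s)) * (Y k u)\<^sup>2))"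
      using that
      by (intro causal_add causal_mult causal_compose[of _ _ "\<lambda>x. sqrt (x / s)"] causal_const
          causal_compose[of _ _ exp] causal_compose[of _ _ "\<lambda>x. x\<^sup>2 / 2"] causal_compose[of _ _ "\<lambda>x. x\<^sup>2"]
          causal_proj causal_Y causal_mono[OF Suc.prems(3)[of k]]) auto
    then show ?thesis by (simp add: lr_def[abs_def])
  qed
  have causal_all: "causal (Suc (Suc n)) (\<lambda>u. g (\<lambda>k\<in>{1..Suc n}. Y k u) * ennreal (\<Prod>k\<in>{1..Suc n}. lr k u))"
  proof -
    have "causal (Suc (Suc n)) (\<lambda>u. g (\<lambda>k\<in>{1..Suc n}. Y k u))"
      by (intro causal_vector causal_Y g)
    moreover have "causal (Suc (Suc n)) (\<lambda>u. ennreal (\<Prod>k\<in>{1..Suc n}. lr k u))"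
      by (intro causal_compose[of _ _ ennreal] causal_prod causal_lr) auto
    ultimately show ?thesis
      by (rule causal_mult_ennreal)
  qed
  have Y_upd: "Y k (u(Suc n := t)) = Y k u" if "k \<in> {1..n}" for k u t
    using that Suc.prems(2,3)[of k] by (simp add: Y_def causal_upd)
  have lr_upd: "lr k (u(Suc n := t)) = lr k u" if "k \<in> {1..n}" for k u t
    using that Suc.prems(3)[of k] by (simp add: lr_def Y_upd causal_upd)
  have inner: "(\<integral>\<^sup>+ t. g (\<lambda>k\<in>{1..Suc n}. Y k (u(Suc n := t))) * ennreal (\<Prod>k\<in>{1..Suc n}. lr k (u(Suc n := t))) \<partial>std_normal)
     = h (\<lambda>k\<in>{1..n}. Y k u) * ennreal (\<Prod>k\<in>{1..n}. lr k u)" for u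
  proof -
    let ?x = "X (Suc n) u" and ?v = "v (Suc n) u" and ?y = "\<lambda>k\<in>{1..n}. Y k u"
    have ym: "?y \<in> space (PiM {1..n} (\<lambda>_. borel))" by (simp add: space_PiM)
    have gm1: "(\<lambda>t. g (?y(Suc n := t))) \<in> borel_measurable borel"
      using measurable_Pair2[OF gm ym] by simp
    have "(\<lambda>t. ?x + sqrt ?v * t) \<in> borel_measurable borel" by simp
    from measurable_compose[OF this gm1]
    have gm2: "(\<lambda>t. g (?y(Suc n := ?x + sqrt ?v * t))) \<in> borel_measurable borel" .
    have Y_last: "Y (Suc n) (u(Suc n := t)) = ?x + sqrt ?v * t" for t
      using Suc.prems(2,3)[of "Suc n"] by (simp add: Y_def causal_upd)
    have vec: "(\<lambda>k\<in>{1..Suc n}. Y k (u(Suc n := t))) = ?y(Suc n := ?x + sqrt ?v * t)" for t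
      by (auto simp: fun_eq_iff restrict_def Y_upd Y_last)
    have prod_eq: "(\<Prod>k\<in>{1..Suc n}. lr k (u(Suc n := t)))
        = (\<Prod>k\<in>{1..n}. lr k u) * (sqrt (?v / s) * exp (t\<^sup>2 / 2 - (?x + sqrt ?v * t)\<^sup>2 / (2 * s)))" for t
    proof -
      have "(\<Prod>k\<in>{1..n}. lr k (u(Suc n := t))) = (\<Prod>k\<in>{1..n}. lr k u)"
        by (intro prod.cong) (auto simp: lr_upd)
      moreover have "lr (Suc n) (u(Suc n := t)) = sqrt (?v / s) * exp (t\<^sup>2 / 2 - (?x + sqrt ?v * t)\<^sup>2 / (2 * s))"
        using Suc.prems(3)[of "Suc n"] by (simp add: lr_def Y_last causal_upd)
      ultimately show ?thesis unfolding ins by (simp add: mult.commute)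
    qed
    have nonneg: "(\<Prod>k\<in>{1..n}. lr k u) \<ge> 0"
      using Suc.prems(1,4) by (intro prod_nonneg) (auto simp: lr_def less_imp_le)
    have "(\<integral>\<^sup>+ t. g (\<lambda>k\<in>{1..Suc n}. Y k (u(Suc n := t))) * ennreal (\<Prod>k\<in>{1..Suc n}. lr k (u(Suc n := t))) \<partial>std_normal)
      = (\<integral>\<^sup>+ t. ennreal (\<Prod>k\<in>{1..n}. lr k u) * (g (?y(Suc n := ?x + sqrt ?v * t)) *
           ennreal (sqrt (?v / s) * exp (t\<^sup>2 / 2 - (?x + sqrt ?v * t)\<^sup>2 / (2 * s)))) \<partial>std_normal)"
      unfolding vec prod_eq ennreal_mult'[OF nonneg] by (simp only: mult.left_commute)
    also have "\<dots> = ennreal (\<Prod>k\<in>{1..n}. lr k u) * (\<integral>\<^sup>+ t. g (?y(Suc n := ?x + sqrt ?v * t)) *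
           ennreal (sqrt (?v / s) * exp (t\<^sup>2 / 2 - (?x + sqrt ?v * t)\<^sup>2 / (2 * s))) \<partial>std_normal)"
      using gm2 by (intro nn_integral_cmult borel_measurable_times_ennreal) auto
    also have "(\<integral>\<^sup>+ t. g (?y(Suc n := ?x + sqrt ?v * t)) *
           ennreal (sqrt (?v / s) * exp (t\<^sup>2 / 2 - (?x + sqrt ?v * t)\<^sup>2 / (2 * s))) \<partial>std_normal) = h ?y"
      unfolding h_def by (rule nn_integral_std_normal_change[OF gm1]) (use Suc.prems(1,4) in auto)
    finally show ?thesis by (simp only: mult.commute[of "h _"])
  qed
  have "(\<integral>\<^sup>+ w. g (\<lambda>k\<in>{1..Suc n}. Y k (\<lambda>t. U t w)) * ennreal (\<Prod>k\<in>{1..Suc n}. lr k (\<lambda>t. U t w)) \<partial>N)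
     = (\<integral>\<^sup>+ w. h (\<lambda>k\<in>{1..n}. Y k (\<lambda>t. U t w)) * ennreal (\<Prod>k\<in>{1..n}. lr k (\<lambda>t. U t w)) \<partial>N)"
    unfolding nn_integral_causal_step[OF causal_all] inner ..
  also have "\<dots> = (\<integral>\<^sup>+ w. h (\<lambda>k\<in>{1..n}. sqrt s * U k w) \<partial>N)"
    unfolding lr_def using Suc.prems by (intro Suc.IH h) auto
  also have "\<dots> = (\<integral>\<^sup>+ w. g (\<lambda>k\<in>{1..Suc n}. sqrt s * U k w) \<partial>N)"
  proof -
    have "causal (Suc (Suc n)) (\<lambda>u. g (\<lambda>k\<in>{1..Suc n}. sqrt s * u k))"
      by (intro causal_vector g causal_mult causal_const causal_proj) auto
    from nn_integral_causal_step[OF this] show ?thesis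
      unfolding h_def
      by (auto intro!: nn_integral_cong arg_cong[where f=g] simp: fun_eq_iff restrict_def)
  qed
  finally show ?case unfolding lr_def .
qed

end

section \<open>Converse with feedback\<close>

definition noise_variance :: "real \<Rightarrow> (nat \<Rightarrow> real) \<Rightarrow> (nat \<Rightarrow> real) \<Rightarrow> nat \<Rightarrow> real" where
  "noise_variance s2 \<alpha> x k = s2 + (\<Sum>l\<in>{1..<k}. \<alpha> (k - l) * (x l)\<^sup>2)"

lemma channel_output_noise_variance:
  "channel_output s2 \<alpha> u x k = x k + sqrt (noise_variance s2 \<alpha> x k) * u k"
  by (simp add: channel_output_def noise_variance_def)

lemma noise_variance_ge:
  "(\<And>l. l \<ge> 1 \<Longrightarrow> \<alpha> l \<ge> 0) \<Longrightarrow> noise_variance s2 \<alpha> x k \<ge> s2"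
  unfolding noise_variance_def by (auto intro!: sum_nonneg mult_nonneg_nonneg)

lemma causal_noise_variance:
  assumes "\<And>l. l \<in> {1..<k} \<Longrightarrow> causal l (\<lambda>u. X u l)"
  shows "causal k (\<lambda>u. noise_variance s2 \<alpha> (X u) k)"
  unfolding noise_variance_def
  by (intro causal_add causal_const causal_sum causal_mult causal_compose[of _ _ "\<lambda>x. x\<^sup>2"] causal_mono[OF assms]) auto

text \<open>Strong induction along time: the outputs fed back at time \<open>k\<close> involve only
  inputs and noise before \<open>k\<close>, and the noise variances in them involve inputs that are
  earlier still.\<close>

lemma causal_fb_input:
  assumes "fb_encoder n m \<phi>" "i < m"
  shows "k \<in> {1..n} \<Longrightarrow> causal k (\<lambda>u. fb_input s2 \<alpha> \<phi> i u k)"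
proof (induction k rule: less_induct)
  case (less k)
  have "causal k (\<lambda>u. \<phi> k i (\<lambda>j\<in>{1..<k}. channel_output s2 \<alpha> u (fb_input s2 \<alpha> \<phi> i u) j))"
    unfolding channel_output_noise_variance
    using less assms unfolding fb_encoder_def
    by (intro causal_vector causal_add causal_mult causal_compose[of _ _ sqrt] causal_proj
        causal_mono[OF less.IH] causal_mono[OF causal_noise_variance]) auto
  then show ?case by (simp only: fb_input.simps[of s2 \<alpha> \<phi> i _ k])
qed

context gaussian_noise
begin

text \<open>
  The logarithm of the likelihood ratio \<open>L\<close> weighted by \<open>exp f\<close>, where \<open>f = ln m\<close> on
  correct decoding and \<open>f = 0\<close> otherwise, is bounded by \<open>ln x \<le> x / 2 - 1 + ln 2\<close>;
  this replaces the data processing inequality for the divergence from white noise.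
\<close>

lemma decoding_bound:
  fixes X v :: "nat \<Rightarrow> (nat \<Rightarrow> real) \<Rightarrow> real" and D :: "(nat \<Rightarrow> real) set" and m :: nat
  defines "Y \<equiv> \<lambda>k u. X k u + sqrt (v k u) * u k"
  assumes "s > 0" "m > 0"
    and X: "\<And>k. k \<in> {1..n} \<Longrightarrow> causal k (X k)" and v: "\<And>k. k \<in> {1..n} \<Longrightarrow> causal k (v k)"
    and v_ge: "\<And>k u. k \<in> {1..n} \<Longrightarrow> v k u \<ge> s"
    and D: "D \<in> sets (PiM {1..n} (\<lambda>_. borel))"
  shows "ennreal (ln (real m)) * emeasure N {w \<in> space N. (\<lambda>k\<in>{1..n}. Y k (\<lambda>t. U t w)) \<in> D}
      + of_nat n / 2 + 1
    \<le> (\<Sum>k\<in>{1..n}. \<integral>\<^sup>+ w. ennreal ((Y k (\<lambda>t. U t w))\<^sup>2) \<partial>N) * ennreal (1 / (2 * s))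
      + (1 + of_nat (m - 1) * emeasure N {w \<in> space N. (\<lambda>k\<in>{1..n}. sqrt s * U k w) \<in> D}) / 2 + ennreal (ln 2)"
proof -
  define L where "L u = (\<Prod>k\<in>{1..n}. sqrt (v k u / s) * exp ((u k)\<^sup>2 / 2 - (Y k u)\<^sup>2 / (2 * s)))" for u
  define E where "E = {w \<in> space N. (\<lambda>k\<in>{1..n}. Y k (\<lambda>t. U t w)) \<in> D}"
  define Q where "Q = {w \<in> space N. (\<lambda>k\<in>{1..n}. sqrt s * U k w) \<in> D}"
  let ?u = "\<lambda>w t. U t w"
  \<comment> \<open>The weight \<open>exp f\<close> of the text above: \<open>m\<close> if the
    output falls into \<open>D\<close> and 1 otherwise.\<close>
  let ?f = "\<lambda>w. 1 + real (m - 1) * indicator D (\<lambda>k\<in>{1..n}. Y k (?u w))"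
  have causal_Y: "causal (Suc n) (Y k)" if "k \<in> {1..n}" for k
    unfolding Y_def using that
    by (intro causal_add causal_mult causal_compose[of _ _ sqrt] causal_proj
        causal_mono[OF X[of k]] causal_mono[OF v[of k]]) auto
  have Y_meas: "(\<lambda>w. Y k (?u w)) \<in> borel_measurable N" if "k \<in> {1..n}" for k
    by (rule causal_measurable_noise[OF causal_Y[OF that]])
  have U_meas: "U k \<in> borel_measurable N" if "k \<in> {1..n}" for k
    using that by (intro measurable_U) auto
  have vec: "(\<lambda>w. \<lambda>k\<in>{1..n}. Y k (?u w)) \<in> measurable N (PiM {1..n} (\<lambda>_. borel))"
    by (intro measurable_restrict Y_meas)
  have vec': "(\<lambda>w. \<lambda>k\<in>{1..n}. sqrt s * U k w) \<in> measurable N (PiM {1..n} (\<lambda>_. borel))"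
    using U_meas by (intro measurable_restrict borel_measurable_times) auto
  have E: "E \<in> sets N"
    using measurable_sets[OF vec D] unfolding E_def by (simp add: vimage_def Int_def conj_commute)
  have Q: "Q \<in> sets N"
    using measurable_sets[OF vec' D] unfolding Q_def by (simp add: vimage_def Int_def conj_commute)
  have L_meas: "(\<lambda>w. L (?u w)) \<in> borel_measurable N"
    unfolding L_def using Y_meas U_meas causal_measurable_noise[OF v] by measurable
  have v_pos: "v k u > 0" if "k \<in> {1..n}" for k u
    using v_ge[OF that, of u] \<open>s > 0\<close> by linarith
  have L_pos: "L u > 0" for u
    unfolding L_def using v_pos \<open>s > 0\<close> by (intro prod_pos ballI) simp
  \<comment> \<open>Terms that would be negative are moved to the other side, so that both sides can
    be integrated as nonnegative functions without knowing integrability beforehand.\<close>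
  have pointwise: "ln (real m) * indicator E w + (\<Sum>k\<in>{1..n}. (U k w)\<^sup>2 / 2) + 1
      \<le> (\<Sum>k\<in>{1..n}. (Y k (?u w))\<^sup>2) * (1 / (2 * s)) + L (?u w) * ?f w * (1 / 2) + ln 2" if "w \<in> space N" for w
  proof -
    have f_pos: "?f w > 0" by (auto simp: indicator_def)
    have ln_f: "ln (?f w) = ln (real m) * indicator E w"
      using that \<open>m > 0\<close> by (auto simp: E_def indicator_def of_nat_diff)
    have ln_L: "ln (L (?u w)) = (\<Sum>k\<in>{1..n}. ln (sqrt (v k (?u w) / s)) + ((U k w)\<^sup>2 / 2 - (Y k (?u w))\<^sup>2 / (2 * s)))"
      unfolding L_def using \<open>s > 0\<close>
      by (subst ln_prod) (auto intro!: sum.cong simp: ln_mult v_pos v_pos[THEN less_imp_neq, symmetric])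
    also have "\<dots> \<ge> (\<Sum>k\<in>{1..n}. (U k w)\<^sup>2 / 2 - (Y k (?u w))\<^sup>2 / (2 * s))"
      using v_ge \<open>s > 0\<close> by (intro sum_mono) (auto simp: ln_sqrt)
    finally have "(\<Sum>k\<in>{1..n}. (U k w)\<^sup>2 / 2) - (\<Sum>k\<in>{1..n}. (Y k (?u w))\<^sup>2) * (1 / (2 * s)) \<le> ln (L (?u w))"
      by (simp add: sum_subtractf sum_divide_distrib)
    \<comment> \<open>The tangent to the logarithm is taken at 2, since averaged over the messages
      the mean of \<open>L * ?f\<close> is at most \<open>1 + (m - 1) / m\<close>, hence below 2.
      The linear terms then cancel, leaving only \<open>ln 2\<close>.\<close>
    moreover have "ln (L (?u w) * ?f w / 2) \<le> L (?u w) * ?f w / 2 - 1"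
      using L_pos[of "?u w"] f_pos by (intro ln_le_minus_one) simp
    then have "ln (L (?u w)) + ln (?f w) - ln 2 \<le> L (?u w) * ?f w / 2 - 1"
      using L_pos[of "?u w"] f_pos by (simp add: ln_mult ln_div)
    ultimately show ?thesis unfolding ln_f by simp
  qed
  have half: "ennreal (1 / 2) = 1 / 2"
    by (metis divide_ennreal ennreal_1 ennreal_numeral zero_le_numeral zero_le_one zero_less_numeral)
  have sum_U: "(\<integral>\<^sup>+ w. ennreal (\<Sum>k\<in>{1..n}. (U k w)\<^sup>2 / 2) \<partial>N) = of_nat n / 2"
  proof -
    have "(\<integral>\<^sup>+ w. ennreal ((U k w)\<^sup>2 / 2) \<partial>N) = ennreal (1 / 2)" if "k \<in> {1..n}" for k
    proof -
      have "(\<integral>\<^sup>+ w. ennreal ((U k w)\<^sup>2 / 2) \<partial>N) = (\<integral>\<^sup>+ t. ennreal (t\<^sup>2 / 2) \<partial>std_normal)"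
        using that by (intro nn_integral_U[where f="\<lambda>t. ennreal (t\<^sup>2 / 2)"]) auto
      also have "\<dots> = (\<integral>\<^sup>+ t. ennreal (1 / 2) * ennreal ((0 + sqrt 1 * t)\<^sup>2) \<partial>std_normal)"
        by (intro nn_integral_cong, subst ennreal_mult'[symmetric]) auto
      also have "\<dots> = ennreal (1 / 2)"
        by (subst nn_integral_cmult, simp, subst nn_integral_std_normal_affine_square) auto
      finally show ?thesis .
    qed
    then have "(\<integral>\<^sup>+ w. (\<Sum>k\<in>{1..n}. ennreal ((U k w)\<^sup>2 / 2)) \<partial>N) = of_nat n * ennreal (1 / 2)"
      using U_meas by (subst nn_integral_sum) auto
    moreover have "(\<integral>\<^sup>+ w. ennreal (\<Sum>k\<in>{1..n}. (U k w)\<^sup>2 / 2) \<partial>N) = (\<integral>\<^sup>+ w. (\<Sum>k\<in>{1..n}. ennreal ((U k w)\<^sup>2 / 2)) \<partial>N)"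
      by (intro nn_integral_cong sum_ennreal[symmetric]) simp
    ultimately show ?thesis by (simp only: half ennreal_times_divide mult_1_right)
  qed
  have sum_Y: "(\<integral>\<^sup>+ w. ennreal (\<Sum>k\<in>{1..n}. (Y k (?u w))\<^sup>2) \<partial>N) = (\<Sum>k\<in>{1..n}. \<integral>\<^sup>+ w. ennreal ((Y k (?u w))\<^sup>2) \<partial>N)"
    using Y_meas by (subst nn_integral_sum[symmetric]) (auto intro!: nn_integral_cong)
  have Lf: "(\<integral>\<^sup>+ w. ennreal (L (?u w) * ?f w) \<partial>N) = 1 + of_nat (m - 1) * emeasure N Q"
  proof -
    have "(\<integral>\<^sup>+ w. ennreal (L (?u w) * ?f w) \<partial>N)
        = (\<integral>\<^sup>+ w. (1 + of_nat (m - 1) * indicator D (\<lambda>k\<in>{1..n}. Y k (?u w))) * ennreal (L (?u w)) \<partial>N)"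
      using L_pos
      by (intro nn_integral_cong) (auto simp: indicator_def ennreal_of_nat_eq_real_of_nat
         ennreal_mult''[symmetric] ennreal_plus[symmetric] less_imp_le algebra_simps simp del: ennreal_plus)
    also have "\<dots> = (\<integral>\<^sup>+ w. 1 + of_nat (m - 1) * indicator D (\<lambda>k\<in>{1..n}. sqrt s * U k w) \<partial>N)"
      unfolding L_def Y_def
      by (intro nn_integral_change_to_white_noise X v v_pos) (use D \<open>s > 0\<close> in auto)
    also have "\<dots> = (\<integral>\<^sup>+ w. 1 + of_nat (m - 1) * indicator Q w \<partial>N)"
      by (intro nn_integral_cong) (auto simp: Q_def indicator_def)
    also have "\<dots> = 1 + of_nat (m - 1) * emeasure N Q"
      using Q by (simp add: nn_integral_add nn_integral_cmult emeasure_space_1)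
    finally show ?thesis .
  qed
  have "ennreal (ln (real m)) * emeasure N E + of_nat n / 2 + 1
     = (\<integral>\<^sup>+ w. ennreal (ln (real m) * indicator E w + (\<Sum>k\<in>{1..n}. (U k w)\<^sup>2 / 2) + 1) \<partial>N)"
  proof -
    have "(\<integral>\<^sup>+ w. ennreal (ln (real m) * indicator E w + (\<Sum>k\<in>{1..n}. (U k w)\<^sup>2 / 2) + 1) \<partial>N)
       = (\<integral>\<^sup>+ w. ennreal (ln (real m)) * indicator E w + ennreal (\<Sum>k\<in>{1..n}. (U k w)\<^sup>2 / 2) + 1 \<partial>N)"
      using \<open>m > 0\<close>
      by (intro nn_integral_cong) (auto simp: ennreal_mult'[symmetric] sum_nonneg indicator_def ennreal_plus)
    also have "\<dots> = ennreal (ln (real m)) * emeasure N E + of_nat n / 2 + 1"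
      using E U_meas sum_U by (simp add: nn_integral_add nn_integral_cmult emeasure_space_1)
    finally show ?thesis ..
  qed
  also have "\<dots> \<le> (\<integral>\<^sup>+ w. ennreal ((\<Sum>k\<in>{1..n}. (Y k (?u w))\<^sup>2) * (1 / (2 * s)) + L (?u w) * ?f w * (1 / 2) + ln 2) \<partial>N)"
    by (intro nn_integral_mono ennreal_leI pointwise)
  also have "\<dots> = (\<integral>\<^sup>+ w. ennreal (\<Sum>k\<in>{1..n}. (Y k (?u w))\<^sup>2) * ennreal (1 / (2 * s))
      + ennreal (L (?u w) * ?f w) * ennreal (1 / 2) + ennreal (ln 2) \<partial>N)"
  proof (intro nn_integral_cong)
    fix w
    have "0 \<le> L (?u w) * ?f w" using L_pos[of "?u w"] by (simp add: less_imp_le)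
    moreover have "0 \<le> (\<Sum>k\<in>{1..n}. (Y k (?u w))\<^sup>2)" by (simp add: sum_nonneg)
    ultimately show "ennreal ((\<Sum>k\<in>{1..n}. (Y k (?u w))\<^sup>2) * (1 / (2 * s)) + L (?u w) * ?f w * (1 / 2) + ln 2)
       = ennreal (\<Sum>k\<in>{1..n}. (Y k (?u w))\<^sup>2) * ennreal (1 / (2 * s))
      + ennreal (L (?u w) * ?f w) * ennreal (1 / 2) + ennreal (ln 2)"
      using \<open>s > 0\<close> by (simp only: ennreal_mult'[symmetric] ennreal_plus[symmetric] mult_nonneg_nonneg add_nonneg_nonneg ln_ge_zero
           zero_le_divide_1_iff)
  qed
  also have "\<dots> = (\<Sum>k\<in>{1..n}. \<integral>\<^sup>+ w. ennreal ((Y k (?u w))\<^sup>2) \<partial>N) * ennreal (1 / (2 * s))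
      + (1 + of_nat (m - 1) * emeasure N Q) * ennreal (1 / 2) + ennreal (ln 2)"
  proof -
    have [measurable]: "(\<lambda>w. indicator D (\<lambda>k\<in>{1..n}. Y k (?u w)) :: real) \<in> borel_measurable N"
      using vec D by (intro measurable_compose[OF vec] borel_measurable_indicator)
    have 1: "(\<lambda>w. ennreal (\<Sum>k\<in>{1..n}. (Y k (?u w))\<^sup>2) * ennreal (1 / (2 * s))) \<in> borel_measurable N"
      using Y_meas by measurable
    have 2: "(\<lambda>w. ennreal (L (?u w) * ?f w)) \<in> borel_measurable N"
      using L_meas by measurable
    show ?thesis
      using 1 2 L_meas Y_meas sum_Y Lf by (simp add: nn_integral_add nn_integral_multc emeasure_space_1 del: One_nat_def)
  qed
  finally show ?thesis
    unfolding E_def Q_def half by (simp only: ennreal_times_divide mult_1_right)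
qed

text \<open>\<open>decoding_bound\<close> is averaged over the messages. The term
  \<open>n / 2\<close> coming from the noise cancels the share of \<open>s2\<close> in the output
  power, the guessing terms are controlled by disjointness of the decoding regions, and the energies
  enter only through their average, which is what the power constraint bounds.\<close>

lemma fb_rate_bound:
  fixes \<phi> \<psi>
  assumes "s2 > 0" and \<alpha>_nonneg: "\<And>l. l \<ge> 1 \<Longrightarrow> \<alpha> l \<ge> 0" and \<alpha>_summable: "summable (\<lambda>l. \<alpha> (Suc l))"
    and "m > 0" "n > 0" "P \<ge> 0"
    and enc: "fb_encoder n m \<phi>" and dec: "decoder n m \<psi>"
    and power: "power_constraint N U n m (fb_input s2 \<alpha> \<phi>) P"
  shows "(1 - error_prob N U s2 \<alpha> n m (fb_input s2 \<alpha> \<phi>) \<psi>) * ln (real m)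
    \<le> real n * (1 / 2 * (1 + (\<Sum>l. \<alpha> (Suc l))) * P / s2) + ln 2"
proof -
  define A where "A = (\<Sum>l. \<alpha> (Suc l))"
  define X where "X i k u = fb_input s2 \<alpha> \<phi> i u k" for i k u
  define v where "v i k u = noise_variance s2 \<alpha> (fb_input s2 \<alpha> \<phi> i u) k" for i k u
  define Y where "Y i k u = X i k u + sqrt (v i k u) * u k" for i k u
  define e where "e i k = (\<integral>\<^sup>+ w. ennreal ((X i k (\<lambda>t. U t w))\<^sup>2) \<partial>N)" for i k
  define r where "r i k = enn2real (e i k)" for i k
  define D where "D i = {y \<in> space (PiM {1..n} (\<lambda>_. borel)). \<psi> y = i}" for i
  define c where "c i = prob {w \<in> space N. (\<lambda>k\<in>{1..n}. Y i k (\<lambda>t. U t w)) \<in> D i}" for i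
  define q where "q i = prob {w \<in> space N. (\<lambda>k\<in>{1..n}. sqrt s2 * U k w) \<in> D i}" for i
  have Y_output: "Y i k u = channel_output s2 \<alpha> u (fb_input s2 \<alpha> \<phi> i u) k" for i k u
    by (simp add: Y_def X_def v_def channel_output_noise_variance)
  have X: "causal k (X i k)" if "i < m" "k \<in> {1..n}" for i k
    using causal_fb_input[OF enc that] by (simp add: X_def[abs_def])
  have v: "causal k (v i k)" if "i < m" "k \<in> {1..n}" for i k
    unfolding v_def using that by (intro causal_noise_variance causal_fb_input[OF enc]) auto
  have v_ge: "v i k u \<ge> s2" for i k u
    unfolding v_def by (intro noise_variance_ge \<alpha>_nonneg)
  have \<psi>: "\<psi> \<in> measurable (PiM {1..n} (\<lambda>_. borel)) (count_space {..<m})"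
    using dec by (simp add: decoder_def)
  have D: "D i \<in> sets (PiM {1..n} (\<lambda>_. borel))" if "i < m" for i
    using measurable_sets[OF \<psi>, of "{i}"] that unfolding D_def
    by (simp add: vimage_def Int_def conj_commute)
  have X_sq_meas: "(\<lambda>w. ennreal ((X i k (\<lambda>t. U t w))\<^sup>2)) \<in> borel_measurable N" if "i < m" "k \<in> {1..n}" for i k
    using causal_measurable_noise[OF X[OF that]] by measurable
  have vec: "(\<lambda>w. \<lambda>k\<in>{1..n}. Y i k (\<lambda>t. U t w)) \<in> measurable N (PiM {1..n} (\<lambda>_. borel))" if "i < m" for i
  proof (intro measurable_restrict causal_measurable_noise[of "Suc n"])
    fix k assume "k \<in> {1..n}"
    with that show "causal (Suc n) (Y i k)"
      unfolding Y_def
      by (intro causal_add causal_mult causal_compose[of _ _ sqrt] causal_proj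
          causal_mono[OF X[of i k]] causal_mono[OF v[of i k]]) auto
  qed
  have vec': "(\<lambda>w. \<lambda>k\<in>{1..n}. sqrt s2 * U k w) \<in> measurable N (PiM {1..n} (\<lambda>_. borel))"
    by (intro measurable_restrict borel_measurable_times measurable_U) auto

  have power_sum: "(\<Sum>k\<in>{1..n}. \<Sum>i<m. e i k) \<le> ennreal (real n * real m * P)"
  proof -
    have mult_le: "a \<le> b * of_nat j" if "a / of_nat j \<le> b" "j > 0" for a b :: ennreal and j :: nat
    proof -
      have "a = a * of_nat j / of_nat j"
        using that by (simp add: ennreal_mult_divide_eq)
      also have "\<dots> = a / of_nat j * of_nat j"
        by (simp add: divide_ennreal_def ac_simps)
      also have "\<dots> \<le> b * of_nat j"
        using that(1) by (rule mult_right_mono) simp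
      finally show ?thesis .
    qed
    have "(\<Sum>k=1..n. (\<Sum>i<m. e i k) / of_nat m) / of_nat n \<le> ennreal P"
      using power X_sq_meas \<open>m > 0\<close> unfolding power_constraint_def e_def X_def
      by (subst (asm) sum.cong[OF refl nn_integral_message_noise_space[OF prob_space_axioms]]) auto
    then have "(\<Sum>k=1..n. (\<Sum>i<m. e i k) / of_nat m) \<le> ennreal P * of_nat n"
      by (rule mult_le) fact
    then have "(\<Sum>k=1..n. \<Sum>i<m. e i k) / of_nat m \<le> ennreal P * of_nat n"
      by (simp add: divide_ennreal_def sum_distrib_right)
    then have "(\<Sum>k=1..n. \<Sum>i<m. e i k) \<le> ennreal P * of_nat n * of_nat m"
      by (rule mult_le) fact
    also have "\<dots> = ennreal (real n * real m * P)"
      using \<open>P \<ge> 0\<close> by (simp add: ennreal_of_nat_eq_real_of_nat ennreal_mult[symmetric] ac_simps)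
    finally show ?thesis .
  qed
  \<comment> \<open>Every energy is a summand of a finite total, so it is finite and the remaining
    computation can be done in the reals.\<close>
  have e_r: "e i k = ennreal (r i k)" if "i < m" "k \<in> {1..n}" for i k
  proof -
    have "e i k \<le> (\<Sum>i<m. e i k)"
      using that by (intro member_le_sum) auto
    also have "\<dots> \<le> (\<Sum>k\<in>{1..n}. \<Sum>i<m. e i k)"
      using that by (intro member_le_sum[where f="\<lambda>k. \<Sum>i<m. e i k"]) auto
    also have "\<dots> < top"
      using power_sum by (rule le_less_trans) simp
    finally show ?thesis unfolding r_def by simp
  qed
  have r_nonneg: "r i k \<ge> 0" for i k
    by (simp add: r_def)
  have power_real: "(\<Sum>i<m. \<Sum>k\<in>{1..n}. r i k) \<le> real n * real m * P"
  proof -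
    have "(\<Sum>k\<in>{1..n}. \<Sum>i<m. e i k) = (\<Sum>k\<in>{1..n}. \<Sum>i<m. ennreal (r i k))"
      by (intro sum.cong refl e_r) auto
    also have "\<dots> = ennreal (\<Sum>k\<in>{1..n}. \<Sum>i<m. r i k)"
      by (simp add: r_nonneg sum_nonneg)
    finally have "ennreal (\<Sum>k\<in>{1..n}. \<Sum>i<m. r i k) \<le> ennreal (real n * real m * P)"
      using power_sum by simp
    then show ?thesis
      using \<open>P \<ge> 0\<close> by (subst sum.swap) (simp add: ennreal_le_iff)
  qed

  have A_ge: "(\<Sum>l\<in>{1..<k}. \<alpha> (k - l) * r i l) \<ge> 0" for i k
    using r_nonneg \<alpha>_nonneg by (intro sum_nonneg mult_nonneg_nonneg) auto
  have output_power: "(\<integral>\<^sup>+ w. ennreal ((Y i k (\<lambda>t. U t w))\<^sup>2) \<partial>N)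
      = ennreal (r i k + (s2 + (\<Sum>l\<in>{1..<k}. \<alpha> (k - l) * r i l)))" if i: "i < m" and k: "k \<in> {1..n}" for i k
  proof -
    have "(\<integral>\<^sup>+ w. ennreal (v i k (\<lambda>t. U t w)) \<partial>N)
        = (\<integral>\<^sup>+ w. ennreal s2 + (\<Sum>l\<in>{1..<k}. ennreal (\<alpha> (k - l)) * ennreal ((X i l (\<lambda>t. U t w))\<^sup>2)) \<partial>N)"
    proof (intro nn_integral_cong)
      fix w
      have "(\<Sum>l\<in>{1..<k}. ennreal (\<alpha> (k - l)) * ennreal ((X i l (\<lambda>t. U t w))\<^sup>2))
          = ennreal (\<Sum>l\<in>{1..<k}. \<alpha> (k - l) * (X i l (\<lambda>t. U t w))\<^sup>2)"
        using \<alpha>_nonneg by (subst sum_ennreal[symmetric]) (auto simp: ennreal_mult'')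
      moreover have "0 \<le> (\<Sum>l\<in>{1..<k}. \<alpha> (k - l) * (X i l (\<lambda>t. U t w))\<^sup>2)"
        using \<alpha>_nonneg by (intro sum_nonneg mult_nonneg_nonneg) auto
      ultimately show "ennreal (v i k (\<lambda>t. U t w)) = ennreal s2 + (\<Sum>l\<in>{1..<k}. ennreal (\<alpha> (k - l)) * ennreal ((X i l (\<lambda>t. U t w))\<^sup>2))"
        using \<open>s2 > 0\<close> by (simp add: v_def noise_variance_def X_def ennreal_plus[symmetric] del: ennreal_plus)
    qed
    also have "\<dots> = ennreal s2 + (\<Sum>l\<in>{1..<k}. ennreal (\<alpha> (k - l)) * e i l)"
    proof -
      have m: "\<And>l. l \<in> {1..<k} \<Longrightarrow> (\<lambda>w. ennreal ((X i l (\<lambda>t. U t w))\<^sup>2)) \<in> borel_measurable N"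
        using X_sq_meas[OF i] k by auto
      have "(\<integral>\<^sup>+ w. (\<Sum>l\<in>{1..<k}. ennreal (\<alpha> (k - l)) * ennreal ((X i l (\<lambda>t. U t w))\<^sup>2)) \<partial>N)
          = (\<Sum>l\<in>{1..<k}. ennreal (\<alpha> (k - l)) * e i l)"
        unfolding e_def using m
        by (subst nn_integral_sum) (auto intro!: sum.cong nn_integral_cmult borel_measurable_times_ennreal simp del: One_nat_def)
      then show ?thesis
        using m by (subst nn_integral_add)
          (auto intro!: borel_measurable_sum borel_measurable_times_ennreal simp: emeasure_space_1 simp del: One_nat_def)
    qed
    also have "\<dots> = ennreal s2 + (\<Sum>l\<in>{1..<k}. ennreal (\<alpha> (k - l) * r i l))"
      using e_r[OF i] k \<alpha>_nonneg by (intro arg_cong2[where f="(+)"] refl sum.cong) (auto simp: ennreal_mult''[OF r_nonneg])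
    also have "\<dots> = ennreal s2 + ennreal (\<Sum>l\<in>{1..<k}. \<alpha> (k - l) * r i l)"
      using \<alpha>_nonneg r_nonneg by (subst sum_ennreal) auto
    also have "\<dots> = ennreal (s2 + (\<Sum>l\<in>{1..<k}. \<alpha> (k - l) * r i l))"
      by (rule ennreal_plus[symmetric, OF less_imp_le[OF \<open>s2 > 0\<close>] A_ge])
    finally have v_int: "(\<integral>\<^sup>+ w. ennreal (v i k (\<lambda>t. U t w)) \<partial>N) = ennreal (s2 + (\<Sum>l\<in>{1..<k}. \<alpha> (k - l) * r i l))" .
    have "(\<integral>\<^sup>+ w. ennreal ((Y i k (\<lambda>t. U t w))\<^sup>2) \<partial>N) = e i k + (\<integral>\<^sup>+ w. ennreal (v i k (\<lambda>t. U t w)) \<partial>N)"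
      unfolding Y_def e_def
      by (intro nn_integral_output_square X[OF that] v[OF that] order_trans[OF less_imp_le[OF \<open>s2 > 0\<close>] v_ge]) (use k in auto)
    also have "\<dots> = ennreal (r i k) + ennreal (s2 + (\<Sum>l\<in>{1..<k}. \<alpha> (k - l) * r i l))"
      by (simp only: v_int e_r[OF that])
    also have "\<dots> = ennreal (r i k + (s2 + (\<Sum>l\<in>{1..<k}. \<alpha> (k - l) * r i l)))"
      using r_nonneg \<open>s2 > 0\<close> \<alpha>_nonneg by (intro ennreal_plus[symmetric] add_nonneg_nonneg sum_nonneg mult_nonneg_nonneg) auto
    finally show ?thesis .
  qed
  have heat: "(\<Sum>k\<in>{1..n}. \<Sum>l\<in>{1..<k}. \<alpha> (k - l) * r i l) \<le> A * (\<Sum>k\<in>{1..n}. r i k)" for i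
  proof -
    have "(\<Sum>k\<in>{1..n}. \<Sum>l\<in>{1..<k}. \<alpha> (k - l) * r i l) = (\<Sum>l\<in>{1..n}. \<Sum>k\<in>{l<..n}. \<alpha> (k - l) * r i l)"
      by (subst sum.Sigma, simp, simp, subst sum.Sigma, simp, simp,
          rule sum.reindex_bij_witness[where i="\<lambda>(l, k). (k, l)" and j="\<lambda>(k, l). (l, k)"]) auto
    also have "\<dots> \<le> (\<Sum>l\<in>{1..n}. A * r i l)"
    proof (intro sum_mono)
      fix l
      have "(\<Sum>k\<in>{l<..n}. \<alpha> (k - l)) = (\<Sum>j<n - l. \<alpha> (Suc j))"
        by (rule sum.reindex_bij_witness[where i="\<lambda>j. Suc j + l" and j="\<lambda>k. k - Suc l"]) (auto simp: Suc_diff_Suc)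
      also have "\<dots> \<le> A"
        unfolding A_def using \<alpha>_nonneg by (intro sum_le_suminf[OF \<alpha>_summable]) auto
      finally show "(\<Sum>k\<in>{l<..n}. \<alpha> (k - l) * r i l) \<le> A * r i l"
        using r_nonneg by (simp add: sum_distrib_right[symmetric] mult_right_mono)
    qed
    finally show ?thesis by (simp add: sum_distrib_left)
  qed

  have bound_i: "ln (real m) * c i + real n / 2 + 1
      \<le> (real n * s2 + (1 + A) * (\<Sum>k\<in>{1..n}. r i k)) / (2 * s2) + (1 + real (m - 1) * q i) / 2 + ln 2" if i: "i < m" for i
  proof -
    let ?S = "\<Sum>k\<in>{1..n}. r i k + (s2 + (\<Sum>l\<in>{1..<k}. \<alpha> (k - l) * r i l))"
    have S_nonneg: "?S \<ge> 0"
      using \<alpha>_nonneg r_nonneg \<open>s2 > 0\<close> by (intro sum_nonneg add_nonneg_nonneg mult_nonneg_nonneg) auto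
    have "ennreal (ln (real m)) * ennreal (c i) + of_nat n / 2 + 1
      \<le> (\<Sum>k\<in>{1..n}. \<integral>\<^sup>+ w. ennreal ((Y i k (\<lambda>t. U t w))\<^sup>2) \<partial>N) * ennreal (1 / (2 * s2))
        + (1 + of_nat (m - 1) * ennreal (q i)) / 2 + ennreal (ln 2)"
      using decoding_bound[OF \<open>s2 > 0\<close> \<open>m > 0\<close> X[OF i] v[OF i] v_ge D[OF i]]
      unfolding Y_def c_def q_def emeasure_eq_measure by simp
    also have "(\<Sum>k\<in>{1..n}. \<integral>\<^sup>+ w. ennreal ((Y i k (\<lambda>t. U t w))\<^sup>2) \<partial>N) = ennreal ?S"
    proof -
      have "(\<Sum>k\<in>{1..n}. \<integral>\<^sup>+ w. ennreal ((Y i k (\<lambda>t. U t w))\<^sup>2) \<partial>N)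
          = (\<Sum>k\<in>{1..n}. ennreal (r i k + (s2 + (\<Sum>l\<in>{1..<k}. \<alpha> (k - l) * r i l))))"
        by (intro sum.cong refl output_power[OF i])
      also have "\<dots> = ennreal ?S"
        using A_ge r_nonneg \<open>s2 > 0\<close> by (intro sum_ennreal add_nonneg_nonneg) auto
      finally show ?thesis .
    qed
    also have "ennreal ?S * ennreal (1 / (2 * s2)) + (1 + of_nat (m - 1) * ennreal (q i)) / 2 + ennreal (ln 2)
        = ennreal (?S * (1 / (2 * s2)) + (1 + real (m - 1) * q i) / 2 + ln 2)"
    proof -
      have q: "q i \<ge> 0" by (simp add: q_def)
      have "(1 + of_nat (m - 1) * ennreal (q i)) / 2 = ennreal ((1 + real (m - 1) * q i) / 2)"
        using q by (simp only: ennreal_of_nat_eq_real_of_nat ennreal_mult'[symmetric] ennreal_1[symmetric] ennreal_numeral[symmetric]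
            ennreal_plus[symmetric] divide_ennreal mult_nonneg_nonneg add_nonneg_nonneg zero_le_one of_nat_0_le_iff zero_less_numeral)
      then show ?thesis
        using q S_nonneg \<open>s2 > 0\<close>
        by (simp only: ennreal_mult'[symmetric] ennreal_plus[symmetric] mult_nonneg_nonneg add_nonneg_nonneg
            divide_nonneg_nonneg zero_le_one zero_le_numeral less_imp_le of_nat_0_le_iff ln_ge_zero one_le_numeral)
    qed
    also have "ennreal (ln (real m)) * ennreal (c i) + of_nat n / 2 + 1 = ennreal (ln (real m) * c i + real n / 2 + 1)"
    proof -
      have "c i \<ge> 0" "ln (real m) \<ge> 0" using \<open>m > 0\<close> by (auto simp: c_def)
      moreover have "of_nat n / 2 = ennreal (real n / 2)"
        by (simp only: ennreal_of_nat_eq_real_of_nat ennreal_numeral[symmetric] divide_ennreal of_nat_0_le_iff zero_less_numeral)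
      ultimately show ?thesis
        by (simp only: ennreal_mult'[symmetric] ennreal_1[symmetric] ennreal_plus[symmetric] mult_nonneg_nonneg add_nonneg_nonneg
            divide_nonneg_nonneg zero_le_one zero_le_numeral of_nat_0_le_iff)
    qed
    finally have "ln (real m) * c i + real n / 2 + 1 \<le> ?S * (1 / (2 * s2)) + (1 + real (m - 1) * q i) / 2 + ln 2"
      using S_nonneg \<open>s2 > 0\<close>
      by (subst (asm) ennreal_le_iff) (auto intro!: add_nonneg_nonneg mult_nonneg_nonneg simp: q_def)
    also have "?S * (1 / (2 * s2)) \<le> (real n * s2 + (1 + A) * (\<Sum>k\<in>{1..n}. r i k)) / (2 * s2)"
    proof -
      have "?S = (\<Sum>k\<in>{1..n}. r i k) + real n * s2 + (\<Sum>k\<in>{1..n}. \<Sum>l\<in>{1..<k}. \<alpha> (k - l) * r i l)"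
        by (simp add: sum.distrib)
      also have "\<dots> \<le> real n * s2 + (1 + A) * (\<Sum>k\<in>{1..n}. r i k)"
        using heat[of i] by (simp add: algebra_simps)
      finally show ?thesis
        using \<open>s2 > 0\<close> by (simp add: divide_right_mono)
    qed
    finally show ?thesis by simp
  qed
  \<comment> \<open>Under white noise the observation does not depend on the message, so the
    disjoint decoding regions share a total probability of at most 1.\<close>
  have sum_q: "(\<Sum>i<m. q i) \<le> 1"
  proof -
    have "(\<Sum>i<m. q i) = prob (\<Union>i<m. {w \<in> space N. (\<lambda>k\<in>{1..n}. sqrt s2 * U k w) \<in> D i})"
      unfolding q_def
    proof (rule finite_measure_finite_Union[symmetric])
      show "(\<lambda>i. {w \<in> space N. (\<lambda>k\<in>{1..n}. sqrt s2 * U k w) \<in> D i}) ` {..<m} \<subseteq> events"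
        using measurable_sets[OF vec' D] by (auto simp: vimage_def Int_def conj_commute)
    qed (auto simp: disjoint_family_on_def D_def)
    then show ?thesis by simp
  qed
  have "error_prob N U s2 \<alpha> n m (fb_input s2 \<alpha> \<phi>) \<psi> = (\<Sum>i<m. 1 - c i) / real m"
  proof -
    have set_eq: "{w \<in> space N. \<psi> (\<lambda>k\<in>{1..n}. channel_output s2 \<alpha> (\<lambda>t. U t w) (fb_input s2 \<alpha> \<phi> i (\<lambda>t. U t w)) k) \<noteq> i}
       = space N - {w \<in> space N. (\<lambda>k\<in>{1..n}. Y i k (\<lambda>t. U t w)) \<in> D i}" for i
      by (auto simp: Y_output D_def space_PiM)
    have ev: "{w \<in> space N. (\<lambda>k\<in>{1..n}. Y i k (\<lambda>t. U t w)) \<in> D i} \<in> events" if "i < m" for i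
      using measurable_sets[OF vec[OF that] D[OF that]] by (simp add: vimage_def Int_def conj_commute)
    show ?thesis
      unfolding error_prob_def
      by (subst measure_message_noise_space[OF prob_space_axioms \<open>m > 0\<close>])
         (auto simp: set_eq c_def prob_compl ev simp del: One_nat_def intro!: sets.Diff sum.cong arg_cong2[where f="(/)"])
  qed
  then have err: "1 - error_prob N U s2 \<alpha> n m (fb_input s2 \<alpha> \<phi>) \<psi> = (\<Sum>i<m. c i) / real m"
    using \<open>m > 0\<close> by (simp add: sum_subtractf field_simps)
  have "(\<Sum>i<m. ln (real m) * c i + real n / 2 + 1)
      \<le> (\<Sum>i<m. (real n * s2 + (1 + A) * (\<Sum>k\<in>{1..n}. r i k)) / (2 * s2) + (1 + real (m - 1) * q i) / 2 + ln 2)"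
    by (intro sum_mono bound_i) auto
  then have "ln (real m) * (\<Sum>i<m. c i) + real m * real n / 2 + real m
      \<le> real m * real n * s2 / (2 * s2) + (1 + A) * (\<Sum>i<m. \<Sum>k\<in>{1..n}. r i k) / (2 * s2)
        + (real m + real (m - 1) * (\<Sum>i<m. q i)) / 2 + real m * ln 2"
    using \<open>s2 > 0\<close> by (simp add: sum.distrib sum_distrib_left sum_divide_distrib add_divide_distrib)
  moreover have "(1 + A) * (\<Sum>i<m. \<Sum>k\<in>{1..n}. r i k) / (2 * s2) \<le> (1 + A) * (real n * real m * P) / (2 * s2)"
    unfolding A_def using \<open>s2 > 0\<close> \<alpha>_nonneg
    by (intro divide_right_mono mult_left_mono power_real add_nonneg_nonneg suminf_nonneg \<alpha>_summable) auto
  moreover have "real (m - 1) * (\<Sum>i<m. q i) \<le> real m * 1"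
    using sum_q \<open>m > 0\<close> by (intro mult_mono) (auto simp: q_def intro!: sum_nonneg)
  moreover have "real m * real n * s2 / (2 * s2) = real m * real n / 2"
    using \<open>s2 > 0\<close> by simp
  moreover have "(1 + A) * (real n * real m * P) / (2 * s2) = real m * (real n * (1 / 2 * (1 + A) * P / s2))"
    by simp
  ultimately have "ln (real m) * (\<Sum>i<m. c i) \<le> real m * (real n * (1 / 2 * (1 + A) * P / s2)) + real m * ln 2"
    by argo
  then have "ln (real m) * (\<Sum>i<m. c i) \<le> real m * (real n * (1 / 2 * (1 + A) * P / s2) + ln 2)"
    by (simp only: distrib_left)
  then show ?thesis
    unfolding err A_def[symmetric] using \<open>m > 0\<close> by (simp add: field_simps)
qed

text \<open>\<open>fb_rate_bound\<close> is divided by \<open>n\<close> and by the probability of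
  correct decoding. The latter tends to 1, hence is positive for large \<open>n\<close>, and
  \<open>ln 2 / n\<close> vanishes.\<close>

lemma achievable_fb_le:
  assumes "s2 > 0" and \<alpha>_nonneg: "\<And>l. l \<ge> 1 \<Longrightarrow> \<alpha> l \<ge> 0" and \<alpha>_summable: "summable (\<lambda>l. \<alpha> (Suc l))"
    and "P \<ge> 0" and R: "achievable_fb N U s2 \<alpha> P R"
  shows "R \<le> 1 / 2 * (1 + (\<Sum>l. \<alpha> (Suc l))) * P / s2"
proof -
  let ?K = "1 / 2 * (1 + (\<Sum>l. \<alpha> (Suc l))) * P / s2"
  obtain m \<phi> \<psi> where code: "\<And>n. n \<ge> 1 \<Longrightarrow> m n > 0 \<and> fb_encoder n (m n) (\<phi> n) \<and> decoder n (m n) (\<psi> n) \<and>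
           power_constraint N U n (m n) (fb_input s2 \<alpha> (\<phi> n)) P"
    and rate: "ereal R \<le> liminf (\<lambda>n. ereal (ln (real (m n)) / real n))"
    and err: "(\<lambda>n. error_prob N U s2 \<alpha> n (m n) (fb_input s2 \<alpha> (\<phi> n)) (\<psi> n)) \<longlonglongrightarrow> 0"
    using R unfolding achievable_fb_def by blast
  define p where "p n = 1 - error_prob N U s2 \<alpha> n (m n) (fb_input s2 \<alpha> (\<phi> n)) (\<psi> n)" for n
  have p_lim: "p \<longlonglongrightarrow> 1"
    unfolding p_def using tendsto_diff[OF tendsto_const err, of 1] by simp
  have "(\<lambda>n. (?K + ln 2 / real n) / p n) \<longlonglongrightarrow> (?K + 0) / 1"
    by (intro tendsto_divide tendsto_add tendsto_const p_lim lim_const_over_n) simp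
  then have lim: "(\<lambda>n. ereal ((?K + ln 2 / real n) / p n)) \<longlonglongrightarrow> ereal ?K"
    by simp
  have "\<forall>\<^sub>F n in sequentially. p n > 0"
    using order_tendstoD(1)[OF p_lim] by simp
  then have "\<forall>\<^sub>F n in sequentially. ereal (ln (real (m n)) / real n) \<le> ereal ((?K + ln 2 / real n) / p n)"
    using eventually_gt_at_top[of 0]
  proof eventually_elim
    case (elim n)
    then have c: "m n > 0 \<and> fb_encoder n (m n) (\<phi> n) \<and> decoder n (m n) (\<psi> n) \<and>
           power_constraint N U n (m n) (fb_input s2 \<alpha> (\<phi> n)) P"
      by (intro code) auto
    have "p n * ln (real (m n)) \<le> real n * ?K + ln 2"
      unfolding p_def using c elim assms by (intro fb_rate_bound) auto
    then have "p n * ln (real (m n)) / real n \<le> (real n * ?K + ln 2) / real n"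
      using elim by (intro divide_right_mono) auto
    also have "\<dots> = ?K + ln 2 / real n"
      using elim by (simp add: add_divide_distrib)
    finally show ?case
      using elim by (simp add: pos_le_divide_eq mult.commute)
  qed
  then have "liminf (\<lambda>n. ereal (ln (real (m n)) / real n)) \<le> liminf (\<lambda>n. ereal ((?K + ln 2 / real n) / p n))"
    by (rule Liminf_mono)
  also have "\<dots> = ereal ?K"
    by (rule lim_imp_Liminf[OF _ lim]) simp
  finally show ?thesis
    using rate order_trans ereal_less_eq(3) by blast
qed

end

section \<open>Outer code and exponential moments\<close>

text \<open>A word of the ball is \<open>c\<close> patched on the set where the two differ. The set
  is chosen in at most \<open>2 ^ B\<close> ways and its letters in at most \<open>N ^ d\<close>.
  The crude factor \<open>2 ^ B\<close> costs \<open>ln 2\<close> per block, which is harmless for a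
  large alphabet.\<close>

lemma card_hamming_ball:
  fixes B d N :: nat and c :: "nat \<Rightarrow> nat"
  assumes "N > 0"
  shows "card {y \<in> {..<B} \<rightarrow>\<^sub>E {..<N}. card {b \<in> {..<B}. c b \<noteq> y b} \<le> d} \<le> 2 ^ B * N ^ d"
proof -
  let ?ball = "{y \<in> {..<B} \<rightarrow>\<^sub>E {..<N}. card {b \<in> {..<B}. c b \<noteq> y b} \<le> d}"
  let ?\<S> = "{S \<in> Pow {..<B}. card S \<le> d}"
  define patch where "patch S f = (\<lambda>b\<in>{..<B}. if b \<in> S then f b else c b)" for S and f :: "nat \<Rightarrow> nat"
  have "?ball \<subseteq> (\<Union>S\<in>?\<S>. patch S ` (S \<rightarrow>\<^sub>E {..<N}))"
  proof
    fix y assume y: "y \<in> ?ball"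
    define S where "S = {b \<in> {..<B}. c b \<noteq> y b}"
    have "y = patch S (restrict y S)"
      using y by (auto simp: patch_def S_def fun_eq_iff PiE_def extensional_def)
    moreover have "restrict y S \<in> S \<rightarrow>\<^sub>E {..<N}"
      using y by (auto simp: S_def PiE_def)
    moreover have "S \<in> ?\<S>"
      using y by (auto simp: S_def)
    ultimately show "y \<in> (\<Union>S\<in>?\<S>. patch S ` (S \<rightarrow>\<^sub>E {..<N}))" by blast
  qed
  then have "card ?ball \<le> card (\<Union>S\<in>?\<S>. patch S ` (S \<rightarrow>\<^sub>E {..<N}))"
    by (intro card_mono finite_UN_I finite_imageI finite_PiE) (auto intro: finite_subset)
  also have "\<dots> \<le> (\<Sum>S\<in>?\<S>. card (patch S ` (S \<rightarrow>\<^sub>E {..<N})))"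
    by (rule card_UN_le) simp
  also have "\<dots> \<le> (\<Sum>S\<in>?\<S>. N ^ d)"
  proof (intro sum_mono)
    fix S assume S: "S \<in> ?\<S>"
    then have fin: "finite S" by (auto intro: finite_subset)
    have "card (patch S ` (S \<rightarrow>\<^sub>E {..<N})) \<le> card (S \<rightarrow>\<^sub>E {..<N})"
      using fin by (intro card_image_le finite_PiE) auto
    also have "\<dots> = N ^ card S"
      using fin by (simp add: card_PiE)
    also have "\<dots> \<le> N ^ d"
      using S assms by (intro power_increasing) auto
    finally show "card (patch S ` (S \<rightarrow>\<^sub>E {..<N})) \<le> N ^ d" .
  qed
  also have "\<dots> = card ?\<S> * N ^ d"
    by simp
  also have "\<dots> \<le> card (Pow {..<B}) * N ^ d"
    by (intro mult_right_mono card_mono) auto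
  finally show ?thesis by (simp add: card_Pow)
qed

text \<open>In a code that is maximal under inclusion the balls of radius \<open>d\<close> cover all
  words, since an uncovered word could be added; counting gives the size.\<close>

lemma gilbert_varshamov:
  fixes B d N :: nat
  assumes "N > 0"
  shows "\<exists>C. C \<subseteq> {..<B} \<rightarrow>\<^sub>E {..<N} \<and>
    (\<forall>c\<in>C. \<forall>c'\<in>C. c \<noteq> c' \<longrightarrow> card {b \<in> {..<B}. c b \<noteq> c' b} > d) \<and>
    N ^ B \<le> card C * (2 ^ B * N ^ d)"
proof -
  let ?W = "{..<B} \<rightarrow>\<^sub>E {..<N}"
  let ?code = "\<lambda>C. C \<subseteq> ?W \<and> (\<forall>c\<in>C. \<forall>c'\<in>C. c \<noteq> c' \<longrightarrow> card {b \<in> {..<B}. c b \<noteq> c' b} > d)"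
  have finW: "finite ?W" by (intro finite_PiE) auto
  have "finite {C. ?code C}"
    by (rule finite_subset[of _ "Pow ?W"]) (use finW in auto)
  moreover have "{C. ?code C} \<noteq> {}"
    by (rule ex_in_conv[THEN iffD1], rule exI[of _ "{}"]) simp
  ultimately have "\<exists>C\<in>{C. ?code C}. \<forall>C'\<in>{C. ?code C}. C \<subseteq> C' \<longrightarrow> C = C'"
    by (rule finite_has_maximal)
  then obtain C where C_in: "C \<in> {C. ?code C}" and max': "\<forall>C'\<in>{C. ?code C}. C \<subseteq> C' \<longrightarrow> C = C'"
    by (rule bexE)
  from C_in have C: "?code C" by (rule CollectD)
  have max: "C = C'" if "?code C'" "C \<subseteq> C'" for C'
    using bspec[OF max' CollectI, OF that(1)] that(2) by (rule mp)
  have "?W \<subseteq> (\<Union>c\<in>C. {y \<in> ?W. card {b \<in> {..<B}. c b \<noteq> y b} \<le> d})"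
  proof
    fix y assume y: "y \<in> ?W"
    show "y \<in> (\<Union>c\<in>C. {y \<in> ?W. card {b \<in> {..<B}. c b \<noteq> y b} \<le> d})"
    proof (rule ccontr)
      assume "\<not> ?thesis"
      then have far: "\<And>c. c \<in> C \<Longrightarrow> card {b \<in> {..<B}. c b \<noteq> y b} > d"
        using y by force
      moreover have "{b \<in> {..<B}. y b \<noteq> c b} = {b \<in> {..<B}. c b \<noteq> y b}" for c by auto
      ultimately have "?code (insert y C)"
        using C y by auto
      then have "y \<in> C" using max[of "insert y C"] by blast
      with far[of y] show False by simp
    qed
  qed
  then have "card ?W \<le> card (\<Union>c\<in>C. {y \<in> ?W. card {b \<in> {..<B}. c b \<noteq> y b} \<le> d})"
    using finW C by (intro card_mono finite_UN_I) (auto intro: finite_subset)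
  also have "\<dots> \<le> (\<Sum>c\<in>C. card {y \<in> ?W. card {b \<in> {..<B}. c b \<noteq> y b} \<le> d})"
    using finW C by (intro card_UN_le) (auto intro: finite_subset)
  also have "\<dots> \<le> (\<Sum>c\<in>C. 2 ^ B * N ^ d)"
    by (intro sum_mono card_hamming_ball assms)
  finally have size: "N ^ B \<le> card C * (2 ^ B * N ^ d)"
    by (simp add: card_PiE)
  show ?thesis
    by (rule exI[of _ C], unfold conj_assoc[symmetric], intro conjI C size)
qed

text \<open>Markov's inequality for the product of the factors \<open>1 + F b\<close>: each failure
  contributes a factor of at least 2, and by independence the expectation factorises. Independence
  is asked of the majorants \<open>F b\<close>, not of the failures themselves.\<close>

lemma (in prob_space) prob_many_failures_le:
  fixes F :: "nat \<Rightarrow> 'a \<Rightarrow> ennreal" and \<epsilon> :: real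
  assumes indep: "indep_vars (\<lambda>_. borel) F {..<B}"
    and F_le: "\<And>b. b < B \<Longrightarrow> (\<integral>\<^sup>+ w. F b w \<partial>M) \<le> ennreal \<epsilon>"
    and bad: "\<And>b w. b < B \<Longrightarrow> w \<in> space M \<Longrightarrow> bad b w \<Longrightarrow> F b w \<ge> 1"
    and "\<epsilon> \<ge> 0"
    and ev: "{w \<in> space M. card {b \<in> {..<B}. bad b w} > t} \<in> events"
  shows "prob {w \<in> space M. card {b \<in> {..<B}. bad b w} > t} \<le> (1 + \<epsilon>) ^ B / 2 ^ Suc t"
proof -
  let ?E = "{w \<in> space M. card {b \<in> {..<B}. bad b w} > t}"
  have "2 ^ Suc t * emeasure M ?E = (\<integral>\<^sup>+ w. 2 ^ Suc t * indicator ?E w \<partial>M)"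
    by (rule nn_integral_cmult_indicator[OF ev, symmetric])
  also have "\<dots> \<le> (\<integral>\<^sup>+ w. (\<Prod>b\<in>{..<B}. 1 + F b w) \<partial>M)"
  proof (rule nn_integral_mono)
    fix w assume w: "w \<in> space M"
    let ?S = "{b \<in> {..<B}. bad b w}"
    have "2 ^ Suc t \<le> (\<Prod>b\<in>{..<B}. 1 + F b w)" if "card ?S > t"
    proof -
      have "(2::ennreal) ^ Suc t \<le> 2 ^ card ?S"
        using that by (intro power_increasing) auto
      also have "\<dots> = (\<Prod>b\<in>?S. 2)" by simp
      also have "\<dots> \<le> (\<Prod>b\<in>?S. 1 + F b w)"
      proof (rule prod_mono_ennreal)
        fix b assume "b \<in> ?S"
        then have "1 + 1 \<le> 1 + F b w" using bad[of b w] w by (intro add_left_mono) auto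
        then show "2 \<le> 1 + F b w" by simp
      qed
      also have "\<dots> = (\<Prod>b\<in>{..<B}. if b \<in> ?S then 1 + F b w else 1)"
        by (subst prod.If_cases) (auto intro!: prod.cong)
      also have "\<dots> \<le> (\<Prod>b\<in>{..<B}. 1 + F b w)"
        by (intro prod_mono_ennreal) auto
      finally show ?thesis .
    qed
    then show "2 ^ Suc t * indicator ?E w \<le> (\<Prod>b\<in>{..<B}. 1 + F b w)"
      by (auto simp: indicator_def)
  qed
  also have "\<dots> = (\<Prod>b\<in>{..<B}. \<integral>\<^sup>+ w. 1 + F b w \<partial>M)"
    by (rule indep_vars_nn_integral) (auto intro: indep_vars_compose2[OF indep])
  also have "\<dots> \<le> (\<Prod>b\<in>{..<B}. ennreal (1 + \<epsilon>))"
  proof (rule prod_mono_ennreal)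
    fix b assume b: "b \<in> {..<B}"
    have "F b \<in> borel_measurable M"
      using indep b by (auto simp: indep_vars_def)
    then have "(\<integral>\<^sup>+ w. 1 + F b w \<partial>M) = 1 + (\<integral>\<^sup>+ w. F b w \<partial>M)"
      by (subst nn_integral_add) (auto simp: emeasure_space_1)
    also have "\<dots> \<le> 1 + ennreal \<epsilon>"
      using b by (intro add_left_mono F_le) auto
    finally show "(\<integral>\<^sup>+ w. 1 + F b w \<partial>M) \<le> ennreal (1 + \<epsilon>)"
      using \<open>\<epsilon> \<ge> 0\<close> by simp
  qed
  also have "\<dots> = ennreal ((1 + \<epsilon>) ^ B)"
    using \<open>\<epsilon> \<ge> 0\<close> by (simp only: prod_constant card_lessThan) (rule ennreal_power, simp)
  also have "2 ^ Suc t * emeasure M ?E = ennreal (2 ^ Suc t * prob ?E)"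
    unfolding emeasure_eq_measure
    by (simp only: ennreal_mult'' measure_nonneg ennreal_power[symmetric] ennreal_numeral zero_le_numeral)
  finally have "2 ^ Suc t * prob ?E \<le> (1 + \<epsilon>) ^ B"
    using \<open>\<epsilon> \<ge> 0\<close> by (subst (asm) ennreal_le_iff) auto
  then show ?thesis by (simp add: field_simps)
qed

section \<open>Exponential moments of single output samples\<close>

context gaussian_noise
begin

lemma nn_integral_prod_U:
  assumes "finite I" and inj: "inj_on h I" and h: "\<And>i. i \<in> I \<Longrightarrow> h i \<ge> 1"
    and f: "\<And>i. i \<in> I \<Longrightarrow> f i \<in> borel_measurable borel"
  shows "(\<integral>\<^sup>+ w. (\<Prod>i\<in>I. f i (U (h i) w)) \<partial>N) = (\<Prod>i\<in>I. \<integral>\<^sup>+ t. f i t \<partial>std_normal)"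
proof -
  define g where "g k = f (the_inv_into I h k)" for k
  have g: "g (h i) = f i" if "i \<in> I" for i
    using that inj by (simp add: g_def the_inv_into_f_f)
  have "indep_vars (\<lambda>_. borel) (\<lambda>k w. g k (U k w)) (h ` I)"
  proof (rule indep_vars_compose2[where X=U and Y=g and M'="\<lambda>_. borel"])
    show "indep_vars (\<lambda>_. borel) U (h ` I)"
      using h by (intro indep_vars_subset[OF indep_U]) auto
  qed (use g f in auto)
  then have "(\<integral>\<^sup>+ w. (\<Prod>k\<in>h ` I. g k (U k w)) \<partial>N) = (\<Prod>k\<in>h ` I. \<integral>\<^sup>+ w. g k (U k w) \<partial>N)"
    using \<open>finite I\<close> by (intro indep_vars_nn_integral) auto
  also have "\<dots> = (\<Prod>k\<in>h ` I. \<integral>\<^sup>+ t. g k t \<partial>std_normal)"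
    using h f g by (intro prod.cong refl nn_integral_U) auto
  finally show ?thesis
    using inj g by (simp add: prod.reindex)
qed

end

text \<open>The variance enters only through the term in \<open>z\<^sup>2\<close>, so an upper bound
  on it suffices for both signs of \<open>z\<close>. Silent instants use \<open>z = 1\<close> and
  \<open>x = 0\<close>, pulses use negative \<open>z\<close> and \<open>x = \<xi>\<close>.\<close>

lemma nn_integral_std_normal_exp_affine_le:
  assumes "0 \<le> v" "v \<le> v0" "v0 > 0"
  shows "(\<integral>\<^sup>+ t. ennreal (exp (z * (\<xi> * (x + sqrt v * t) / v0))) \<partial>std_normal)
    \<le> ennreal (exp (z * (\<xi> * x / v0) + z\<^sup>2 * (\<xi>\<^sup>2 / (2 * v0))))"
proof -
  have "(\<integral>\<^sup>+ t. ennreal (exp (z * (\<xi> * (x + sqrt v * t) / v0))) \<partial>std_normal)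
     = (\<integral>\<^sup>+ t. ennreal (exp (z * (\<xi> * x / v0))) * ennreal (exp ((z * \<xi> * sqrt v / v0) * t)) \<partial>std_normal)"
    by (intro nn_integral_cong)
       (simp add: ennreal_mult'[symmetric] mult_exp_exp algebra_simps add_divide_distrib)
  also have "\<dots> = ennreal (exp (z * (\<xi> * x / v0))) * ennreal (exp ((z * \<xi> * sqrt v / v0)\<^sup>2 / 2))"
    by (subst nn_integral_cmult) (simp_all add: nn_integral_std_normal_exp del: times_divide_eq_left)
  also have "\<dots> = ennreal (exp (z * (\<xi> * x / v0) + z\<^sup>2 * (\<xi>\<^sup>2 / (2 * v0)) * (v / v0)))"
  proof -
    have "(z * \<xi> * sqrt v / v0)\<^sup>2 / 2 = z\<^sup>2 * (\<xi>\<^sup>2 / (2 * v0)) * (v / v0)"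
      using assms by (simp add: power_mult_distrib power_divide) (simp add: power2_eq_square)
    then show ?thesis by (simp only: ennreal_mult'[symmetric] mult_exp_exp exp_ge_zero)
  qed
  also have "\<dots> \<le> ennreal (exp (z * (\<xi> * x / v0) + z\<^sup>2 * (\<xi>\<^sup>2 / (2 * v0))))"
  proof -
    have "z\<^sup>2 * (\<xi>\<^sup>2 / (2 * v0)) * (v / v0) \<le> z\<^sup>2 * (\<xi>\<^sup>2 / (2 * v0))"
      using assms by (intro mult_left_le) auto
    then show ?thesis by (intro ennreal_leI) simp
  qed
  finally show ?thesis .
qed

text \<open>\<open>\<theta> < 1\<close> is what keeps this moment finite when \<open>v\<close>
  reaches \<open>v0\<close>. The price \<open>- ln (1 - \<theta>) / 2\<close> does not depend on the
  pulse height.\<close>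

lemma nn_integral_std_normal_exp_square_le_off:
  assumes "0 \<le> v" "v \<le> v0" "v0 > 0" "0 < \<theta>" "\<theta> < 1"
  shows "(\<integral>\<^sup>+ t. ennreal (exp (\<theta> * (sqrt v * t)\<^sup>2 / (2 * v0))) \<partial>std_normal)
    \<le> ennreal (exp (- ln (1 - \<theta>) / 2))"
proof -
  have le: "\<theta> * (v / v0) \<le> \<theta>"
    using assms by (intro mult_left_le) auto
  have "(\<integral>\<^sup>+ t. ennreal (exp (\<theta> * (sqrt v * t)\<^sup>2 / (2 * v0))) \<partial>std_normal)
     = (\<integral>\<^sup>+ t. ennreal (exp (- (- (\<theta> * (v / v0))) * t\<^sup>2 / 2)) \<partial>std_normal)"
    using assms by (intro nn_integral_cong) (simp add: power_mult_distrib mult.assoc)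
  also have "\<dots> = ennreal (1 / sqrt (1 + - (\<theta> * (v / v0))))"
    by (rule nn_integral_std_normal_exp_square) (use le \<open>\<theta> < 1\<close> in linarith)
  also have "\<dots> \<le> ennreal (1 / sqrt (1 - \<theta>))"
  proof -
    have "1 - \<theta> \<le> 1 + - (\<theta> * (v / v0))" "0 < sqrt (1 - \<theta>)"
      using le \<open>\<theta> < 1\<close> by auto
    then show ?thesis by (intro ennreal_leI frac_le real_sqrt_le_mono) auto
  qed
  also have "1 / sqrt (1 - \<theta>) = exp (- ln (1 - \<theta>) / 2)"
    using assms by (simp add: exp_minus ln_sqrt[symmetric] inverse_eq_divide)
  finally show ?thesis .
qed

text \<open>The moment decreases in \<open>v\<close>, so a lower bound on the variance is enough.
  The quadratic form in \<open>z\<close> comes from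
  \<open>ln (1 + y) \<ge> y - y\<^sup>2\<close>.\<close>

lemma nn_integral_std_normal_exp_square_le_on:
  assumes "v0 > 0" "\<theta> > 0" "c \<ge> 0" "c \<le> v / v0" "z \<ge> 0"
  shows "(\<integral>\<^sup>+ t. ennreal (exp (- z * (\<theta> * (sqrt v * t)\<^sup>2 / (2 * v0)))) \<partial>std_normal)
    \<le> ennreal (exp (- z * (\<theta> * c / 2) + z\<^sup>2 * (\<theta>\<^sup>2 * c\<^sup>2 / 2)))"
proof -
  define y where "y = z * \<theta> * c"
  have y: "0 \<le> y" "y \<le> z * \<theta> * (v / v0)"
    unfolding y_def using assms by (auto intro!: mult_left_mono simp del: times_divide_eq_right)
  have "v \<ge> 0"
    using assms by (metis order_trans zero_le_divide_iff less_imp_le linorder_not_less)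
  have "(\<integral>\<^sup>+ t. ennreal (exp (- z * (\<theta> * (sqrt v * t)\<^sup>2 / (2 * v0)))) \<partial>std_normal)
     = (\<integral>\<^sup>+ t. ennreal (exp (- (z * \<theta> * (v / v0)) * t\<^sup>2 / 2)) \<partial>std_normal)"
    using assms \<open>v \<ge> 0\<close> by (intro nn_integral_cong) (simp add: power_mult_distrib mult.assoc)
  also have "\<dots> = ennreal (1 / sqrt (1 + z * \<theta> * (v / v0)))"
    using y by (intro nn_integral_std_normal_exp_square) linarith
  also have "\<dots> \<le> ennreal (1 / sqrt (1 + y))"
    using y by (intro ennreal_leI divide_left_mono real_sqrt_le_mono mult_pos_pos) auto
  also have "1 / sqrt (1 + y) = exp (- ln (1 + y) / 2)"
    using y by (simp add: exp_minus ln_sqrt[symmetric] inverse_eq_divide)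
  also have "ennreal (exp (- ln (1 + y) / 2)) \<le> ennreal (exp (- (y - y\<^sup>2) / 2))"
  proof -
    have "y - y\<^sup>2 \<le> ln (1 + y)"
    proof (cases "y \<le> 1")
      case True
      with y show ?thesis by (intro ln_one_plus_pos_lower_bound)
    next
      case False
      then have "y * 1 \<le> y * y" by (intro mult_left_mono) auto
      then have "y - y\<^sup>2 \<le> 0" by (simp add: power2_eq_square)
      also have "0 \<le> ln (1 + y)" using y by simp
      finally show ?thesis .
    qed
    then show ?thesis by (intro ennreal_leI) simp
  qed
  also have "- (y - y\<^sup>2) / 2 = - z * (\<theta> * c / 2) + z\<^sup>2 * (\<theta>\<^sup>2 * c\<^sup>2 / 2)"
    by (simp add: y_def power2_eq_square field_simps)
  finally show ?thesis .
qed

section \<open>Pulse-position modulation\<close>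

text \<open>
  Time is cut into windows of length \<open>L\<close>; a window carries a pulse \<open>\<xi>\<close> at its first instant or is
  silent. \<open>K\<close> consecutive windows form a slot, \<open>M\<close> consecutive slots a block, and in each of the first
  \<open>B\<close> blocks exactly one slot is active, meaning that all its windows carry a pulse; its position is
  the letter sent in that block. As pulses are at least \<open>L\<close> apart, the heat of all earlier windows
  together is at most \<open>v0 - s2\<close>, whatever the codeword. Only the first \<open>L0 + 1\<close> outputs of a window
  enter the detector, so that \<open>L0\<close> can be chosen before \<open>\<xi>\<close> and \<open>L\<close> after it.
\<close>

locale pulse_position = gaussian_noise N U for N :: "'w measure" and U +
  fixes s2 \<xi> v0 \<theta> :: real and \<alpha> :: "nat \<Rightarrow> real" and L0 L K M :: nat
  assumes s2_pos: "s2 > 0" and \<alpha>_nonneg: "\<And>l. l \<ge> 1 \<Longrightarrow> \<alpha> l \<ge> 0"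
    and \<alpha>_summable: "summable (\<lambda>l. \<alpha> (Suc l))"
    and L0_less: "L0 < L" and K_pos: "K > 0" and M_pos: "M > 0" and \<xi>_nz: "\<xi> \<noteq> 0"
    and heat: "s2 + \<xi>\<^sup>2 * (\<Sum>j. \<alpha> (j + L)) \<le> v0"
    and \<theta>: "0 < \<theta>" "\<theta> < 1"
begin

definition active :: "nat \<Rightarrow> (nat \<Rightarrow> nat) \<Rightarrow> nat \<Rightarrow> bool" where
  "active B c s \<longleftrightarrow> s < B * M \<and> s mod M = c (s div M)"

definition codeword :: "nat \<Rightarrow> (nat \<Rightarrow> nat) \<Rightarrow> nat \<Rightarrow> real" where
  "codeword B c k = (if k \<ge> 1 \<and> L dvd (k - 1) \<and> active B c ((k - 1) div L div K) then \<xi> else 0)"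

text \<open>Windows are numbered globally by \<open>s * K + r\<close>; \<open>i = 0\<close> is the
  instant that may carry the pulse, and the final \<open>+ 1\<close> reflects that time starts at
  1.\<close>

definition time :: "nat \<Rightarrow> nat \<Rightarrow> nat \<Rightarrow> nat" where
  "time s r i = (s * K + r) * L + i + 1"

text \<open>The log-likelihood ratio of pulse against silence over background variance
  \<open>v0\<close>, simplified and without additive constants: linear at the pulse, quadratic
  afterwards. With \<open>v1\<close> the variance after a pulse, the exact quadratic weight would be
  \<open>1 / v0 - 1 / v1\<close>; \<open>\<theta> / v0\<close> replaces it, whatever
  \<open>v1\<close> is.\<close>

definition stat :: "nat \<Rightarrow> real \<Rightarrow> real" where
  "stat i y = (if i = 0 then \<xi> * y / v0 else \<theta> * y\<^sup>2 / (2 * v0))"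

definition slot_stat :: "nat \<Rightarrow> (nat \<Rightarrow> real) \<Rightarrow> real" where
  "slot_stat s y = (\<Sum>(r, i)\<in>{..<K} \<times> {..L0}. stat i (y (time s r i)))"

definition cw_variance :: "nat \<Rightarrow> (nat \<Rightarrow> nat) \<Rightarrow> nat \<Rightarrow> real" where
  "cw_variance B c k = noise_variance s2 \<alpha> (codeword B c) k"

definition received :: "nat \<Rightarrow> (nat \<Rightarrow> nat) \<Rightarrow> (nat \<Rightarrow> real) \<Rightarrow> nat \<Rightarrow> real" where
  "received B c u k = channel_output s2 \<alpha> u (codeword B c) k"

text \<open>Bound, per window, on the logarithm of the exponential moment of the statistic in
  silence.\<close>

definition drift :: real where
  "drift = (\<Sum>i\<le>L0. if i = 0 then \<xi>\<^sup>2 / (2 * v0) else - ln (1 - \<theta>) / 2)"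

text \<open>Lower bound on the expected statistic of a window with a pulse: at later instants only
  the heat of that pulse is counted.\<close>

definition mean :: real where
  "mean = (\<Sum>i\<le>L0. if i = 0 then \<xi>\<^sup>2 / v0 else \<theta> * (\<alpha> i * \<xi>\<^sup>2 / v0) / 2)"

text \<open>The coefficient of the square of the exponent in the moment bound for an active window;
  it plays the role of half a variance.\<close>

definition spread :: real where
  "spread = (\<Sum>i\<le>L0. if i = 0 then \<xi>\<^sup>2 / (2 * v0) else \<theta>\<^sup>2 * (\<alpha> i * \<xi>\<^sup>2 / v0)\<^sup>2 / 2)"

text \<open>The margin of one unit per window makes a miss exponentially unlikely in
  \<open>K\<close>, and it is negligible against \<open>mean\<close> for a strong pulse.\<close>

definition threshold :: real where
  "threshold = real K * (mean - 1)"

text \<open>Chernoff bound for missing the active slot, plus a union bound over false alarms in the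
  other slots.\<close>

definition block_error :: real where
  "block_error = exp (- real K / (4 * spread)) + real M * exp (- real K * (mean - drift - 1))"

lemma L_pos: "L > 0" using L0_less by simp

lemma tail_summable: "summable (\<lambda>j. \<alpha> (j + L))"
proof -
  obtain L' where "L = Suc L'" using L_pos by (cases L) auto
  then show ?thesis
    using summable_ignore_initial_segment[OF \<alpha>_summable, of L'] by simp
qed

lemma v0_pos: "v0 > 0"
proof -
  have "0 \<le> (\<Sum>j. \<alpha> (j + L))"
    using \<alpha>_nonneg L_pos by (intro suminf_nonneg tail_summable) simp
  then have "0 \<le> \<xi>\<^sup>2 * (\<Sum>j. \<alpha> (j + L))" by simp
  with heat s2_pos show ?thesis by linarith
qed

section \<open>Pulse times and the heat at the sampled instants\<close>

lemma time_ge_1: "time s r i \<ge> 1"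
  by (simp add: time_def)

lemma time_div_mod:
  assumes "i < L" "r < K"
  shows "(time s r i - 1) div L = s * K + r" "(time s r i - 1) mod L = i" "(time s r i - 1) div L div K = s"
  using assms by (auto simp: time_def)

lemma codeword_time:
  assumes "i < L" "r < K"
  shows "codeword B c (time s r i) = (if i = 0 \<and> active B c s then \<xi> else 0)"
  using time_div_mod[OF assms, of s] time_ge_1[of s r i]
  by (simp add: codeword_def dvd_eq_mod_eq_0)

text \<open>Pulses occur only at starts of windows, so fewer than \<open>L\<close> instants back
  only the start of the current window can carry one. In the proof, comparing multiples of
  \<open>L\<close> forces the two window numbers to agree.\<close>

lemma codeword_near:
  assumes "i < L" "r < K" "l \<in> {1..<time s r i}" "time s r i < l + L" "codeword B c l \<noteq> 0"
  shows "l = time s r 0 \<and> active B c s"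
proof -
  define g where "g = s * K + r"
  have "L dvd (l - 1)" using assms by (auto simp: codeword_def split: if_splits)
  then obtain q where "l - 1 = L * q" by (elim dvdE)
  then have l: "l = q * L + 1" using assms(3) by (simp add: mult.commute) linarith
  have t: "time s r i = g * L + i + 1" by (simp add: time_def g_def)
  have "q * L < (g + 1) * L" "g * L < (q + 1) * L"
    using assms(1,3,4) unfolding l t by auto
  then have "q < g + 1" "g < q + 1" by (simp_all only: mult_less_cancel2)
  then have "q = g" by simp
  then have "l = time s r 0" by (simp add: l time_def g_def)
  moreover from this have "active B c s"
    using assms(5) codeword_time[of 0 r B c s] L_pos \<open>r < K\<close> by (auto split: if_splits)
  ultimately show ?thesis by simp
qed

lemma cw_variance_ge: "cw_variance B c k \<ge> s2"
  unfolding cw_variance_def by (intro noise_variance_ge \<alpha>_nonneg)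

lemma cw_variance_nonneg: "cw_variance B c k \<ge> 0"
  using cw_variance_ge[of B c k] s2_pos by linarith

text \<open>Even a pulse at every instant at distance \<open>L\<close> or more would leave no more
  heat than the tail sum in the locale assumption \<open>heat\<close>. This makes the bound uniform
  in the codeword.\<close>

lemma cw_variance_le:
  assumes "\<And>l. l \<in> {1..<k} \<Longrightarrow> k < l + L \<Longrightarrow> codeword B c l = 0"
  shows "cw_variance B c k \<le> v0"
proof -
  have "(\<Sum>l\<in>{1..<k}. \<alpha> (k - l) * (codeword B c l)\<^sup>2)
      \<le> (\<Sum>l\<in>{1..<k}. if l + L \<le> k then \<alpha> (k - l) * \<xi>\<^sup>2 else 0)"
    using \<alpha>_nonneg assms by (intro sum_mono) (auto simp: codeword_def)
  also have "\<dots> = (\<Sum>l\<in>{l \<in> {1..<k}. l + L \<le> k}. \<alpha> (k - l) * \<xi>\<^sup>2)"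
    by (rule sum.inter_filter[symmetric]) simp
  also have "\<dots> = (\<Sum>j<k - L. \<alpha> (j + L) * \<xi>\<^sup>2)"
    using L_pos
    by (intro sum.reindex_bij_witness[where i="\<lambda>j. k - L - j" and j="\<lambda>l. k - L - l"]) auto
  also have "\<dots> = (\<Sum>j<k - L. \<alpha> (j + L)) * \<xi>\<^sup>2"
    by (simp add: sum_distrib_right)
  also have "\<dots> \<le> (\<Sum>j. \<alpha> (j + L)) * \<xi>\<^sup>2"
    using \<alpha>_nonneg L_pos by (intro mult_right_mono sum_le_suminf tail_summable) auto
  finally show ?thesis
    using heat by (simp add: cw_variance_def noise_variance_def mult.commute)
qed

text \<open>The only pulse that could be near is the one sent at this very instant, and an input
  does not heat its own output.\<close>

lemma cw_variance_le_pulse: "r < K \<Longrightarrow> cw_variance B c (time s r 0) \<le> v0"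
  using codeword_near[of 0 r _ s B c] L_pos by (intro cw_variance_le) force

lemma cw_variance_le_inactive: "\<not> active B c s \<Longrightarrow> i < L \<Longrightarrow> r < K \<Longrightarrow> cw_variance B c (time s r i) \<le> v0"
  using codeword_near[of i r _ s B c] by (intro cw_variance_le) blast

lemma cw_variance_ge_active:
  assumes "active B c s" "i < L" "r < K" "i > 0"
  shows "cw_variance B c (time s r i) \<ge> \<alpha> i * \<xi>\<^sup>2"
proof -
  have "\<alpha> (time s r i - time s r 0) * (codeword B c (time s r 0))\<^sup>2
      \<le> (\<Sum>l\<in>{1..<time s r i}. \<alpha> (time s r i - l) * (codeword B c l)\<^sup>2)"
    using assms \<alpha>_nonneg
    by (intro member_le_sum[where f="\<lambda>l. \<alpha> (time s r i - l) * (codeword B c l)\<^sup>2"]) (auto simp: time_def)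
  moreover have "time s r i - time s r 0 = i" by (simp add: time_def)
  moreover have "codeword B c (time s r 0) = \<xi>"
    using codeword_time[of 0 r B c s] assms by simp
  ultimately show ?thesis
    using s2_pos by (simp add: cw_variance_def noise_variance_def)
qed

lemma received_eq: "received B c u k = codeword B c k + sqrt (cw_variance B c k) * u k"
  by (simp add: received_def cw_variance_def channel_output_noise_variance)

section \<open>Exponential moments of a slot\<close>

lemma inj_on_time: "inj_on (\<lambda>(r, i). time s r i) ({..<K} \<times> {..L0})"
proof (rule inj_onI, clarify)
  fix r i r' i' assume "r < K" "r' < K" "i \<le> L0" "i' \<le> L0" and eq: "time s r i = time s r' i'"
  then have lt: "i < L" "i' < L" using L0_less by auto
  have "i = i'" "s * K + r = s * K + r'"
    using time_div_mod[OF lt(1) \<open>r < K\<close>, of s] time_div_mod[OF lt(2) \<open>r' < K\<close>, of s] eq by auto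
  then show "r = r' \<and> i = i'" by simp
qed

text \<open>For a fixed codeword all inputs and noise variances are constants, and the samples of a
  slot use distinct noise variables, so the exponential moment is a product over the
  samples.\<close>

lemma mgf_slot_stat_le:
  assumes factor: "\<And>r i. r < K \<Longrightarrow> i \<le> L0 \<Longrightarrow>
    (\<integral>\<^sup>+ t. ennreal (exp (z * stat i (codeword B c (time s r i) + sqrt (cw_variance B c (time s r i)) * t))) \<partial>std_normal)
      \<le> ennreal (exp (e i))"
  shows "(\<integral>\<^sup>+ w. ennreal (exp (z * slot_stat s (received B c (\<lambda>t. U t w)))) \<partial>N) \<le> ennreal (exp (real K * (\<Sum>i\<le>L0. e i)))"
proof -
  let ?I = "{..<K} \<times> {..L0}"
  define f where "f p t = ennreal (exp (z * stat (snd p)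
      (codeword B c (time s (fst p) (snd p)) + sqrt (cw_variance B c (time s (fst p) (snd p))) * t)))" for p t
  have "(\<integral>\<^sup>+ w. ennreal (exp (z * slot_stat s (received B c (\<lambda>t. U t w)))) \<partial>N)
      = (\<integral>\<^sup>+ w. (\<Prod>p\<in>?I. f p (U ((\<lambda>(r, i). time s r i) p) w)) \<partial>N)"
    unfolding slot_stat_def f_def
    by (simp add: sum_distrib_left exp_sum prod_ennreal case_prod_unfold received_eq)
  also have "\<dots> = (\<Prod>p\<in>?I. \<integral>\<^sup>+ t. f p t \<partial>std_normal)"
    by (intro nn_integral_prod_U inj_on_time) (auto simp: f_def stat_def simp del: One_nat_def intro: time_ge_1)
  also have "\<dots> \<le> (\<Prod>p\<in>?I. ennreal (exp (e (snd p))))"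
    unfolding f_def by (intro prod_mono_ennreal factor) auto
  also have "\<dots> = ennreal (exp (\<Sum>p\<in>?I. e (snd p)))"
    by (simp add: prod_ennreal exp_sum)
  also have "(\<Sum>p\<in>?I. e (snd p)) = real K * (\<Sum>i\<le>L0. e i)"
    using sum.cartesian_product[of "\<lambda>r i. e i" "{..L0}" "{..<K}"] by (simp add: case_prod_unfold)
  finally show ?thesis .
qed

text \<open>The exponent 1 is the natural one, as the statistic imitates a log-likelihood
  ratio.\<close>

lemma mgf_inactive:
  assumes "\<not> active B c s"
  shows "(\<integral>\<^sup>+ w. ennreal (exp (slot_stat s (received B c (\<lambda>t. U t w)))) \<partial>N) \<le> ennreal (exp (real K * drift))"
proof -
  have "(\<integral>\<^sup>+ w. ennreal (exp (1 * slot_stat s (received B c (\<lambda>t. U t w)))) \<partial>N)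
      \<le> ennreal (exp (real K * (\<Sum>i\<le>L0. if i = 0 then \<xi>\<^sup>2 / (2 * v0) else - ln (1 - \<theta>) / 2)))"
  proof (rule mgf_slot_stat_le)
    fix r i assume r: "r < K" and i: "i \<le> L0"
    then have "i < L" using L0_less by simp
    then have x: "codeword B c (time s r i) = 0"
      using codeword_time[of i r B c s] r assms by simp
    have v: "cw_variance B c (time s r i) \<le> v0"
      using cw_variance_le_inactive assms \<open>i < L\<close> r by blast
    show "(\<integral>\<^sup>+ t. ennreal (exp (1 * stat i (codeword B c (time s r i) + sqrt (cw_variance B c (time s r i)) * t))) \<partial>std_normal)
      \<le> ennreal (exp (if i = 0 then \<xi>\<^sup>2 / (2 * v0) else - ln (1 - \<theta>) / 2))"
    proof (cases "i = 0")
      case True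
      then show ?thesis
        using nn_integral_std_normal_exp_affine_le[OF cw_variance_nonneg v v0_pos, of 1 \<xi> 0] x by (simp add: stat_def)
    next
      case False
      then show ?thesis
        using nn_integral_std_normal_exp_square_le_off[OF cw_variance_nonneg v v0_pos \<theta>] by (simp add: stat_def x)
    qed
  qed
  then show ?thesis by (simp add: drift_def)
qed

text \<open>Heat left by earlier pulses can only enlarge the variance of the squared samples, which
  lowers this moment; at the pulse itself it is covered by \<open>v0\<close>.\<close>

lemma mgf_active:
  assumes "active B c s" "z \<ge> 0"
  shows "(\<integral>\<^sup>+ w. ennreal (exp (- z * slot_stat s (received B c (\<lambda>t. U t w)))) \<partial>N)
      \<le> ennreal (exp (real K * (- z * mean + z\<^sup>2 * spread)))"
proof -
  let ?\<mu> = "\<lambda>i. if i = 0 then \<xi>\<^sup>2 / v0 else \<theta> * (\<alpha> i * \<xi>\<^sup>2 / v0) / 2"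
  let ?\<sigma> = "\<lambda>i. if i = 0 then \<xi>\<^sup>2 / (2 * v0) else \<theta>\<^sup>2 * (\<alpha> i * \<xi>\<^sup>2 / v0)\<^sup>2 / 2"
  have "(\<integral>\<^sup>+ w. ennreal (exp (- z * slot_stat s (received B c (\<lambda>t. U t w)))) \<partial>N)
      \<le> ennreal (exp (real K * (\<Sum>i\<le>L0. - z * ?\<mu> i + z\<^sup>2 * ?\<sigma> i)))"
  proof (rule mgf_slot_stat_le)
    fix r i assume r: "r < K" and i: "i \<le> L0"
    then have "i < L" using L0_less by simp
    show "(\<integral>\<^sup>+ t. ennreal (exp (- z * stat i (codeword B c (time s r i) + sqrt (cw_variance B c (time s r i)) * t))) \<partial>std_normal)
      \<le> ennreal (exp (- z * ?\<mu> i + z\<^sup>2 * ?\<sigma> i))"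
    proof (cases "i = 0")
      case True
      have x: "codeword B c (time s r 0) = \<xi>"
        using codeword_time[of 0 r B c s] r assms L_pos by simp
      show ?thesis
        using True nn_integral_std_normal_exp_affine_le[OF cw_variance_nonneg cw_variance_le_pulse[OF r] v0_pos, of "- z" \<xi> \<xi>]
        by (simp add: stat_def x power2_eq_square[of \<xi>])
    next
      case False
      then have x: "codeword B c (time s r i) = 0"
        using codeword_time[of i r B c s] r \<open>i < L\<close> by simp
      have c: "0 \<le> \<alpha> i * \<xi>\<^sup>2 / v0" "\<alpha> i * \<xi>\<^sup>2 / v0 \<le> cw_variance B c (time s r i) / v0"
        using \<alpha>_nonneg[of i] v0_pos False cw_variance_ge_active[OF assms(1) \<open>i < L\<close> r] by (auto simp: divide_right_mono)
      show ?thesis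
        using False nn_integral_std_normal_exp_square_le_on[OF v0_pos \<theta>(1) c \<open>z \<ge> 0\<close>] by (simp add: stat_def x)
    qed
  qed
  also have "(\<Sum>i\<le>L0. - z * ?\<mu> i + z\<^sup>2 * ?\<sigma> i) = - z * mean + z\<^sup>2 * spread"
    unfolding mean_def spread_def by (simp only: sum.distrib sum_distrib_left)
  finally show ?thesis .
qed

lemma spread_pos: "spread > 0"
proof -
  have "(if (0::nat) = 0 then \<xi>\<^sup>2 / (2 * v0) else \<theta>\<^sup>2 * (\<alpha> 0 * \<xi>\<^sup>2 / v0)\<^sup>2 / 2) \<le> spread"
    unfolding spread_def using v0_pos
    by (intro member_le_sum[where f="\<lambda>i. if i = 0 then \<xi>\<^sup>2 / (2 * v0) else \<theta>\<^sup>2 * (\<alpha> i * \<xi>\<^sup>2 / v0)\<^sup>2 / 2"]) auto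
  moreover have "\<xi>\<^sup>2 / (2 * v0) > 0" using \<xi>_nz v0_pos by simp
  ultimately show ?thesis by simp
qed

text \<open>Asking all other slots to stay below the threshold means that at most one position
  \<open>j < M\<close> is detected per block; uniqueness of decoding rests on this.\<close>

definition detected :: "nat \<Rightarrow> nat \<Rightarrow> (nat \<Rightarrow> real) \<Rightarrow> bool" where
  "detected b j y \<longleftrightarrow> slot_stat (b * M + j) y > threshold \<and>
     (\<forall>j'<M. j' \<noteq> j \<longrightarrow> slot_stat (b * M + j') y \<le> threshold)"

text \<open>A majorant of the indicator of failure, with the exponential bounds and the union bound
  built in. The first exponent is the optimal one for \<open>mgf_active\<close>.\<close>

definition failure_bound :: "nat \<Rightarrow> (nat \<Rightarrow> nat) \<Rightarrow> nat \<Rightarrow> (nat \<Rightarrow> real) \<Rightarrow> ennreal" where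
  "failure_bound B c b u =
     ennreal (exp (1 / (2 * spread) * (threshold - slot_stat (b * M + c b) (received B c u)))) +
     (\<Sum>j\<in>{..<M} - {c b}. ennreal (exp (slot_stat (b * M + j) (received B c u) - threshold)))"

lemma failure_bound_ge_1:
  assumes "\<not> detected b (c b) (received B c u)"
  shows "failure_bound B c b u \<ge> 1"
proof -
  consider "slot_stat (b * M + c b) (received B c u) \<le> threshold"
    | j where "j < M" "j \<noteq> c b" "slot_stat (b * M + j) (received B c u) > threshold"
    using assms unfolding detected_def by force
  then show ?thesis
  proof cases
    case 1
    then have "1 \<le> ennreal (exp (1 / (2 * spread) * (threshold - slot_stat (b * M + c b) (received B c u))))"
      using spread_pos by simp
    then show ?thesis unfolding failure_bound_def by (rule order_trans) simp
  next
    case (2 j)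
    have "1 \<le> ennreal (exp (slot_stat (b * M + j) (received B c u) - threshold))"
      using 2 by simp
    also have "\<dots> \<le> (\<Sum>j\<in>{..<M} - {c b}. ennreal (exp (slot_stat (b * M + j) (received B c u) - threshold)))"
      using 2 by (intro member_le_sum[where f="\<lambda>j. ennreal (exp (slot_stat (b * M + j) (received B c u) - threshold))"]) auto
    also have "\<dots> \<le> failure_bound B c b u" unfolding failure_bound_def by simp
    finally show ?thesis .
  qed
qed

section \<open>Independence of the blocks\<close>

abbreviation block_length :: nat where
  "block_length \<equiv> M * K * L"

definition block_times :: "nat \<Rightarrow> nat set" where
  "block_times b = {b * block_length + 1..(b + 1) * block_length}"

lemma time_in_block:
  assumes "j < M" "r < K" "i < L"
  shows "time (b * M + j) r i \<in> block_times b"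
proof -
  have "j * K + r < M * K"
  proof -
    have "j * K + r < (j + 1) * K" using assms by simp
    also have "\<dots> \<le> M * K" using assms by (intro mult_right_mono) auto
    finally show ?thesis .
  qed
  then have "(j * K + r) * L + i < M * K * L"
  proof -
    have "(j * K + r) * L + i < (j * K + r + 1) * L" using assms by simp
    also have "\<dots> \<le> M * K * L" using \<open>j * K + r < M * K\<close> by (intro mult_right_mono) auto
    finally show ?thesis .
  qed
  moreover have "time (b * M + j) r i = b * block_length + ((j * K + r) * L + i) + 1"
    by (simp add: time_def algebra_simps)
  ultimately show ?thesis by (simp add: block_times_def)
qed

lemma disjoint_block_times: "disjoint_family_on block_times S"
proof (unfold disjoint_family_on_def, intro ballI impI)
  fix a b :: nat assume "a \<noteq> b"
  have "block_times a \<inter> block_times b = {}" if "a < b" for a b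
  proof -
    have "(a + 1) * block_length \<le> b * block_length"
      using that by (intro mult_right_mono) auto
    then show ?thesis by (auto simp: block_times_def)
  qed
  with \<open>a \<noteq> b\<close> show "block_times a \<inter> block_times b = {}"
    by (metis Int_commute linorder_neqE_nat)
qed

lemma slot_stat_output_cong:
  assumes "j < M" and "\<And>k. k \<in> block_times b \<Longrightarrow> u k = u' k"
  shows "slot_stat (b * M + j) (received B c u) = slot_stat (b * M + j) (received B c u')"
  unfolding slot_stat_def received_eq using assms time_in_block[OF \<open>j < M\<close>] L0_less
  by (intro sum.cong) (auto intro!: arg_cong[where f="stat _"])

lemma slot_stat_output_measurable:
  assumes "j < M"
  shows "(\<lambda>u. slot_stat (b * M + j) (received B c u)) \<in> borel_measurable (PiM (block_times b) (\<lambda>_. borel))"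
proof -
  have "(\<lambda>u. stat i (received B c u (time (b * M + j) r i))) \<in> borel_measurable (PiM (block_times b) (\<lambda>_. borel))"
    if "r < K" "i \<le> L0" for r i
  proof -
    have [measurable]: "(\<lambda>u. u (time (b * M + j) r i)) \<in> borel_measurable (PiM (block_times b) (\<lambda>_. borel))"
      using that assms L0_less by (intro measurable_component_singleton time_in_block) auto
    show ?thesis unfolding stat_def received_eq by measurable
  qed
  then show ?thesis unfolding slot_stat_def by (intro borel_measurable_sum) auto
qed

text \<open>The channel remembers inputs but not noise. Once the codeword is fixed, the heat is
  deterministic, and the majorant of a block is a function of the noise within that block
  alone.\<close>

lemma indep_failure_bound:
  assumes c: "\<And>b. b < B \<Longrightarrow> c b < M"
  shows "indep_vars (\<lambda>_. borel) (\<lambda>b w. failure_bound B c b (\<lambda>t. U t w)) {..<B}"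
proof -
  have "indep_vars (\<lambda>b. PiM (block_times b) (\<lambda>_. borel)) (\<lambda>b w. restrict (\<lambda>k. U k w) (block_times b)) {..<B}"
    by (intro indep_vars_restrict[OF indep_U] disjoint_block_times) (auto simp: block_times_def)
  then have "indep_vars (\<lambda>_. borel) (\<lambda>b w. failure_bound B c b (restrict (\<lambda>k. U k w) (block_times b))) {..<B}"
  proof (rule indep_vars_compose2)
    fix b assume "b \<in> {..<B}"
    then have [measurable]: "(\<lambda>u. slot_stat (b * M + c b) (received B c u)) \<in> borel_measurable (PiM (block_times b) (\<lambda>_. borel))"
      using c by (intro slot_stat_output_measurable) auto
    have "(\<lambda>u. ennreal (exp (slot_stat (b * M + j) (received B c u) - threshold))) \<in> borel_measurable (PiM (block_times b) (\<lambda>_. borel))"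
      if "j \<in> {..<M} - {c b}" for j
    proof -
      have [measurable]: "(\<lambda>u. slot_stat (b * M + j) (received B c u)) \<in> borel_measurable (PiM (block_times b) (\<lambda>_. borel))"
        using that by (intro slot_stat_output_measurable) auto
      show ?thesis by measurable
    qed
    note terms = this
    show "failure_bound B c b \<in> borel_measurable (PiM (block_times b) (\<lambda>_. borel))"
      unfolding failure_bound_def
    proof (rule borel_measurable_add)
      show "(\<lambda>u. \<Sum>j\<in>{..<M} - {c b}. ennreal (exp (slot_stat (b * M + j) (received B c u) - threshold)))
          \<in> borel_measurable (PiM (block_times b) (\<lambda>_. borel))"
        by (intro borel_measurable_sum terms)
    qed measurable
  qed
  moreover have "failure_bound B c b (restrict (\<lambda>k. U k w) (block_times b)) = failure_bound B c b (\<lambda>t. U t w)" if "b < B" for b w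
  proof -
    have "slot_stat (b * M + j) (received B c (restrict (\<lambda>k. U k w) (block_times b)))
        = slot_stat (b * M + j) (received B c (\<lambda>t. U t w))" if "j < M" for j
      using that by (intro slot_stat_output_cong) auto
    then show ?thesis
      unfolding failure_bound_def using c[OF \<open>b < B\<close>] by (auto intro!: sum.cong)
  qed
  ultimately show ?thesis
    by (subst (asm) indep_vars_cong[OF refl _ refl]) auto
qed

lemma slot_stat_noise_measurable:
  "(\<lambda>w. slot_stat s (received B c (\<lambda>t. U t w))) \<in> borel_measurable N"
proof -
  have "(\<lambda>w. stat i (received B c (\<lambda>t. U t w) (time s r i))) \<in> borel_measurable N" for r i
    using measurable_U[OF time_ge_1[of s r i]] unfolding stat_def received_eq by measurable
  then show ?thesis unfolding slot_stat_def by (intro borel_measurable_sum) auto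
qed

lemma expected_failure_bound:
  assumes "b < B" "c b < M"
  shows "(\<integral>\<^sup>+ w. failure_bound B c b (\<lambda>t. U t w) \<partial>N) \<le> ennreal block_error"
proof -
  let ?S = "\<lambda>j w. slot_stat (b * M + j) (received B c (\<lambda>t. U t w))"
  \<comment> \<open>Minimiser of \<open>- z + z\<^sup>2 * spread\<close>, the exponent per window
    left after the threshold is subtracted; the minimum is
    \<open>- 1 / (4 * spread)\<close>.\<close>
  let ?z = "1 / (2 * spread)"
  note [measurable] = slot_stat_noise_measurable
  have bM: "b * M + j < B * M" if "j < M" for j
  proof -
    have "b * M + j < (b + 1) * M" using that by simp
    also have "\<dots> \<le> B * M" using \<open>b < B\<close> by (intro mult_right_mono) auto
    finally show ?thesis .
  qed
  have act: "active B c (b * M + c b)"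
    using assms bM by (simp add: active_def)
  have inact: "\<not> active B c (b * M + j)" if "j < M" "j \<noteq> c b" for j
    using that by (simp add: active_def)
  have true: "(\<integral>\<^sup>+ w. ennreal (exp (?z * (threshold - ?S (c b) w))) \<partial>N) \<le> ennreal (exp (- real K / (4 * spread)))"
  proof -
    have "(\<integral>\<^sup>+ w. ennreal (exp (?z * (threshold - ?S (c b) w))) \<partial>N)
        = (\<integral>\<^sup>+ w. ennreal (exp (?z * threshold)) * ennreal (exp (- ?z * ?S (c b) w)) \<partial>N)"
      by (intro nn_integral_cong) (simp add: ennreal_mult'[symmetric] mult_exp_exp algebra_simps diff_divide_distrib)
    also have "\<dots> = ennreal (exp (?z * threshold)) * (\<integral>\<^sup>+ w. ennreal (exp (- ?z * ?S (c b) w)) \<partial>N)"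
      by (intro nn_integral_cmult) measurable
    also have "\<dots> \<le> ennreal (exp (?z * threshold)) * ennreal (exp (real K * (- ?z * mean + ?z\<^sup>2 * spread)))"
      using spread_pos by (intro mult_left_mono mgf_active act) auto
    also have "\<dots> = ennreal (exp (?z * threshold + real K * (- ?z * mean + ?z\<^sup>2 * spread)))"
      by (simp only: ennreal_mult'[symmetric] mult_exp_exp exp_ge_zero)
    also have "?z * threshold + real K * (- ?z * mean + ?z\<^sup>2 * spread) = - real K / (4 * spread)"
      using spread_pos by (simp add: threshold_def power2_eq_square field_simps)
    finally show ?thesis .
  qed
  have false: "(\<integral>\<^sup>+ w. ennreal (exp (?S j w - threshold)) \<partial>N) \<le> ennreal (exp (- real K * (mean - drift - 1)))"
    if "j < M" "j \<noteq> c b" for j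
  proof -
    have "(\<integral>\<^sup>+ w. ennreal (exp (?S j w - threshold)) \<partial>N)
        = (\<integral>\<^sup>+ w. ennreal (exp (- threshold)) * ennreal (exp (?S j w)) \<partial>N)"
      by (intro nn_integral_cong) (simp add: ennreal_mult'[symmetric] mult_exp_exp)
    also have "\<dots> = ennreal (exp (- threshold)) * (\<integral>\<^sup>+ w. ennreal (exp (?S j w)) \<partial>N)"
      by (intro nn_integral_cmult) measurable
    also have "\<dots> \<le> ennreal (exp (- threshold)) * ennreal (exp (real K * drift))"
      by (intro mult_left_mono mgf_inactive inact that) auto
    also have "\<dots> = ennreal (exp (- threshold + real K * drift))"
      by (simp only: ennreal_mult'[symmetric] mult_exp_exp exp_ge_zero)
    also have "- threshold + real K * drift = - real K * (mean - drift - 1)"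
      by (simp add: threshold_def algebra_simps)
    finally show ?thesis .
  qed
  have "(\<integral>\<^sup>+ w. failure_bound B c b (\<lambda>t. U t w) \<partial>N)
      = (\<integral>\<^sup>+ w. ennreal (exp (?z * (threshold - ?S (c b) w))) \<partial>N)
        + (\<Sum>j\<in>{..<M} - {c b}. \<integral>\<^sup>+ w. ennreal (exp (?S j w - threshold)) \<partial>N)"
    unfolding failure_bound_def
    by (subst nn_integral_add, measurable) (subst nn_integral_sum, measurable)
  also have "\<dots> \<le> ennreal (exp (- real K / (4 * spread))) + (\<Sum>j\<in>{..<M} - {c b}. ennreal (exp (- real K * (mean - drift - 1))))"
    by (intro add_mono true sum_mono false) auto
  also have "\<dots> \<le> ennreal (exp (- real K / (4 * spread))) + (\<Sum>j\<in>{..<M}. ennreal (exp (- real K * (mean - drift - 1))))"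
    by (intro add_left_mono sum_mono2) auto
  also have "\<dots> = ennreal block_error"
    by (simp add: block_error_def ennreal_mult' ennreal_of_nat_eq_real_of_nat)
  finally show ?thesis .
qed

end

section \<open>Coding theorem for fixed pulses\<close>

context pulse_position
begin

text \<open>Each of the \<open>B\<close> blocks has one active slot with \<open>K\<close> pulses, so
  the nonzero inputs lie in the image of the pairs of a block and a window.\<close>

lemma codeword_power: "(\<Sum>k\<in>{1..n}. (codeword B c k)\<^sup>2) \<le> real (B * K) * \<xi>\<^sup>2"
proof -
  let ?S = "{k \<in> {1..n}. codeword B c k \<noteq> 0}"
  let ?T = "(\<lambda>(b, r). time (b * M + c b) r 0) ` ({..<B} \<times> {..<K})"
  have "?S \<subseteq> ?T"
  proof
    fix k assume "k \<in> ?S"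
    then have k: "k \<ge> 1" "L dvd k - 1" "active B c ((k - 1) div L div K)"
      by (auto simp: codeword_def split: if_splits)
    define g where "g = (k - 1) div L"
    define s where "s = g div K"
    define b where "b = s div M"
    have s: "s < B * M" "s mod M = c b"
      using k(3) by (auto simp: active_def g_def s_def b_def)
    have "b < B" using s(1) by (simp add: b_def less_mult_imp_div_less)
    have "s = b * M + c b" using s(2) by (metis b_def div_mult_mod_eq)
    moreover have "g = s * K + g mod K" by (simp add: s_def)
    moreover have "k = g * L + 1" using k(1,2) by (simp add: g_def)
    ultimately have "k = time (b * M + c b) (g mod K) 0" by (simp add: time_def)
    then show "k \<in> ?T"
      using \<open>b < B\<close> K_pos by (intro image_eqI[of _ _ "(b, g mod K)"]) auto
  qed
  then have "card ?S \<le> card ?T" by (intro card_mono) auto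
  also have "\<dots> \<le> B * K"
    using card_image_le[of "{..<B} \<times> {..<K}" "\<lambda>(b, r). time (b * M + c b) r 0"] by simp
  finally have "card ?S \<le> B * K" .
  have "(\<Sum>k\<in>{1..n}. (codeword B c k)\<^sup>2) = (\<Sum>k\<in>?S. (codeword B c k)\<^sup>2)"
    by (intro sum.mono_neutral_right) auto
  also have "\<dots> \<le> (\<Sum>k\<in>?S. \<xi>\<^sup>2)"
    by (intro sum_mono) (auto simp: codeword_def)
  also have "\<dots> = real (card ?S) * \<xi>\<^sup>2" by simp
  also have "\<dots> \<le> real (B * K) * \<xi>\<^sup>2"
    using \<open>card ?S \<le> B * K\<close> by (intro mult_right_mono) (simp_all del: of_nat_mult)
  finally show ?thesis .
qed

text \<open>A block carries \<open>K\<close> pulses in \<open>M * K * L\<close> instants, so the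
  last assumption says that the share of \<open>M * L\<close> instants pays for one pulse. The
  constraint then holds for each codeword separately.\<close>

lemma power_constraint_codeword:
  assumes "m > 0" "n > 0" "B * block_length \<le> n" "\<xi>\<^sup>2 \<le> real (M * L) * P"
  shows "power_constraint N U n m (\<lambda>i u. codeword B (c i)) P"
proof -
  have "P \<ge> 0"
  proof (rule ccontr)
    assume "\<not> P \<ge> 0"
    then have "real (M * L) * P < 0"
      using M_pos L_pos by (intro mult_pos_neg) auto
    with assms(4) show False by (meson less_le_trans not_less zero_le_power2)
  qed
  have "(\<Sum>i<m. \<Sum>k\<in>{1..n}. (codeword B (c i) k)\<^sup>2) \<le> real m * (real n * P)"
  proof -
    have "(\<Sum>i<m. \<Sum>k\<in>{1..n}. (codeword B (c i) k)\<^sup>2) \<le> (\<Sum>i<m. real n * P)"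
    proof (rule sum_mono)
      fix i
      have "(\<Sum>k\<in>{1..n}. (codeword B (c i) k)\<^sup>2) \<le> real (B * K) * \<xi>\<^sup>2" by (rule codeword_power)
      also have "\<dots> \<le> real (B * K) * (real (M * L) * P)"
        using assms by (intro mult_left_mono) auto
      also have "\<dots> = real (B * block_length) * P" by simp
      also have "\<dots> \<le> real n * P"
        using assms(3) \<open>P \<ge> 0\<close> by (intro mult_right_mono of_nat_mono)
      finally show "(\<Sum>k\<in>{1..n}. (codeword B (c i) k)\<^sup>2) \<le> real n * P" .
    qed
    then show ?thesis by simp
  qed
  then have le: "(\<Sum>k\<in>{1..n}. (\<Sum>i<m. (codeword B (c i) k)\<^sup>2) / real m) / real n \<le> P"
    using assms by (subst (asm) sum.swap) (simp add: sum_divide_distrib[symmetric] field_simps)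
  have "(\<Sum>k=1..n. \<integral>\<^sup>+ (i, w). ennreal ((codeword B (c i) k)\<^sup>2) \<partial>message_noise_space m N) / of_nat n
      = (\<Sum>k=1..n. (\<Sum>i<m. ennreal ((codeword B (c i) k)\<^sup>2)) / of_nat m) / of_nat n"
    using \<open>m > 0\<close> by (subst nn_integral_message_noise_space[OF prob_space_axioms]) (auto simp: emeasure_space_1)
  also have "\<dots> = (\<Sum>k=1..n. ennreal ((\<Sum>i<m. (codeword B (c i) k)\<^sup>2) / real m)) / of_nat n"
    using \<open>m > 0\<close>
    by (intro arg_cong2[where f="(/)"] sum.cong refl)
       (simp add: sum_nonneg ennreal_of_nat_eq_real_of_nat divide_ennreal)
  also have "\<dots> = ennreal ((\<Sum>k\<in>{1..n}. (\<Sum>i<m. (codeword B (c i) k)\<^sup>2) / real m) / real n)"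
    using \<open>n > 0\<close> by (subst sum_ennreal) (auto simp: sum_nonneg ennreal_of_nat_eq_real_of_nat divide_ennreal)
  also have "\<dots> \<le> ennreal P"
    by (rule ennreal_leI[OF le])
  finally show ?thesis by (simp add: power_constraint_def)
qed

section \<open>Detection from finitely many outputs, and its measurability\<close>

lemma time_in_range:
  assumes "B * block_length \<le> n" "b < B" "j < M" "r < K" "i \<le> L0"
  shows "time (b * M + j) r i \<in> {1..n}"
proof -
  have "(b + 1) * block_length \<le> B * block_length"
    using \<open>b < B\<close> by (intro mult_right_mono) auto
  with time_in_block[of j r i b] assms L0_less show ?thesis
    by (auto simp: block_times_def)
qed

lemma slot_stat_restrict:
  assumes "B * block_length \<le> n" "b < B" "j < M"
  shows "slot_stat (b * M + j) (restrict y {1..n}) = slot_stat (b * M + j) y"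
  unfolding slot_stat_def using time_in_range[OF assms] by (intro sum.cong) (auto simp del: One_nat_def)

lemma detected_restrict:
  assumes "B * block_length \<le> n" "b < B" "j < M"
  shows "detected b j (restrict y {1..n}) \<longleftrightarrow> detected b j y"
  unfolding detected_def using slot_stat_restrict[OF assms(1,2)] \<open>j < M\<close> by simp

lemma slot_stat_measurable:
  assumes "B * block_length \<le> n" "b < B" "j < M"
  shows "slot_stat (b * M + j) \<in> borel_measurable (PiM {1..n} (\<lambda>_. borel))"
proof -
  have "(\<lambda>y. stat i (y (time (b * M + j) r i))) \<in> borel_measurable (PiM {1..n} (\<lambda>_. borel))"
    if "r < K" "i \<le> L0" for r i
  proof -
    have [measurable]: "(\<lambda>y. y (time (b * M + j) r i)) \<in> borel_measurable (PiM {1..n} (\<lambda>_. borel))"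
      by (intro measurable_component_singleton time_in_range[OF assms] that)
    show ?thesis unfolding stat_def by measurable
  qed
  then show ?thesis unfolding slot_stat_def[abs_def] by (intro borel_measurable_sum) auto
qed

lemma pred_detected:
  assumes "\<And>j. j < M \<Longrightarrow> slot_stat (b * M + j) \<in> borel_measurable Q" "j < M"
  shows "Measurable.pred Q (detected b j)"
proof -
  have 1: "Measurable.pred Q (\<lambda>y. slot_stat (b * M + j) y > threshold)"
    using assms by (intro borel_measurable_pred_less) auto
  have 2: "Measurable.pred Q (\<lambda>y. slot_stat (b * M + j') y \<le> threshold)" if "j' < M" for j'
    using assms(1)[OF that] by measurable
  have "Measurable.pred Q (\<lambda>y. \<forall>j'\<in>{j'\<in>{..<M}. j' \<noteq> j}. slot_stat (b * M + j') y \<le> threshold)"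
    using 2 by (intro pred_intros_finite) auto
  then have "Measurable.pred Q (\<lambda>y. slot_stat (b * M + j) y > threshold \<and> (\<forall>j'\<in>{j'\<in>{..<M}. j' \<noteq> j}. slot_stat (b * M + j') y \<le> threshold))"
    by (intro pred_intros_logic 1)
  then show ?thesis
    unfolding detected_def by (rule measurable_cong[THEN iffD1, rotated]) auto
qed

lemma pred_few_failures:
  assumes "\<And>b. b < B \<Longrightarrow> Measurable.pred Q (\<lambda>y. detected b (c b) (h y))"
  shows "Measurable.pred Q (\<lambda>y. card {b \<in> {..<B}. \<not> detected b (c b) (h y)} \<le> t)"
proof -
  \<comment> \<open>Counting failures as a sum of real indicators reduces measurability to the
    single predicates \<open>detected b (c b)\<close>.\<close>
  have *: "card {b \<in> {..<B}. \<not> P b} \<le> t \<longleftrightarrow> (\<Sum>b<B. if P b then 0 else 1 :: real) \<le> real t" for P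
  proof -
    have "(\<Sum>b<B. if P b then 0 else 1 :: real) = (\<Sum>b\<in>{b \<in> {..<B}. \<not> P b}. 1)"
      by (subst sum.inter_filter) (auto intro!: sum.cong)
    then show ?thesis by simp
  qed
  have "(\<lambda>y. if detected b (c b) (h y) then 0 else 1 :: real) \<in> borel_measurable Q" if "b < B" for b
    using assms[OF that] by measurable
  then have [measurable]: "(\<lambda>y. \<Sum>b<B. if detected b (c b) (h y) then 0 else 1 :: real) \<in> borel_measurable Q"
    by (intro borel_measurable_sum) auto
  show ?thesis unfolding * by measurable
qed

text \<open>An outer code of minimum distance above \<open>2 * t\<close> corrects \<open>t\<close>
  failed blocks, with \<open>t\<close> about \<open>\<rho> * B\<close>. Distance costs the fraction
  \<open>2 * \<rho>\<close> of the rate, and more than \<open>t\<close> failures have probability at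
  most \<open>(1 + block_error) ^ B / 2 ^ Suc t\<close>.\<close>

lemma exists_code:
  assumes "n > 0" "B * block_length \<le> n" "\<xi>\<^sup>2 \<le> real (M * L) * P" "\<rho> \<ge> 0"
  shows "\<exists>m c \<psi>. m > 0 \<and> decoder n m \<psi> \<and> power_constraint N U n m (\<lambda>i u. codeword B (c i)) P \<and>
    real B * ((1 - 2 * \<rho>) * ln (real M) - ln 2) \<le> ln (real m) \<and>
    error_prob N U s2 \<alpha> n m (\<lambda>i u. codeword B (c i)) \<psi> \<le> ((1 + block_error) / 2 powr \<rho>) ^ B"
proof -
  \<comment> \<open>Rounding down serves both sides: \<open>t \<le> \<rho> * B\<close> for the rate,
    and \<open>Suc t \<ge> \<rho> * B\<close> for the error exponent.\<close>
  define t where "t = nat \<lfloor>\<rho> * real B\<rfloor>"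
  have t: "real t \<le> \<rho> * real B" "\<rho> * real B \<le> real (Suc t)"
    using \<open>\<rho> \<ge> 0\<close> by (auto simp: t_def) linarith
  obtain C where "C \<subseteq> {..<B} \<rightarrow>\<^sub>E {..<M} \<and>
      (\<forall>c\<in>C. \<forall>c'\<in>C. c \<noteq> c' \<longrightarrow> card {b \<in> {..<B}. c b \<noteq> c' b} > 2 * t) \<and>
      M ^ B \<le> card C * (2 ^ B * M ^ (2 * t))"
    using gilbert_varshamov[OF M_pos, of B "2 * t"] by (rule exE)
  then have C: "C \<subseteq> {..<B} \<rightarrow>\<^sub>E {..<M}"
    and dist: "\<And>c c'. c \<in> C \<Longrightarrow> c' \<in> C \<Longrightarrow> c \<noteq> c' \<Longrightarrow> card {b \<in> {..<B}. c b \<noteq> c' b} > 2 * t"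
    and size: "M ^ B \<le> card C * (2 ^ B * M ^ (2 * t))"
    by simp_all
  have "finite C" using C by (rule finite_subset) (intro finite_PiE, auto)
  define m where "m = card C"
  obtain c where bij: "bij_betw c {0..<m} C"
    using ex_bij_betw_nat_finite[OF \<open>finite C\<close>] unfolding m_def by blast
  have c_in: "c i \<in> C" if "i < m" for i
    using bij that by (auto simp: bij_betw_def)
  have c_less: "c i b < M" if "i < m" "b < B" for i b
    using c_in[OF that(1)] C that(2) by (auto simp: PiE_def Pi_def)
  have "m > 0"
    using size M_pos by (cases m) (auto simp: m_def)

  have rate: "real B * ((1 - 2 * \<rho>) * ln (real M) - ln 2) \<le> ln (real m)"
  proof -
    have "real (M ^ B) \<le> real (m * (2 ^ B * M ^ (2 * t)))"
      using size unfolding m_def by (rule of_nat_mono)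
    then have "ln (real M ^ B) \<le> ln (real m * (2 ^ B * real M ^ (2 * t)))"
      using M_pos by (intro ln_mono) auto
    also have "\<dots> = ln (real m) + (real B * ln 2 + real (2 * t) * ln (real M))"
      using M_pos \<open>m > 0\<close> by (simp add: ln_mult ln_realpow)
    finally have "real B * ln (real M) \<le> ln (real m) + (real B * ln 2 + real (2 * t) * ln (real M))"
      using M_pos by (simp add: ln_realpow)
    moreover have "real (2 * t) * ln (real M) \<le> 2 * \<rho> * real B * ln (real M)"
      using t M_pos by (intro mult_right_mono) auto
    ultimately show ?thesis by (simp add: algebra_simps)
  qed

  define ok where "ok i y \<longleftrightarrow> card {b \<in> {..<B}. \<not> detected b (c i b) y} \<le> t" for i y
  \<comment> \<open>\<open>LEAST\<close> is a measurable selection, unique by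
    \<open>ok_unique\<close>; the default 0 is a legal message because \<open>m > 0\<close>.\<close>
  define \<psi> where "\<psi> y = (if \<exists>i<m. ok i y then LEAST i. i < m \<and> ok i y else 0)" for y
  have ok_unique: "i = i'" if "i < m" "i' < m" "ok i y" "ok i' y" for i i' y
  proof (rule ccontr)
    assume "i \<noteq> i'"
    then have "c i \<noteq> c i'"
      using bij that(1,2) by (auto simp: bij_betw_def inj_on_def)
    \<comment> \<open>Where two codewords differ, their letters cannot both be detected, so every
      such block fails for at least one of them.\<close>
    have "{b \<in> {..<B}. c i b \<noteq> c i' b}
        \<subseteq> {b \<in> {..<B}. \<not> detected b (c i b) y} \<union> {b \<in> {..<B}. \<not> detected b (c i' b) y}"
      using c_less that(1,2) unfolding detected_def by force
    then have "card {b \<in> {..<B}. c i b \<noteq> c i' b}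
        \<le> card ({b \<in> {..<B}. \<not> detected b (c i b) y} \<union> {b \<in> {..<B}. \<not> detected b (c i' b) y})"
      by (intro card_mono) auto
    also have "\<dots> \<le> 2 * t"
      using card_Un_le[of "{b \<in> {..<B}. \<not> detected b (c i b) y}" "{b \<in> {..<B}. \<not> detected b (c i' b) y}"] that(3,4)
      unfolding ok_def by linarith
    finally show False
      using dist[OF c_in[OF that(1)] c_in[OF that(2)] \<open>c i \<noteq> c i'\<close>] by simp
  qed
  have \<psi>_eq: "\<psi> y = i" if "i < m" "ok i y" for i y
  proof -
    have "(LEAST i. i < m \<and> ok i y) = i"
    proof (rule Least_equality)
      show "i \<le> i'" if "i' < m \<and> ok i' y" for i'
        using ok_unique[of i i' y] that \<open>i < m\<close> \<open>ok i y\<close> by simp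
    qed (use that in simp)
    then show ?thesis using that by (auto simp: \<psi>_def)
  qed
  have \<psi>_less: "\<psi> y < m" for y
  proof (cases "\<exists>i<m. ok i y")
    case True
    then obtain i where "i < m" "ok i y" by blast
    then show ?thesis using \<psi>_eq by simp
  next
    case False
    show ?thesis unfolding \<psi>_def if_not_P[OF False] by (rule \<open>m > 0\<close>)
  qed

  have dec: "decoder n m \<psi>"
  proof -
    let ?Q = "PiM {1..n} (\<lambda>_. borel :: real measure)"
    have ok_meas: "Measurable.pred ?Q (\<lambda>y. i < m \<and> ok i y)" for i
    proof (cases "i < m")
      case True
      have "Measurable.pred ?Q (\<lambda>y. ok i y)"
        unfolding ok_def using True assms
        by (intro pred_few_failures pred_detected slot_stat_measurable c_less) auto
      with True show ?thesis by simp
    qed simp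
    have \<psi>_meas: "\<psi> \<in> measurable ?Q (count_space UNIV)"
      unfolding \<psi>_def[abs_def]
    proof (rule measurable_If)
      show "(\<lambda>y. LEAST i. i < m \<and> ok i y) \<in> measurable ?Q (count_space UNIV)"
        by (rule measurable_Least) (rule ok_meas)
      show "{y \<in> space ?Q. \<exists>i<m. ok i y} \<in> sets ?Q"
        by (rule predE, rule pred_intros_countable(2), rule ok_meas)
    qed simp
    show ?thesis
      unfolding decoder_def
    proof (rule measurableI)
      show "\<psi> y \<in> space (count_space {..<m})" for y
        by (simp add: \<psi>_less)
      show "\<psi> -` A \<inter> space ?Q \<in> sets ?Q" for A
        by (rule measurable_sets[OF \<psi>_meas]) simp
    qed
  qed

  have err: "prob {w \<in> space N. \<psi> (\<lambda>k\<in>{1..n}. channel_output s2 \<alpha> (\<lambda>t. U t w) (codeword B (c i)) k) \<noteq> i}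
      \<le> ((1 + block_error) / 2 powr \<rho>) ^ B"
    and ev: "{w \<in> space N. \<psi> (\<lambda>k\<in>{1..n}. channel_output s2 \<alpha> (\<lambda>t. U t w) (codeword B (c i)) k) \<noteq> i} \<in> events"
    if i: "i < m" for i
  proof -
    let ?y = "\<lambda>w. received B (c i) (\<lambda>t. U t w)"
    let ?E = "{w \<in> space N. card {b \<in> {..<B}. \<not> detected b (c i b) (?y w)} > t}"
    let ?F = "{w \<in> space N. \<psi> (\<lambda>k\<in>{1..n}. channel_output s2 \<alpha> (\<lambda>t. U t w) (codeword B (c i)) k) \<noteq> i}"
    have detected_meas: "Measurable.pred N (\<lambda>w. detected b (c i b) (?y w))" if "b < B" for b
    proof -
      note [measurable] = slot_stat_noise_measurable
      have "Measurable.pred N (\<lambda>w. \<forall>j'\<in>{j'\<in>{..<M}. j' \<noteq> c i b}. slot_stat (b * M + j') (?y w) \<le> threshold)"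
        by (intro pred_intros_finite) auto
      then have "Measurable.pred N (\<lambda>w. slot_stat (b * M + c i b) (?y w) > threshold \<and>
          (\<forall>j'\<in>{j'\<in>{..<M}. j' \<noteq> c i b}. slot_stat (b * M + j') (?y w) \<le> threshold))"
        by (intro pred_intros_logic) auto
      then show ?thesis
        unfolding detected_def by (rule measurable_cong[THEN iffD1, rotated]) auto
    qed
    have "Measurable.pred N (\<lambda>w. card {b \<in> {..<B}. \<not> detected b (c i b) (?y w)} \<le> t)"
      by (intro pred_few_failures detected_meas)
    then have E: "?E \<in> events"
      unfolding not_le[symmetric] by measurable
    have vec: "(\<lambda>w. \<lambda>k\<in>{1..n}. ?y w k) \<in> measurable N (PiM {1..n} (\<lambda>_. borel))"
    proof (intro measurable_restrict)
      fix k assume "k \<in> {1..n}"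
      then have [measurable]: "U k \<in> borel_measurable N" by (intro measurable_U) auto
      show "(\<lambda>w. ?y w k) \<in> borel_measurable N" unfolding received_eq by measurable
    qed
    have "(\<lambda>w. \<psi> (\<lambda>k\<in>{1..n}. ?y w k)) \<in> measurable N (count_space {..<m})"
      by (rule measurable_compose[OF vec]) (use dec in \<open>simp add: decoder_def\<close>)
    from measurable_sets[OF this, of "{..<m} - {i}"]
    show F: "?F \<in> events"
      using \<psi>_less unfolding received_def by (simp add: vimage_def Int_def conj_commute)
    have "?F \<subseteq> ?E"
    proof
      fix w assume w: "w \<in> ?F"
      have "\<not> ok i (\<lambda>k\<in>{1..n}. ?y w k)"
        using w \<psi>_eq[OF i] unfolding received_def by auto
      moreover have "{b \<in> {..<B}. \<not> detected b (c i b) (\<lambda>k\<in>{1..n}. ?y w k)} = {b \<in> {..<B}. \<not> detected b (c i b) (?y w)}"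
        using detected_restrict[OF assms(2)] c_less[OF i] by auto
      ultimately show "w \<in> ?E" using w by (simp add: ok_def)
    qed
    then have "prob ?F \<le> prob ?E" using E by (rule finite_measure_mono)
    also have "\<dots> \<le> (1 + block_error) ^ B / 2 ^ Suc t"
    proof (rule prob_many_failures_le[where F="\<lambda>b w. failure_bound B (c i) b (\<lambda>t. U t w)"])
      show "(\<integral>\<^sup>+ w. failure_bound B (c i) b (\<lambda>t. U t w) \<partial>N) \<le> ennreal block_error" if "b < B" for b
        using that c_less[OF i] by (intro expected_failure_bound) auto
      show "block_error \<ge> 0" by (simp add: block_error_def)
      show "indep_vars (\<lambda>_. borel) (\<lambda>b w. failure_bound B (c i) b (\<lambda>t. U t w)) {..<B}"
        by (rule indep_failure_bound) (rule c_less[OF i])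
      show "1 \<le> failure_bound B (c i) b (\<lambda>t. U t w)" if "\<not> detected b (c i b) (?y w)" for b w
        by (rule failure_bound_ge_1[OF that])
    qed (rule E)
    also have "\<dots> \<le> (1 + block_error) ^ B / (2 powr \<rho>) ^ B"
    proof (intro divide_left_mono)
      have "(2 powr \<rho>) ^ B = 2 powr (\<rho> * real B)"
        by (simp add: powr_realpow[symmetric] powr_powr)
      also have "\<dots> \<le> 2 powr real (Suc t)"
        using t(2) by (intro powr_mono) auto
      also have "\<dots> = 2 ^ Suc t"
        by (rule powr_realpow) simp
      finally show "(2 powr \<rho>) ^ B \<le> (2::real) ^ Suc t" .
    qed (auto simp: block_error_def)
    also have "\<dots> = ((1 + block_error) / 2 powr \<rho>) ^ B"
      by (simp add: power_divide)
    finally show "prob ?F \<le> ((1 + block_error) / 2 powr \<rho>) ^ B" .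
  qed
  have "error_prob N U s2 \<alpha> n m (\<lambda>i u. codeword B (c i)) \<psi> \<le> ((1 + block_error) / 2 powr \<rho>) ^ B"
  proof -
    let ?p = "\<lambda>i. prob {w \<in> space N. \<psi> (\<lambda>k\<in>{1..n}. channel_output s2 \<alpha> (\<lambda>t. U t w) (codeword B (c i)) k) \<noteq> i}"
    have "error_prob N U s2 \<alpha> n m (\<lambda>i u. codeword B (c i)) \<psi> = (\<Sum>i<m. ?p i) / real m"
      unfolding error_prob_def by (rule measure_message_noise_space[OF prob_space_axioms \<open>m > 0\<close> ev])
    also have "\<dots> \<le> (\<Sum>i<m. ((1 + block_error) / 2 powr \<rho>) ^ B) / real m"
      by (intro divide_right_mono sum_mono err) auto
    also have "\<dots> = ((1 + block_error) / 2 powr \<rho>) ^ B"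
      using \<open>m > 0\<close> by simp
    finally show ?thesis .
  qed
  moreover have "power_constraint N U n m (\<lambda>i u. codeword B (c i)) P"
    by (rule power_constraint_codeword) (use assms \<open>m > 0\<close> in auto)
  ultimately show ?thesis
    using \<open>m > 0\<close> dec rate by (intro exI[of _ m] exI[of _ c] exI[of _ \<psi>]) simp
qed

section \<open>From codes of given length to an achievable rate\<close>

lemma real_div_over_tendsto:
  fixes b :: nat
  assumes "b > 0"
  shows "(\<lambda>n. real (n div b) / real n) \<longlonglongrightarrow> 1 / real b"
proof (rule tendsto_sandwich[of "\<lambda>n. 1 / real b - 1 / real n" _ _ "\<lambda>n. 1 / real b"])
  show "\<forall>\<^sub>F n in sequentially. 1 / real b - 1 / real n \<le> real (n div b) / real n"
    using eventually_gt_at_top[of 0]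
  proof eventually_elim
    case (elim n)
    have "real n < (real (n div b) + 1) * real b"
      using assms by (metis Suc_eq_plus1 dividend_less_times_div mult.commute mult_Suc_right of_nat_1 of_nat_add of_nat_less_iff of_nat_mult)
    then have "real n / real b < real (n div b) + 1"
      using assms by (subst pos_divide_less_eq) auto
    then have "real n / real b - 1 \<le> real (n div b)" by linarith
    then have "(real n / real b - 1) / real n \<le> real (n div b) / real n"
      by (rule divide_right_mono) simp
    with elim show ?case by (simp add: diff_divide_distrib)
  qed
  show "\<forall>\<^sub>F n in sequentially. real (n div b) / real n \<le> 1 / real b"
    using eventually_gt_at_top[of 0]
  proof eventually_elim
    case (elim n)
    have "real (n div b) * real b \<le> real n"
      by (metis div_times_less_eq_dividend of_nat_le_iff of_nat_mult)
    with assms elim show ?case by (simp add: field_simps)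
  qed
  show "(\<lambda>n. 1 / real b - 1 / real n) \<longlonglongrightarrow> 1 / real b"
    using tendsto_diff[OF tendsto_const lim_1_over_n, of "1 / real b"] by simp
qed simp

lemma filterlim_div_nat: "b > 0 \<Longrightarrow> filterlim (\<lambda>n::nat. n div b) at_top at_top"
  unfolding filterlim_at_top eventually_sequentially
  by (metis div_le_mono nonzero_mult_div_cancel_right less_not_refl2 mult.commute)

text \<open>Block-length \<open>n\<close> holds \<open>n div block_length\<close> blocks, and the
  remaining instants stay silent. The error bound is geometric in the number of blocks, while the
  rate loses nothing in the limit.\<close>

lemma achievable_pulse_position:
  assumes P: "\<xi>\<^sup>2 \<le> real (M * L) * P" and "\<rho> \<ge> 0" and \<rho>: "block_error < \<rho> * ln 2"
  shows "achievable N U s2 \<alpha> P (((1 - 2 * \<rho>) * ln (real M) - ln 2) / real block_length)"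
proof -
  let ?g = "(1 - 2 * \<rho>) * ln (real M) - ln 2"
  let ?q = "(1 + block_error) / 2 powr \<rho>"
  have Lb: "block_length > 0" using M_pos K_pos L_pos by simp
  have be: "block_error \<ge> 0" by (simp add: block_error_def)
  \<comment> \<open>The assumption on \<open>block_error\<close> is designed for the chain
    \<open>1 + block_error \<le> exp block_error < 2 powr \<rho>\<close>.\<close>
  have q: "0 \<le> ?q" "?q < 1"
  proof -
    have "1 + block_error \<le> exp block_error" by (rule exp_ge_add_one_self)
    also have "\<dots> < exp (\<rho> * ln 2)" using \<rho> by simp
    also have "\<dots> = 2 powr \<rho>" by (simp add: powr_def)
    finally show "?q < 1" by simp
  qed (use be in simp)
  have "\<forall>n. \<exists>m c \<psi>. n > 0 \<longrightarrow> m > 0 \<and> decoder n m \<psi> \<and>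
    power_constraint N U n m (\<lambda>i u. codeword (n div block_length) (c i)) P \<and>
    real (n div block_length) * ?g \<le> ln (real m) \<and>
    error_prob N U s2 \<alpha> n m (\<lambda>i u. codeword (n div block_length) (c i)) \<psi> \<le> ?q ^ (n div block_length)"
    using exists_code[OF _ _ P \<open>\<rho> \<ge> 0\<close>] by (meson div_times_less_eq_dividend)
  then obtain m c \<psi> where code: "\<And>n. n > 0 \<Longrightarrow> m n > 0 \<and> decoder n (m n) (\<psi> n) \<and>
    power_constraint N U n (m n) (\<lambda>i u. codeword (n div block_length) (c n i)) P \<and>
    real (n div block_length) * ?g \<le> ln (real (m n)) \<and>
    error_prob N U s2 \<alpha> n (m n) (\<lambda>i u. codeword (n div block_length) (c n i)) (\<psi> n) \<le> ?q ^ (n div block_length)"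
    by metis
  define \<phi> where "\<phi> n i = codeword (n div block_length) (c n i)" for n i
  show ?thesis
    unfolding achievable_def
  proof (intro exI[of _ m] exI[of _ \<phi>] exI[of _ \<psi>] conjI allI impI)
    fix n :: nat assume "n \<ge> 1"
    then show "m n > 0" "decoder n (m n) (\<psi> n)" "power_constraint N U n (m n) (\<lambda>i u. \<phi> n i) P"
      using code[of n] by (auto simp: \<phi>_def)
  next
    have "(\<lambda>n. ereal (real (n div block_length) / real n * ?g)) \<longlonglongrightarrow> ereal (1 / real block_length * ?g)"
      by (intro tendsto_ereal tendsto_mult tendsto_const real_div_over_tendsto Lb)
    then have "liminf (\<lambda>n. ereal (real (n div block_length) / real n * ?g)) = ereal (1 / real block_length * ?g)"
      by (intro lim_imp_Liminf) auto
    moreover have "liminf (\<lambda>n. ereal (real (n div block_length) / real n * ?g)) \<le> liminf (\<lambda>n. ereal (ln (real (m n)) / real n))"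
    proof (rule Liminf_mono)
      show "\<forall>\<^sub>F n in sequentially. ereal (real (n div block_length) / real n * ?g) \<le> ereal (ln (real (m n)) / real n)"
        using eventually_gt_at_top[of 0]
      proof eventually_elim
        case (elim n)
        then have "real (n div block_length) * ?g / real n \<le> ln (real (m n)) / real n"
          using code[of n] by (intro divide_right_mono) auto
        then show ?case by simp
      qed
    qed
    ultimately show "ereal (?g / real block_length) \<le> liminf (\<lambda>n. ereal (ln (real (m n)) / real n))"
      by simp
  next
    show "(\<lambda>n. error_prob N U s2 \<alpha> n (m n) (\<lambda>i u. \<phi> n i) (\<psi> n)) \<longlonglongrightarrow> 0"
    proof (rule tendsto_sandwich[of "\<lambda>_. 0" _ _ "\<lambda>n. ?q ^ (n div block_length)"])
      show "\<forall>\<^sub>F n in sequentially. 0 \<le> error_prob N U s2 \<alpha> n (m n) (\<lambda>i u. \<phi> n i) (\<psi> n)"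
        by (simp add: error_prob_def)
      show "\<forall>\<^sub>F n in sequentially. error_prob N U s2 \<alpha> n (m n) (\<lambda>i u. \<phi> n i) (\<psi> n) \<le> ?q ^ (n div block_length)"
        using eventually_gt_at_top[of 0] by eventually_elim (use code in \<open>auto simp: \<phi>_def\<close>)
      show "(\<lambda>n. ?q ^ (n div block_length)) \<longlonglongrightarrow> 0"
        using filterlim_compose[OF LIMSEQ_realpow_zero[OF q] filterlim_div_nat[OF Lb]] .
    qed simp
  qed
qed

end

section \<open>Low signal-to-noise ratio\<close>

text \<open>The divergence that a window contributes: the main term grows with
  \<open>\<xi>\<^sup>2\<close>, while the logarithmic loss (\<open>ln (1 - \<theta>)\<close> is
  negative) does not depend on \<open>\<xi>\<close>.\<close>

lemma (in pulse_position) mean_minus_drift: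
  "mean - drift = \<xi>\<^sup>2 / v0 * (1 / 2 * (1 + \<theta> * (\<Sum>l<L0. \<alpha> (Suc l)))) + real L0 * ln (1 - \<theta>) / 2"
proof -
  have "mean = \<xi>\<^sup>2 / v0 + (\<Sum>l<L0. \<theta> * (\<alpha> (Suc l) * \<xi>\<^sup>2 / v0) / 2)"
    unfolding mean_def by (subst sum.atMost_shift) simp
  also have "(\<Sum>l<L0. \<theta> * (\<alpha> (Suc l) * \<xi>\<^sup>2 / v0) / 2) = \<xi>\<^sup>2 / v0 * (1 / 2 * (\<theta> * (\<Sum>l<L0. \<alpha> (Suc l))))"
    by (simp add: sum_distrib_left mult_ac)
  finally have "mean = \<xi>\<^sup>2 / v0 + \<xi>\<^sup>2 / v0 * (1 / 2 * (\<theta> * (\<Sum>l<L0. \<alpha> (Suc l))))" .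
  moreover have "drift = \<xi>\<^sup>2 / v0 * (1 / 2) - real L0 * ln (1 - \<theta>) / 2"
    unfolding drift_def by (subst sum.atMost_shift) simp
  ultimately show ?thesis by (simp add: algebra_simps)
qed

text \<open>The order of choices matters: the tolerance \<open>\<zeta>\<close>, the observed tail
  \<open>L0\<close>, the pulse \<open>\<xi>\<close> strong enough for this tail, the spacing
  \<open>L\<close> large enough for this pulse; only then \<open>M\<close> from the SNR and
  \<open>K\<close> from \<open>M\<close>.\<close>

lemma (in gaussian_noise) achievable_low_snr:
  fixes s2 T :: real and \<alpha> :: "nat \<Rightarrow> real"
  assumes s2: "s2 > 0" and \<alpha>_nonneg: "\<And>l. l \<ge> 1 \<Longrightarrow> \<alpha> l \<ge> 0" and \<alpha>_summable: "summable (\<lambda>l. \<alpha> (Suc l))"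
    and T: "0 < T" "T < 1 / 2 * (1 + (\<Sum>l. \<alpha> (Suc l)))"
  shows "\<forall>\<^sub>F snr in at_right 0. \<exists>R \<ge> T * snr. achievable N U s2 \<alpha> (snr * s2) R"
proof -
  define A where "A = (\<Sum>l. \<alpha> (Suc l))"
  \<comment> \<open>The rate per unit cost left when every loss is \<open>\<zeta>\<close>:
    \<open>1 - 2 * \<zeta>\<close> for the outer code with \<open>\<rho> = \<zeta>\<close>, the
    factor \<open>1 - \<zeta>\<close> for heat (\<open>s2 / v0\<close>), the inner one for
    \<open>\<theta>\<close>, \<open>A - \<zeta>\<close> for the truncated tail, and the last
    \<open>\<zeta>\<close> for the terms not growing with the pulse.\<close>
  define f where "f \<zeta> = (1 - 2 * \<zeta>) * ((1 - \<zeta>) * (1 / 2 * (1 + (1 - \<zeta>) * (A - \<zeta>))) - \<zeta>)" for \<zeta> :: real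
  have "(f \<longlongrightarrow> f 0) (at_right 0)"
    unfolding f_def by (intro tendsto_intros)
  moreover have "T < f 0" using T by (simp add: f_def A_def)
  ultimately have "\<forall>\<^sub>F \<zeta> in at_right 0. T < f \<zeta>" by (rule order_tendstoD(1))
  moreover have "\<forall>\<^sub>F \<zeta> in at_right (0::real). \<zeta> \<in> {0<..<1/2}"
    by (rule eventually_at_right_real) simp
  ultimately have "\<forall>\<^sub>F \<zeta> in at_right 0. T < f \<zeta> \<and> \<zeta> \<in> {0<..<1/2}" by (rule eventually_conj)
  then obtain \<zeta> where f\<zeta>: "T < f \<zeta>" and \<zeta>: "0 < \<zeta>" "\<zeta> < 1 / 2"
    using eventually_happens' [of "at_right (0::real)"] by auto
  define \<theta> v0 where "\<theta> = 1 - \<zeta>" and "v0 = s2 / (1 - \<zeta>)"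
  have \<theta>: "0 < \<theta>" "\<theta> < 1" using \<zeta> by (auto simp: \<theta>_def)
  have v0: "v0 > 0" "s2 / v0 = 1 - \<zeta>" using s2 \<zeta> by (auto simp: v0_def)

  have A_lim: "(\<lambda>n. \<Sum>l<n. \<alpha> (Suc l)) \<longlonglongrightarrow> A"
    unfolding A_def by (rule summable_LIMSEQ[OF \<alpha>_summable])
  then have "\<forall>\<^sub>F n in sequentially. A - \<zeta> < (\<Sum>l<n. \<alpha> (Suc l))"
    by (rule order_tendstoD(1)) (use \<zeta> in simp)
  then obtain L0 where L0: "A - \<zeta> < (\<Sum>l<L0. \<alpha> (Suc l))"
    unfolding eventually_sequentially by auto

  \<comment> \<open>\<open>c\<close> collects the terms of \<open>s2 * D\<close> that do not grow
    with the pulse, using \<open>1 - \<theta> = \<zeta>\<close>; the pulse energy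
    \<open>c / \<zeta>\<close> makes them the fraction \<open>\<zeta>\<close> of it.\<close>
  define c where "c = s2 * (2 - real L0 * ln \<zeta> / 2)"
  have "ln \<zeta> < 0" using \<zeta> by simp
  then have "real L0 * ln \<zeta> \<le> 0" by (simp add: mult_nonneg_nonpos)
  then have c: "c > 0" unfolding c_def using s2 by (intro mult_pos_pos) auto
  define \<xi> where "\<xi> = sqrt (c / \<zeta>)"
  have \<xi>: "\<xi>\<^sup>2 = c / \<zeta>" "\<xi> \<noteq> 0" "\<xi>\<^sup>2 > 0" using c \<zeta> by (auto simp: \<xi>_def)
  \<comment> \<open>Of the 2 subtracted, one unit is the threshold margin. The other leaves the
    factor \<open>exp (- K)\<close> in the false alarm bound after \<open>exp (- K * D)\<close> has
    paid for the \<open>M\<close> slots.\<close>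
  define D where "D = \<xi>\<^sup>2 / v0 * (1 / 2 * (1 + \<theta> * (\<Sum>l<L0. \<alpha> (Suc l)))) + real L0 * ln (1 - \<theta>) / 2 - 2"
  have D_ge: "(1 - 2 * \<zeta>) * (s2 * D / \<xi>\<^sup>2) \<ge> f \<zeta>"
  proof -
    have "s2 * D / \<xi>\<^sup>2 = s2 / v0 * (1 / 2 * (1 + \<theta> * (\<Sum>l<L0. \<alpha> (Suc l)))) - c / \<xi>\<^sup>2"
      using \<xi>(3) unfolding D_def c_def \<theta>_def by (simp add: field_simps)
    also have "c / \<xi>\<^sup>2 = \<zeta>" using c \<zeta> by (simp add: \<xi>(1))
    also have "s2 / v0 * (1 / 2 * (1 + \<theta> * (\<Sum>l<L0. \<alpha> (Suc l)))) - \<zeta>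
        \<ge> (1 - \<zeta>) * (1 / 2 * (1 + (1 - \<zeta>) * (A - \<zeta>))) - \<zeta>"
      unfolding v0 \<theta>_def using \<zeta> L0 by (intro diff_right_mono mult_left_mono add_left_mono) auto
    finally show ?thesis
      unfolding f_def using \<zeta> by (intro mult_left_mono) auto
  qed
  have D_pos: "D > 0"
  proof -
    have "0 < (1 - 2 * \<zeta>) * (s2 * D / \<xi>\<^sup>2)" using D_ge f\<zeta> T(1) by linarith
    then show ?thesis using \<zeta> s2 \<xi>(3) by (simp add: zero_less_mult_iff zero_less_divide_iff)
  qed

  have "(\<lambda>n. s2 + \<xi>\<^sup>2 * (A - (\<Sum>l<n. \<alpha> (Suc l)))) \<longlonglongrightarrow> s2 + \<xi>\<^sup>2 * (A - A)"
    by (intro tendsto_intros A_lim)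
  moreover have "s2 + \<xi>\<^sup>2 * (A - A) < v0"
    using s2 \<zeta> by (simp add: v0_def field_simps)
  ultimately have "\<forall>\<^sub>F n in sequentially. s2 + \<xi>\<^sup>2 * (A - (\<Sum>l<n. \<alpha> (Suc l))) < v0"
    by (rule order_tendstoD(2))
  then obtain n0 where "\<And>n. n \<ge> n0 \<Longrightarrow> s2 + \<xi>\<^sup>2 * (A - (\<Sum>l<n. \<alpha> (Suc l))) < v0"
    unfolding eventually_sequentially by auto
  then have tail: "s2 + \<xi>\<^sup>2 * (A - (\<Sum>l<max n0 L0. \<alpha> (Suc l))) < v0" by simp
  \<comment> \<open>The successor matches the index shift: the tail of \<alpha> from
    \<open>L\<close> on is \<open>A\<close> minus the first \<open>L - 1\<close>
    coefficients.\<close>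
  define L where "L = Suc (max n0 L0)"
  have L: "L0 < L" "L > 0" by (auto simp: L_def)
  have heat: "s2 + \<xi>\<^sup>2 * (\<Sum>j. \<alpha> (j + L)) \<le> v0"
    using tail suminf_minus_initial_segment[OF \<alpha>_summable, of "max n0 L0"] by (simp add: A_def L_def)

  \<comment> \<open>This is the value of \<open>spread\<close>, written out before the locale is
    interpreted; it depends neither on \<open>K\<close> nor on \<open>M\<close>.\<close>
  define C where "C = (\<Sum>i\<le>L0. if i = 0 then \<xi>\<^sup>2 / (2 * v0) else \<theta>\<^sup>2 * (\<alpha> i * \<xi>\<^sup>2 / v0)\<^sup>2 / 2)"
  \<comment> \<open>The least number of pulses with \<open>M \<le> exp (K * D)\<close>.\<close>
  define K where "K M = nat \<lceil>ln (real M) / D\<rceil>" for M :: nat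
  define g where "g M = (1 - 2 * \<zeta>) * ln (real M) - ln 2" for M :: nat
  have pp: "pulse_position N U s2 \<xi> v0 \<theta> \<alpha> L0 L (K M) M" if "K M > 0" "M > 0" for M
    by unfold_locales (use s2 \<alpha>_nonneg \<alpha>_summable L \<xi> heat \<theta> that in auto)
  have C_pos: "C > 0"
  proof -
    have "(if (0::nat) = 0 then \<xi>\<^sup>2 / (2 * v0) else \<theta>\<^sup>2 * (\<alpha> 0 * \<xi>\<^sup>2 / v0)\<^sup>2 / 2) \<le> C"
      unfolding C_def using v0
      by (intro member_le_sum[where f="\<lambda>i. if i = 0 then \<xi>\<^sup>2 / (2 * v0) else \<theta>\<^sup>2 * (\<alpha> i * \<xi>\<^sup>2 / v0)\<^sup>2 / 2"]) auto
    moreover have "\<xi>\<^sup>2 / (2 * v0) > 0" using \<xi>(3) v0(1) by simp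
    ultimately show ?thesis by simp
  qed
  have ln_lim: "filterlim (\<lambda>M::nat. ln (real M)) at_top at_top"
    by (rule filterlim_compose[OF ln_at_top filterlim_real_sequentially])
  have K_ge: "real (K M) \<ge> ln (real M) / D" for M
    unfolding K_def by (rule real_nat_ceiling_ge)
  have K_le: "real (K M) \<le> ln (real M) / D + 1" if "M > 0" for M
  proof -
    have "0 \<le> ln (real M) / D" using that D_pos by simp
    then show ?thesis unfolding K_def by linarith
  qed
  have K_lim: "filterlim (\<lambda>M. real (K M)) at_top at_top"
  proof (rule filterlim_at_top_mono)
    show "filterlim (\<lambda>M. 1 / D * ln (real M)) at_top at_top"
      using D_pos by (intro filterlim_tendsto_pos_mult_at_top[OF tendsto_const _ ln_lim]) simp
  qed (use K_ge in simp)

  have K_pos: "\<forall>\<^sub>F M in sequentially. real (K M) > 0"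
    using K_lim unfolding filterlim_at_top_dense by (rule spec)
  have err: "\<forall>\<^sub>F M in sequentially. exp (- real (K M) / (4 * C)) + real M * exp (- real (K M) * (D + 1)) < \<zeta> * ln 2"
  proof -
    have exp_lim: "((\<lambda>M. exp (- (a * real (K M)))) \<longlongrightarrow> 0) sequentially" if "a > 0" for a
    proof -
      have "filterlim (\<lambda>M. a * real (K M)) at_top sequentially"
        by (rule filterlim_tendsto_pos_mult_at_top[OF tendsto_const that K_lim])
      then have "filterlim (\<lambda>M. - (a * real (K M))) at_bot sequentially"
        by (simp add: filterlim_uminus_at_bot)
      then show ?thesis by (rule filterlim_compose[OF exp_at_bot])
    qed
    have "(\<lambda>M. exp (- (1 / (4 * C) * real (K M))) + exp (- (1 * real (K M)))) \<longlonglongrightarrow> 0 + 0"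
      using C_pos by (intro tendsto_add exp_lim) auto
    then have "\<forall>\<^sub>F M in sequentially. exp (- (1 / (4 * C) * real (K M))) + exp (- (1 * real (K M))) < \<zeta> * ln 2"
      by (rule order_tendstoD(2)) (use \<zeta> in simp)
    then show ?thesis
      using eventually_gt_at_top[of 0]
    proof eventually_elim
      case (elim M)
      have "real M * exp (- real (K M) * (D + 1)) = exp (ln (real M)) * exp (- real (K M) * (D + 1))"
        using elim(2) by simp
      also have "\<dots> = exp (ln (real M) - real (K M) * D) * exp (- real (K M))"
        unfolding mult_exp_exp by (rule arg_cong[where f=exp]) (simp add: algebra_simps)
      also have "\<dots> \<le> 1 * exp (- real (K M))"
        using K_ge[of M] D_pos by (intro mult_right_mono) (auto simp: pos_divide_le_eq)
      finally show ?case using elim(1) by simp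
    qed
  qed

  \<comment> \<open>The factor \<open>1 - 1 / M\<close> anticipates the rounding of
    \<open>M\<close>: the power budget guarantees only
    \<open>(M - 1) * L * snr * s2 \<le> \<xi>\<^sup>2\<close>.\<close>
  have rate: "\<forall>\<^sub>F M in sequentially. T < s2 * g M * (1 - 1 / real M) / (real (K M) * \<xi>\<^sup>2)"
  proof -
    have inv_ln: "(\<lambda>M::nat. 1 / ln (real M)) \<longlonglongrightarrow> 0"
      using tendsto_inverse_0_at_top[OF ln_lim] by (simp add: inverse_eq_divide)
    \<comment> \<open>Here \<open>g M / (ln M / D + 1)\<close> is written with numerator and
      denominator divided by \<open>ln M\<close>; the denominator is an upper bound for
      \<open>K M\<close>.\<close>
    have "(\<lambda>M. s2 / \<xi>\<^sup>2 * (((1 - 2 * \<zeta>) - ln 2 * (1 / ln (real M))) / (1 / D + 1 / ln (real M))) * (1 - 1 / real M))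
        \<longlonglongrightarrow> s2 / \<xi>\<^sup>2 * (((1 - 2 * \<zeta>) - ln 2 * 0) / (1 / D + 0)) * (1 - 0)"
      by (intro tendsto_intros inv_ln lim_1_over_n) (use D_pos in simp)
    then have lim: "(\<lambda>M. s2 / \<xi>\<^sup>2 * (((1 - 2 * \<zeta>) - ln 2 * (1 / ln (real M))) / (1 / D + 1 / ln (real M))) * (1 - 1 / real M))
        \<longlonglongrightarrow> (1 - 2 * \<zeta>) * (s2 * D / \<xi>\<^sup>2)"
      by (rule tendsto_eq_rhs) simp
    have "T < (1 - 2 * \<zeta>) * (s2 * D / \<xi>\<^sup>2)" using D_ge f\<zeta> by linarith
    with lim have "\<forall>\<^sub>F M in sequentially.
        T < s2 / \<xi>\<^sup>2 * (((1 - 2 * \<zeta>) - ln 2 * (1 / ln (real M))) / (1 / D + 1 / ln (real M))) * (1 - 1 / real M)"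
      by (rule order_tendstoD(1))
    moreover have "\<forall>\<^sub>F M::nat in sequentially. ln (real M) > max 0 (ln 2 / (1 - 2 * \<zeta>))"
      using ln_lim unfolding filterlim_at_top_dense by (rule spec)
    ultimately show ?thesis
      using K_pos eventually_gt_at_top[of 0]
    proof eventually_elim
      case (elim M)
      have ln_pos: "ln (real M) > 0"
        by (rule le_less_trans[OF _ elim(2)]) simp
      have "ln 2 / (1 - 2 * \<zeta>) < ln (real M)"
        by (rule le_less_trans[OF _ elim(2)]) simp
      then have g_pos: "g M > 0"
        using \<zeta> by (simp add: g_def pos_divide_less_eq mult.commute)
      have "((1 - 2 * \<zeta>) - ln 2 * (1 / ln (real M))) / (1 / D + 1 / ln (real M)) = g M / (ln (real M) / D + 1)"
        using ln_pos D_pos unfolding g_def by (simp add: divide_simps)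
      also have "\<dots> \<le> g M / real (K M)"
        using g_pos K_le[of M] elim by (intro divide_left_mono mult_pos_pos) auto
      finally have "s2 / \<xi>\<^sup>2 * (((1 - 2 * \<zeta>) - ln 2 * (1 / ln (real M))) / (1 / D + 1 / ln (real M))) * (1 - 1 / real M)
          \<le> s2 / \<xi>\<^sup>2 * (g M / real (K M)) * (1 - 1 / real M)"
        using s2 \<xi>(3) elim by (intro mult_right_mono mult_left_mono) auto
      then show ?case using elim(1) by (simp add: mult_ac)
    qed
  qed

  \<comment> \<open>The smallest number of slots for which one pulse per \<open>M * L\<close>
    instants respects the power; it tends to infinity as the SNR vanishes.\<close>
  define M where "M snr = nat \<lceil>\<xi>\<^sup>2 / (real L * (snr * s2))\<rceil>" for snr
  have M_lim: "filterlim M sequentially (at_right 0)"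
  proof -
    have "filterlim (\<lambda>snr. \<xi>\<^sup>2 / (real L * s2) * inverse snr) at_top (at_right 0)"
      using \<xi>(3) L(2) s2
      by (intro filterlim_tendsto_pos_mult_at_top[OF tendsto_const _ filterlim_inverse_at_top_right]) auto
    then have "filterlim (\<lambda>snr. real (M snr)) at_top (at_right 0)"
    proof (rule filterlim_at_top_mono)
      show "\<forall>\<^sub>F snr in at_right 0. \<xi>\<^sup>2 / (real L * s2) * inverse snr \<le> real (M snr)"
        unfolding M_def using real_nat_ceiling_ge[of "\<xi>\<^sup>2 / (real L * (_ * s2))"]
        by (intro always_eventually allI) (simp add: field_simps)
    qed
    then show ?thesis by (simp add: filterlim_sequentially_iff_filterlim_real)
  qed
  have "\<forall>\<^sub>F M in sequentially. M > 1 \<and> real (K M) > 0 \<and>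
      exp (- real (K M) / (4 * C)) + real M * exp (- real (K M) * (D + 1)) < \<zeta> * ln 2 \<and>
      T < s2 * g M * (1 - 1 / real M) / (real (K M) * \<xi>\<^sup>2)"
    by (intro eventually_conj eventually_gt_at_top K_pos err rate)
  then have "\<forall>\<^sub>F snr in at_right 0. M snr > 1 \<and> real (K (M snr)) > 0 \<and>
      exp (- real (K (M snr)) / (4 * C)) + real (M snr) * exp (- real (K (M snr)) * (D + 1)) < \<zeta> * ln 2 \<and>
      T < s2 * g (M snr) * (1 - 1 / real (M snr)) / (real (K (M snr)) * \<xi>\<^sup>2)"
    by (rule eventually_compose_filterlim[OF _ M_lim])
  moreover have "\<forall>\<^sub>F snr in at_right (0::real). snr > 0"
    by (rule eventually_at_right_less)
  ultimately show ?thesis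
  proof eventually_elim
    case (elim snr)
    let ?M = "M snr" and ?P = "snr * s2"
    let ?K = "K ?M"
    interpret pp: pulse_position N U s2 \<xi> v0 \<theta> \<alpha> L0 L ?K ?M
      by (rule pp) (use elim in auto)
    have P: "?P > 0" using elim s2 by simp
    have "pp.spread = C" by (simp add: pp.spread_def C_def)
    moreover have "pp.mean - pp.drift - 1 = D + 1"
      using pp.mean_minus_drift by (simp add: D_def)
    ultimately have "pp.block_error = exp (- real ?K / (4 * C)) + real ?M * exp (- real ?K * (D + 1))"
      by (simp only: pp.block_error_def)
    then have "pp.block_error < \<zeta> * ln 2"
      using elim by simp
    moreover have "\<xi>\<^sup>2 \<le> real (?M * L) * ?P"
    proof -
      have "\<xi>\<^sup>2 / (real L * ?P) \<le> real ?M" unfolding M_def by (rule real_nat_ceiling_ge)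
      then have "\<xi>\<^sup>2 \<le> real ?M * (real L * ?P)"
        by (subst (asm) pos_divide_le_eq) (use L P in \<open>auto intro: mult_pos_pos\<close>)
      then show ?thesis by (simp only: of_nat_mult mult.assoc)
    qed
    ultimately have ach: "achievable N U s2 \<alpha> ?P (g ?M / real (?M * ?K * L))"
      unfolding g_def using \<zeta> by (intro pp.achievable_pulse_position) auto
    have "T * snr \<le> g ?M / real (?M * ?K * L)"
    proof -
      have "0 \<le> \<xi>\<^sup>2 / (real L * ?P)" using P by simp
      then have "real ?M \<le> \<xi>\<^sup>2 / (real L * ?P) + 1" unfolding M_def by linarith
      then have "(real ?M - 1) * (real L * ?P) \<le> \<xi>\<^sup>2"
        by (subst pos_le_divide_eq[symmetric]) (use L P in \<open>auto intro: mult_pos_pos\<close>)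
      then have "T * ((real ?M - 1) * (real L * ?P)) \<le> s2 * g ?M * (1 - 1 / real ?M) / (real ?K * \<xi>\<^sup>2) * \<xi>\<^sup>2"
        using elim T(1) P L by (intro mult_mono) auto
      also have "\<dots> = s2 * g ?M * (1 - 1 / real ?M) / real ?K"
        using \<xi>(3) by simp
      also have "1 - 1 / real ?M = (real ?M - 1) / real ?M"
        using elim by (simp add: diff_divide_distrib)
      finally have "(real ?M - 1) * s2 * (T * snr * real L) \<le> (real ?M - 1) * s2 * (g ?M / (real ?M * real ?K))"
        by (simp add: mult_ac)
      then have "T * snr * real L \<le> g ?M / (real ?M * real ?K)"
        using elim s2 by (subst (asm) mult_le_cancel_left_pos) auto
      then have "T * snr \<le> g ?M / (real ?M * real ?K) / real L"
        using L by (subst pos_le_divide_eq) auto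
      then show ?thesis
        by (simp only: divide_divide_eq_left of_nat_mult)
    qed
    with ach show ?case by blast
  qed
qed

lemma achievable_imp_achievable_fb:
  assumes "achievable N U s2 \<alpha> P R"
  shows "achievable_fb N U s2 \<alpha> P R"
proof -
  obtain m \<phi> \<psi> where "\<forall>n\<ge>1. m n > 0 \<and> decoder n (m n) (\<psi> n) \<and> power_constraint N U n (m n) (\<lambda>i u. \<phi> n i) P"
    and "ereal R \<le> liminf (\<lambda>n. ereal (ln (real (m n)) / real n))"
    and "(\<lambda>n. error_prob N U s2 \<alpha> n (m n) (\<lambda>i u. \<phi> n i) (\<psi> n)) \<longlonglongrightarrow> 0"
    using assms unfolding achievable_def by blast
  moreover have "fb_input s2 \<alpha> (\<lambda>k i y. \<phi> n i k) = (\<lambda>i u. \<phi> n i)" for n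
    by (intro ext) (simp add: fb_input.simps)
  moreover have "fb_encoder n (m n) (\<lambda>k i y. \<phi> n i k)" for n
    by (simp add: fb_encoder_def)
  ultimately show ?thesis
    unfolding achievable_fb_def
    by (intro exI[of _ m] exI[of _ "\<lambda>n k i y. \<phi> n i k"] exI[of _ \<psi>]) simp
qed

text \<open>The converse with feedback is linear in the SNR and also bounds the smaller capacity
  without feedback, so both ratios stay below \<open>?c\<close> for every SNR. Codes without
  feedback approach \<open>?c\<close> as the SNR tends to 0, which gives the limit and both
  suprema.\<close>

theorem theorem2:
  fixes N :: "'w measure" and U :: "nat \<Rightarrow> 'w \<Rightarrow> real"
    and s2 :: real and \<alpha> :: "nat \<Rightarrow> real"
  assumes "prob_space N"
    and "prob_space.indep_vars N (\<lambda>_. borel) U {1..}"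
    and "\<And>k. k \<ge> 1 \<Longrightarrow> distributed N lborel (U k) (\<lambda>x. ennreal (std_normal_density x))"
    and "s2 > 0"
    and "\<And>l. l \<ge> 1 \<Longrightarrow> \<alpha> l \<ge> 0"
    and "bdd_above (\<alpha> ` {1..})"
    and "summable (\<lambda>l. \<alpha> (Suc l))"
  shows "capacity_per_unit_cost (capacity_fb N U s2 \<alpha>) = capacity_per_unit_cost (capacity N U s2 \<alpha>)
    \<and> ((\<lambda>snr. capacity N U s2 \<alpha> snr / ereal snr)
        \<longlongrightarrow> capacity_per_unit_cost (capacity N U s2 \<alpha>)) (at_right 0)
    \<and> capacity_per_unit_cost (capacity N U s2 \<alpha>) = ereal (1 / 2 * (1 + (\<Sum>l. \<alpha> (Suc l))))"
proof -
  interpret gaussian_noise N U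
    using assms(1-3) by (simp add: gaussian_noise_def gaussian_noise_axioms_def)
  let ?c = "1 / 2 * (1 + (\<Sum>l. \<alpha> (Suc l)))"
  let ?C = "capacity N U s2 \<alpha>" and ?F = "capacity_fb N U s2 \<alpha>"
  have C_le_F: "?C snr \<le> ?F snr" for snr
    unfolding capacity_def capacity_fb_def
    by (intro Sup_subset_mono) (auto intro: achievable_imp_achievable_fb)
  have F_le: "?F snr / ereal snr \<le> ereal ?c" if "snr > 0" for snr
  proof -
    have "?F snr \<le> ereal (?c * snr)"
      unfolding capacity_fb_def
    proof (rule Sup_least, clarify)
      fix R assume "achievable_fb N U s2 \<alpha> (snr * s2) R"
      then have "R \<le> ?c * (snr * s2) / s2"
        using that assms(4,5,7) by (intro achievable_fb_le) auto
      then show "ereal R \<le> ereal (?c * snr)" using assms(4) by simp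
    qed
    then have "?F snr / ereal snr \<le> ereal (?c * snr) / ereal snr"
      using that by (intro ereal_divide_right_mono) auto
    then show ?thesis using that by simp
  qed
  have C_le: "?C snr / ereal snr \<le> ereal ?c" if "snr > 0" for snr
    using ereal_divide_right_mono[OF C_le_F[of snr], of "ereal snr"] F_le[OF that] that by simp
  have C_ge: "\<forall>\<^sub>F snr in at_right 0. ereal T \<le> ?C snr / ereal snr" if T: "0 < T" "T < ?c" for T
  proof -
    have "\<forall>\<^sub>F snr in at_right 0. \<exists>R \<ge> T * snr. achievable N U s2 \<alpha> (snr * s2) R"
      by (rule achievable_low_snr) (use assms(4,5,7) T in auto)
    then show ?thesis
      using eventually_at_right_less[of 0]
    proof eventually_elim
      case (elim snr)
      then obtain R where R: "R \<ge> T * snr" "achievable N U s2 \<alpha> (snr * s2) R" by blast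
      have "ereal (T * snr) \<le> ereal R" using R by simp
      also have "\<dots> \<le> ?C snr" unfolding capacity_def using R by (intro Sup_upper) auto
      finally have "ereal (T * snr) / ereal snr \<le> ?C snr / ereal snr"
        using elim by (intro ereal_divide_right_mono) auto
      then show ?case using elim by simp
    qed
  qed
  have c_pos: "?c > 0"
  proof -
    have "0 \<le> (\<Sum>l. \<alpha> (Suc l))" using assms(5,7) by (intro suminf_nonneg) auto
    then show ?thesis by simp
  qed
  have lim: "((\<lambda>snr. ?C snr / ereal snr) \<longlongrightarrow> ereal ?c) (at_right 0)"
  proof (rule order_tendstoI)
    fix a assume "a < ereal ?c"
    \<comment> \<open>\<open>C_ge\<close> handles only positive targets, so a negative lower level
      is first raised to 0, which is still below \<open>?c\<close>.\<close>
    then have "max a 0 < ereal ?c" using c_pos by simp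
    then obtain T where T: "max a 0 < ereal T" "ereal T < ereal ?c"
      using ereal_dense2 by blast
    then have "\<forall>\<^sub>F snr in at_right 0. ereal T \<le> ?C snr / ereal snr" by (intro C_ge) auto
    then show "\<forall>\<^sub>F snr in at_right 0. a < ?C snr / ereal snr"
      by eventually_elim (use T in \<open>auto intro: less_le_trans\<close>)
  next
    fix a assume a: "ereal ?c < a"
    show "\<forall>\<^sub>F snr in at_right 0. ?C snr / ereal snr < a"
      using eventually_at_right_less[of 0] by eventually_elim (rule le_less_trans[OF C_le a])
  qed
  have C_cost: "capacity_per_unit_cost ?C = ereal ?c"
    unfolding capacity_per_unit_cost_def
  proof (rule antisym)
    show "(SUP snr\<in>{0<..}. ?C snr / ereal snr) \<le> ereal ?c"
      by (intro SUP_least) (use C_le in auto)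
    show "ereal ?c \<le> (SUP snr\<in>{0<..}. ?C snr / ereal snr)"
    proof (rule tendsto_upperbound[OF lim])
      show "\<forall>\<^sub>F snr in at_right 0. ?C snr / ereal snr \<le> (SUP snr\<in>{0<..}. ?C snr / ereal snr)"
        using eventually_at_right_less[of 0] by eventually_elim (auto intro: SUP_upper)
    qed simp
  qed
  have F_cost: "capacity_per_unit_cost ?F = ereal ?c"
  proof (rule antisym)
    show "capacity_per_unit_cost ?F \<le> ereal ?c"
      unfolding capacity_per_unit_cost_def by (intro SUP_least) (use F_le in auto)
    have "capacity_per_unit_cost ?C \<le> capacity_per_unit_cost ?F"
      unfolding capacity_per_unit_cost_def
      by (intro SUP_mono) (auto intro!: bexI ereal_divide_right_mono C_le_F)
    then show "ereal ?c \<le> capacity_per_unit_cost ?F" by (simp only: C_cost)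
  qed
  show ?thesis
    unfolding C_cost F_cost using lim by simp
qed

end
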